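(* Assume that $\lim_{m\to\infty}\alpha_m^{\mathbf a}=\alpha$ and $\lim_{n\to\infty}\beta_n^{\mathbf b}=\beta$ in the vague topology, and $\lim_{m\to\infty}\min\mathbf a_m=\mathfrak a$ and $\lim_{n\to\infty}\min\mathbf b_n=\mathfrak b$, for some nonzero subprobability measures $\alpha,\beta$ on $\mathbb R$ and some $\mathfrak a,\mathfrak b\in\mathbb R\cup\{\infty\}$ with $\mathfrak a+\mathfrak b>0$. Let $\epsilon>0$. Then, $\mathbf P$-almost surely, there exists a random $L\in\mathbb Z_{>0}$ such that $$|\mathrm H^{\mathbf a,\mathbf b}(n,t)-\mathrm h(n,t)|\le\epsilon(t+n),\qquad |\sigma^{\mathbf a,\mathbf b}(n,t)-\mathrm h(n,t)+n|\le\epsilon(t+n),$$ $$|\mathrm F^{\mathbf a,\mathbf b}(m,t)-\mathrm f(m,t)|\le\epsilon(t+m)$$ for all $m,n\in\mathbb Z_{\ge L}$ and $t\in\mathbb R_{\ge0}$.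
   Context: $[n]=\{1,\dots,n\}$; $\mathrm{Exp}(\lambda)$ is the exponential distribution with rate $\lambda$ (mean $1/\lambda$). Fix two collections of real parameters $\mathbf a=\{\mathbf a_m(i):m\in\mathbb Z_{>0},i\in[m]\}$ and $\mathbf b=\{\mathbf b_n(j):n\in\mathbb Z_{>0},j\in[n]\}$ such that $\mathbf a_m(i)+\mathbf b_n(j)>0$ for all $m,n\in\mathbb Z_{>0}$, $i\in[m]$, $j\in[n]$. Write $\min\mathbf a_m=\min_{i\in[m]}\mathbf a_m(i)$ and $\min\mathbf b_n=\min_{j\in[n]}\mathbf b_n(j)$. Let $\alpha_m^{\mathbf a}=\frac1m\sum_{i=1}^m\delta_{\mathbf a_m(i)}$ and $\beta_n^{\mathbf b}=\frac1n\sum_{j=1}^n\delta_{\mathbf b_n(j)}$ be the empirical distributions. Vague convergence $\mu_n\to\mu$ of finite Borel measures on $\mathbb R$ means $\int f\,\mathrm d\mu_n\to\int f\,\mathrm d\mu$ for every continuous $f:\mathbb R\to\mathbb R$ vanishing at infinity. A subprobability measure is a nonnegative Borel measure of total mass at most $1$. Let $(\Omega,\mathbf P)$ be $\Omega=\mathbb R^{\mathbb Z_{>0}^2}$ with the product measure under which the coordinates are i.i.d. $\mathrm{Exp}(1)$. For each $m,n\in\mathbb Z_{>0}$ let $\{\omega_{m,n}^{\mathbf a,\mathbf b}(i,j): i\in[m],j\in[n]\}$ be independent random variables on $(\Omega,\mathbf P)$ with $\omega_{m,n}^{\mathbf a,\mathbf b}(i,j)\sim\mathrm{Exp}(\mathbf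 a_m(i)+\mathbf b_n(j))$; no assumption is made about the joint distribution of these collections for different $(m,n)$. The last-passage time is $\mathrm G^{\mathbf a,\mathbf b}(m,n)=\max_{\pi}\sum_{(i,j)\in\pi}\omega^{\mathbf a,\mathbf b}_{m,n}(i,j)$, the maximum over all up-right lattice paths $\pi$ from $(1,1)$ to $(m,n)$ (steps $(1,0)$ or $(0,1)$). For $m,n\in\mathbb Z_{>0}$ and $t\ge0$, the height, particle and flux processes are (with $\sup\emptyset=-\infty$) $$\mathrm H^{\mathbf a,\mathbf b}(n,t)=\max\{\sup\{m\in\mathbb Z_{>0}:\mathrm G^{\mathbf a,\mathbf b}(m,n)\le t\},0\},\qquad \sigma^{\mathbf a,\mathbf b}(n,t)=\mathrm H^{\mathbf a,\mathbf b}(n,t)-n+1,$$ $$\mathrm F^{\mathbf a,\mathbf b}(m,t)=\max\{\sup\{n\in\mathbb Z_{>0}:\mathrm G^{\mathbf a,\mathbf b}(m+n-1,n)\le t\},0\}.$$ With $\mathrm A(z)=\int_{\mathbb R}\frac{\alpha(\mathrm da)}{a+z}$ and $\mathrm B(z)=\int_{\mathbb R}\frac{\beta(\mathrm db)}{b-z}$ for $z\in(-\mathfrak a,\mathfrak b)$, the limiting height and flux functions are, for $x,y,t\ge0$, $$\mathrm h(y,t)=\max\Big\{\sup_{z\in(-\mathfrak a,\mathfrak b)}\frac{t-y\,\mathrm B(z)}{\mathrm A(z)},0\Big\},\qquad \mathrm f(x,t)=\max\Big\{\sup_{z\in(-\mathfrak a,\mathfrak b)}\frac{t-x\,\mathrm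 A(z)}{\mathrm A(z)+\mathrm B(z)},0\Big\}.$$ *)

theory Defs
  imports "HOL-Probability.Probability"
begin

text \<open>
  Parameter arrays have type \<^typ>\<open>nat \<Rightarrow> nat \<Rightarrow> real\<close>; only the entries \<open>a m i\<close> with
  \<open>m \<ge> 1\<close> and \<open>i \<in> {1..m}\<close> are meaningful. Suprema are taken in \<^typ>\<open>ereal\<close>, so
  \<open>sup {} = -\<infinity>\<close>, and \<open>\<infinity> - \<infinity> = \<infinity>\<close>: a real bound on the absolute value of a difference
  of two extended reals that are not \<open>-\<infinity>\<close> therefore forces both of them to be finite.
\<close>

definition empirical_distribution :: "(nat \<Rightarrow> nat \<Rightarrow> real) \<Rightarrow> nat \<Rightarrow> real measure" where
  "empirical_distribution a m = distr (uniform_count_measure {1..m}) borel (a m)"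

definition min_param :: "(nat \<Rightarrow> nat \<Rightarrow> real) \<Rightarrow> nat \<Rightarrow> real" where
  "min_param a m = (MIN i\<in>{1..m}. a m i)"

text \<open>Test functions are the continuous functions vanishing at infinity.\<close>

definition vague_conv :: "(nat \<Rightarrow> real measure) \<Rightarrow> real measure \<Rightarrow> bool" where
  "vague_conv \<mu>s \<mu> \<longleftrightarrow>
     (\<forall>f :: real \<Rightarrow> real. continuous_on UNIV f \<longrightarrow> (f \<longlongrightarrow> 0) at_infinity \<longrightarrow>
        (\<lambda>n. \<integral>x. f x \<partial>\<mu>s n) \<longlonglongrightarrow> (\<integral>x. f x \<partial>\<mu>))"

definition exp_product_space :: "(nat \<times> nat \<Rightarrow> real) measure" where
  "exp_product_space =
     (\<Pi>\<^sub>M p\<in>{1..} \<times> {1..}. density lborel (\<lambda>x. ennreal (exponential_density 1 x)))"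

lemma prob_space_exp_product_space: "prob_space exp_product_space"
  unfolding exp_product_space_def
  by (intro prob_space_PiM prob_space_exponential_density) simp

definition up_right_paths :: "nat \<Rightarrow> nat \<Rightarrow> (nat \<times> nat) list set" where
  "up_right_paths m n =
     {\<pi>. \<pi> \<noteq> [] \<and> hd \<pi> = (1, 1) \<and> last \<pi> = (m, n) \<and>
         successively (\<lambda>(i, j) q. q = (i + 1, j) \<or> q = (i, j + 1)) \<pi>}"

text \<open>The argument is a single weight configuration, i.e. one realization.\<close>

definition last_passage :: "(nat \<times> nat \<Rightarrow> real) \<Rightarrow> nat \<Rightarrow> nat \<Rightarrow> real" where
  "last_passage w m n = (MAX \<pi>\<in>up_right_paths m n. \<Sum>p\<leftarrow>\<pi>. w p)"

text \<open>
  In the next three definitions \<open>G m n\<close> is the realized last-passage time to \<open>(m, n)\<close>.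
  Since the joint law of the weights for different \<open>(m, n)\<close> is arbitrary, \<open>G\<close> need not
  be monotone and the suprema may be infinite.
\<close>

definition height_process :: "(nat \<Rightarrow> nat \<Rightarrow> real) \<Rightarrow> nat \<Rightarrow> real \<Rightarrow> ereal" where
  "height_process G n t = max (SUP m\<in>{m. m \<ge> 1 \<and> G m n \<le> t}. ereal (real m)) 0"

definition particle_process :: "(nat \<Rightarrow> nat \<Rightarrow> real) \<Rightarrow> nat \<Rightarrow> real \<Rightarrow> ereal" where
  "particle_process G n t = height_process G n t - ereal (real n) + 1"

definition flux_process :: "(nat \<Rightarrow> nat \<Rightarrow> real) \<Rightarrow> nat \<Rightarrow> real \<Rightarrow> ereal" where
  "flux_process G m t = max (SUP n\<in>{n. n \<ge> 1 \<and> G (m + n - 1) n \<le> t}. ereal (real n)) 0"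

definition A_transform :: "real measure \<Rightarrow> real \<Rightarrow> real" where
  "A_transform \<alpha> z = (\<integral>a. 1 / (a + z) \<partial>\<alpha>)"

definition B_transform :: "real measure \<Rightarrow> real \<Rightarrow> real" where
  "B_transform \<beta> z = (\<integral>b. 1 / (b - z) \<partial>\<beta>)"

definition limit_height ::
    "real measure \<Rightarrow> real measure \<Rightarrow> ereal \<Rightarrow> ereal \<Rightarrow> real \<Rightarrow> real \<Rightarrow> ereal" where
  "limit_height \<alpha> \<beta> \<aa> \<bb> y t =
     max (SUP z\<in>{z. - \<aa> < ereal z \<and> ereal z < \<bb>}.
            ereal ((t - y * B_transform \<beta> z) / A_transform \<alpha> z)) 0"

definition limit_flux ::
    "real measure \<Rightarrow> real measure \<Rightarrow> ereal \<Rightarrow> ereal \<Rightarrow> real \<Rightarrow> real \<Rightarrow> ereal" where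
  "limit_flux \<alpha> \<beta> \<aa> \<bb> x t =
     max (SUP z\<in>{z. - \<aa> < ereal z \<and> ereal z < \<bb>}.
            ereal ((t - x * A_transform \<alpha> z) / (A_transform \<alpha> z + B_transform \<beta> z))) 0"

end

theory Submission
  imports Defs
begin

text \<open>
  Put boundary weights \<open>Exp (a i + z)\<close> and \<open>Exp (b j - z)\<close> on the axes. By Burke's theorem the
  increments of the resulting passage time along the right and bottom sides are independent
  exponentials, so it concentrates around \<open>\<Sum> 1 / (a i + z) + \<Sum> 1 / (b j - z)\<close>; this bounds the
  bulk passage time from above. For the lower bound choose \<open>z\<close> with
  \<open>\<Sum> 1 / (a i + z)^2 = \<Sum> 1 / (b j - z)^2\<close>. Perturbing \<open>z\<close> then changes the mean only to second
  order, while a path that leaves an axis at macroscopic distance would see a change of first order.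
  Hence optimal paths leave the axes near the origin, and bulk and stationary passage times agree up
  to an error that is linear with arbitrarily small slope. In directions where the limit admits no
  such \<open>z\<close> (flat regions), the column or row with the smallest parameter acts as the boundary.
  All error probabilities are exponentially small in \<open>m + n\<close>, so compactness of the set of
  directions and the Borel-Cantelli lemma give an almost sure shape theorem, which is inverted
  deterministically.
\<close>

subsection \<open>Last-passage recursions\<close>

text \<open>Nothing relates the weights for different (m, n), so neither monotonicity nor a
  subadditive ergodic theorem along a ray is available. Every (m, n) is estimated alone with an
  exponentially small failure probability, and the pairs with a given m + n then cost only a linear
  factor. Only the sums a i + b j are given, so the split into a i + z and b j - z is free and every
  z yields an upper bound. The limit is an infimum over z of a convex function whose derivative is
  the difference of the two sums of squares. The exit point of a stationary path is never described
  in law. The path is re-evaluated after enlarging the boundary weights of the axis it uses, with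
  the interior fixed; the enlarged model is again stationary, with z moved by h. Rates are not
  bounded above, so the relative gain h / u has no lower bound; weighted boundary sums make up for
  this. Vague convergence sees only functions vanishing at infinity. The function 1 / (x + z)
  becomes one after its pole is cut off, which the convergence of the minima permits.\<close>

text \<open>The entries \<open>x (i, 0)\<close> and \<open>x (0, j)\<close> are boundary weights; \<open>x (0, 0)\<close> is ignored.\<close>

fun lpp :: "(nat \<times> nat \<Rightarrow> real) \<Rightarrow> nat \<Rightarrow> nat \<Rightarrow> real" where
  "lpp x 0 0 = 0"
| "lpp x (Suc i) 0 = lpp x i 0 + x (Suc i, 0)"
| "lpp x 0 (Suc j) = lpp x 0 j + x (0, Suc j)"
| "lpp x (Suc i) (Suc j) = max (lpp x i (Suc j)) (lpp x (Suc i) j) + x (Suc i, Suc j)"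

text \<open>Zero weights on the axes let the interior passage time share the recursion, and so all
  comparison lemmas, with the stationary one. For nonnegative weights it is the maximum over
  interior paths, since a zero axis value never beats a genuine predecessor.\<close>

definition bulk :: "(nat \<times> nat \<Rightarrow> real) \<Rightarrow> nat \<Rightarrow> nat \<Rightarrow> real" where
  "bulk x = lpp (\<lambda>p. if fst p = 0 \<or> snd p = 0 then 0 else x p)"

lemma lpp_axes: "lpp x m 0 = (\<Sum>i=1..m. x (i, 0))" "lpp x 0 n = (\<Sum>j=1..n. x (0, j))"
  by (induction m; simp)+ (induction n; simp)

lemma bulk_simps [simp]:
  "bulk x m 0 = 0" "bulk x 0 n = 0"
  "bulk x (Suc i) (Suc j) = max (bulk x i (Suc j)) (bulk x (Suc i) j) + x (Suc i, Suc j)"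
  by (simp_all add: bulk_def lpp_axes)

lemma lpp_cong:
  assumes "\<And>p. p \<in> {..m} \<times> {..n} \<Longrightarrow> x p = y p"
  shows "lpp x m n = lpp y m n"
  using assms by (induction x m n rule: lpp.induct) auto

lemma lpp_mono:
  assumes "\<And>p. p \<in> {..m} \<times> {..n} \<Longrightarrow> x p \<le> y p"
  shows "lpp x m n \<le> lpp y m n"
  using assms
proof (induction x m n rule: lpp.induct)
  case (4 x i j)
  have "lpp x i (Suc j) \<le> lpp y i (Suc j)" "lpp x (Suc i) j \<le> lpp y (Suc i) j"
    "x (Suc i, Suc j) \<le> y (Suc i, Suc j)"
    using 4 by auto
  then show ?case by (simp add: max_def)
qed (auto intro!: add_mono)

lemma bulk_cong:
  assumes "\<And>p. p \<in> {1..m} \<times> {1..n} \<Longrightarrow> x p = y p"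
  shows "bulk x m n = bulk y m n"
  unfolding bulk_def by (rule lpp_cong) (use assms in auto)

lemma bulk_mono:
  assumes "\<And>p. p \<in> {1..m} \<times> {1..n} \<Longrightarrow> x p \<le> y p"
  shows "bulk x m n \<le> bulk y m n"
  unfolding bulk_def by (rule lpp_mono) (use assms in auto)

lemma bulk_le_lpp:
  assumes "\<And>p. p \<in> {..m} \<times> {..n} \<Longrightarrow> x p \<ge> 0"
  shows "bulk x m n \<le> lpp x m n"
  unfolding bulk_def by (rule lpp_mono) (use assms in auto)

lemma bulk_transpose: "bulk (\<lambda>p. x (snd p, fst p)) n m = bulk x m n"
proof (induction n arbitrary: m)
  case (Suc n)
  then show ?case
  proof (induction m)
    case (Suc m)
    then show ?case by (simp add: max.commute)
  qed simp
qed simp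

lemma lpp_nonneg:
  assumes "\<And>p. p \<in> {..m} \<times> {..n} \<Longrightarrow> x p \<ge> 0"
  shows "lpp x m n \<ge> 0"
  using assms by (induction x m n rule: lpp.induct) (auto intro!: add_nonneg_nonneg simp: le_max_iff_disj)

lemma bulk_nonneg:
  assumes "\<And>p. p \<in> {1..m} \<times> {1..n} \<Longrightarrow> x p \<ge> 0"
  shows "bulk x m n \<ge> 0"
  unfolding bulk_def by (rule lpp_nonneg) (use assms in auto)

text \<open>Concatenation of a path to (k, l) with a path in the rectangle whose lower left cell is
  (k + 1, l + 1); nonnegative weights pay for the connecting cell. Degenerate sizes are included
  because the blocks cut out around a slow column may be empty.\<close>

lemma bulk_superadditive:
  assumes "\<And>p. p \<in> {1..k+m} \<times> {1..l+n} \<Longrightarrow> x p \<ge> 0"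
  shows "bulk x k l + bulk (\<lambda>p. x (k + fst p, l + snd p)) m n \<le> bulk x (k+m) (l+n)"
  using assms
proof (induction m arbitrary: n)
  case 0
  have "bulk x k l \<le> bulk x k (l+n)"
    using 0
  proof (induction n)
    case (Suc n)
    then have IH: "bulk x k l \<le> bulk x k (l+n)" by auto
    show ?case
    proof (cases k)
      case (Suc k')
      then show ?thesis using IH Suc.prems[of "(k, Suc (l+n))"] by auto
    qed simp
  qed simp
  then show ?case by simp
next
  case (Suc m)
  note IHm = Suc.IH
  show ?case using Suc.prems
  proof (induction n)
    case 0
    have "bulk x k l \<le> bulk x (k+m) l" using IHm[of 0] 0 by auto
    also have "\<dots> \<le> bulk x (k + Suc m) l"
    proof (cases l)
      case (Suc l')
      then show ?thesis using 0[of "(Suc (k+m), l)"] by auto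
    qed simp
    finally show ?case by simp
  next
    case (Suc n)
    have "bulk x k l + bulk (\<lambda>p. x (k + fst p, l + snd p)) m (Suc n) \<le> bulk x (k+m) (l+Suc n)"
      using Suc.prems by (intro IHm) auto
    moreover have "bulk x k l + bulk (\<lambda>p. x (k + fst p, l + snd p)) (Suc m) n \<le> bulk x (k+Suc m) (l+n)"
      using Suc.prems by (intro Suc.IH) auto
    ultimately show ?case by (simp add: max_def)
  qed
qed

lemma bulk_one_col: "bulk x 1 n = (\<Sum>j=1..n. x (1, j))"
  if "\<And>p. p \<in> {1..1} \<times> {1..n} \<Longrightarrow> x p \<ge> 0"
proof -
  have "bulk x (Suc 0) n = (\<Sum>j=1..n. x (1, j)) \<and> bulk x (Suc 0) n \<ge> 0"
    using that
  proof (induction n)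
    case (Suc n)
    then show ?case by (auto simp: max_def)
  qed simp
  then show ?thesis by simp
qed

text \<open>The witness \<open>R\<close> is the passage time from the point where an optimal path leaves the axes.
  It does not depend on the boundary weights, so it can be compared with another choice of them.\<close>

lemma lpp_exit_point:
  shows "\<exists>R \<le> bulk x m n.
     (\<exists>k\<le>m. lpp x m n = (\<Sum>i=1..k. x (i, 0)) + R \<and>
        (\<forall>y. (\<forall>p\<in>{1..}\<times>{1..}. y p = x p) \<longrightarrow> (\<Sum>i=1..k. y (i, 0)) + R \<le> lpp y m n)) \<or>
     (\<exists>k\<le>n. lpp x m n = (\<Sum>j=1..k. x (0, j)) + R \<and>
        (\<forall>y. (\<forall>p\<in>{1..}\<times>{1..}. y p = x p) \<longrightarrow> (\<Sum>j=1..k. y (0, j)) + R \<le> lpp y m n))"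
proof (induction x m n rule: lpp.induct)
  case (4 x i j)
  \<comment> \<open>The pair (i', j') is the predecessor of (Suc i, Suc j) on an optimal path for x.
    For other boundary weights the same step is admissible but perhaps not optimal, which is why y
    satisfies only an inequality.\<close>
  define i' j' where "i' = (if lpp x i (Suc j) \<ge> lpp x (Suc i) j then i else Suc i)"
    and "j' = (if lpp x i (Suc j) \<ge> lpp x (Suc i) j then Suc j else j)"
  define w where "w = x (Suc i, Suc j)"
  have le: "i' \<le> Suc i" "j' \<le> Suc j" by (auto simp: i'_def j'_def)
  have *: "lpp x (Suc i) (Suc j) = lpp x i' j' + w"
     "bulk x i' j' + w \<le> bulk x (Suc i) (Suc j)"
     by (auto simp: i'_def j'_def w_def)
  have **: "lpp y i' j' + w \<le> lpp y (Suc i) (Suc j)" if "\<forall>p\<in>{1..}\<times>{1..}. y p = x p" for y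
    using that by (auto simp: i'_def j'_def w_def)
  have "\<exists>R \<le> bulk x i' j'.
     (\<exists>k\<le>i'. lpp x i' j' = (\<Sum>i=1..k. x (i, 0)) + R \<and>
        (\<forall>y. (\<forall>p\<in>{1..}\<times>{1..}. y p = x p) \<longrightarrow> (\<Sum>i=1..k. y (i, 0)) + R \<le> lpp y i' j')) \<or>
     (\<exists>k\<le>j'. lpp x i' j' = (\<Sum>j=1..k. x (0, j)) + R \<and>
        (\<forall>y. (\<forall>p\<in>{1..}\<times>{1..}. y p = x p) \<longrightarrow> (\<Sum>j=1..k. y (0, j)) + R \<le> lpp y i' j'))"
    using 4 by (auto simp: i'_def j'_def)
  then obtain R where R: "R \<le> bulk x i' j'" and
    "(\<exists>k\<le>i'. lpp x i' j' = (\<Sum>i=1..k. x (i, 0)) + R \<and>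
        (\<forall>y. (\<forall>p\<in>{1..}\<times>{1..}. y p = x p) \<longrightarrow> (\<Sum>i=1..k. y (i, 0)) + R \<le> lpp y i' j')) \<or>
     (\<exists>k\<le>j'. lpp x i' j' = (\<Sum>j=1..k. x (0, j)) + R \<and>
        (\<forall>y. (\<forall>p\<in>{1..}\<times>{1..}. y p = x p) \<longrightarrow> (\<Sum>j=1..k. y (0, j)) + R \<le> lpp y i' j'))"
    (is "(\<exists>k. ?P k) \<or> (\<exists>k. ?Q k)") by blast
  then consider k where "?P k" | k where "?Q k" by blast
  then show ?case
  proof cases
    case 1
    have "k \<le> Suc i" using 1 le by linarith
    moreover have "lpp x (Suc i) (Suc j) = (\<Sum>i=1..k. x (i, 0)) + (R + w)" using 1 * by linarith
    moreover have "(\<Sum>i=1..k. y (i, 0)) + (R + w) \<le> lpp y (Suc i) (Suc j)"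
      if "\<forall>p\<in>{1..}\<times>{1..}. y p = x p" for y
    proof -
      have "(\<Sum>i=1..k. y (i, 0)) + R \<le> lpp y i' j'" using 1 that by blast
      then show ?thesis using **[OF that] by linarith
    qed
    moreover have "R + w \<le> bulk x (Suc i) (Suc j)" using * R by linarith
    ultimately show ?thesis by blast
  next
    case 2
    have "k \<le> Suc j" using 2 le by linarith
    moreover have "lpp x (Suc i) (Suc j) = (\<Sum>j=1..k. x (0, j)) + (R + w)" using 2 * by linarith
    moreover have "(\<Sum>j=1..k. y (0, j)) + (R + w) \<le> lpp y (Suc i) (Suc j)"
      if "\<forall>p\<in>{1..}\<times>{1..}. y p = x p" for y
    proof -
      have "(\<Sum>j=1..k. y (0, j)) + R \<le> lpp y i' j'" using 2 that by blast
      then show ?thesis using **[OF that] by linarith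
    qed
    moreover have "R + w \<le> bulk x (Suc i) (Suc j)" using * R by linarith
    ultimately show ?thesis by blast
  qed
next
  case (1 x)
  show ?case by (intro exI[of _ 0]) auto
next
  case (2 x i)
  show ?case by (intro exI[of _ 0] conjI disjI1 exI[of _ "Suc i"]) (auto simp: lpp_axes)
next
  case (3 x j)
  show ?case by (intro exI[of _ 0] conjI disjI2 exI[of _ "Suc j"]) (auto simp: lpp_axes)
qed

subsection \<open>Paths\<close>

abbreviation up_right :: "nat \<times> nat \<Rightarrow> nat \<times> nat \<Rightarrow> bool" where
  "up_right \<equiv> \<lambda>(i, j) q. q = (i + 1, j) \<or> q = (i, j + 1)"

lemma up_right_path_bounds:
  assumes "\<pi> \<noteq> []" "hd \<pi> = (1, 1)" "successively up_right \<pi>"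
  shows "set \<pi> \<subseteq> {1..fst (last \<pi>)} \<times> {1..snd (last \<pi>)} \<and>
    length \<pi> + 1 = fst (last \<pi>) + snd (last \<pi>)"
  using assms
proof (induction \<pi> rule: rev_induct)
  case (snoc p \<pi>)
  show ?case
  proof (cases "\<pi> = []")
    case True
    then show ?thesis using snoc by auto
  next
    case False
    then have "hd \<pi> = (1, 1)" "successively up_right \<pi>" "up_right (last \<pi>) p"
      using snoc.prems by (auto simp: successively_append_iff)
    then have "set \<pi> \<subseteq> {1..fst (last \<pi>)} \<times> {1..snd (last \<pi>)}"
      "length \<pi> + 1 = fst (last \<pi>) + snd (last \<pi>)"
      using snoc.IH[OF False] by auto
    moreover obtain i j where ij: "last \<pi> = (i, j)" by force
    moreover have "(i, j) \<in> set \<pi>" using False ij by (metis last_in_set)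
    moreover have "p = (i + 1, j) \<or> p = (i, j + 1)" using \<open>up_right (last \<pi>) p\<close> ij by simp
    ultimately show ?thesis by fastforce
  qed
qed simp

lemma finite_up_right_paths: "finite (up_right_paths m n)"
proof (rule finite_subset)
  show "up_right_paths m n \<subseteq> {\<pi>. set \<pi> \<subseteq> {1..m} \<times> {1..n} \<and> length \<pi> \<le> m + n}"
    using up_right_path_bounds by (fastforce simp: up_right_paths_def)
qed (simp add: finite_lists_length_le)

text \<open>The endpoint is \<open>last \<pi>\<close> and not a fixed (m, n), so that reverse
  induction can strip the final vertex and use the claim for a smaller rectangle.\<close>

lemma up_right_path_sum_le_bulk:
  assumes "\<pi> \<noteq> []" "hd \<pi> = (1, 1)" "successively up_right \<pi>"
    and "\<And>p. p \<in> {1..fst (last \<pi>)} \<times> {1..snd (last \<pi>)} \<Longrightarrow> w p \<ge> 0"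
  shows "(\<Sum>p\<leftarrow>\<pi>. w p) \<le> bulk w (fst (last \<pi>)) (snd (last \<pi>))"
  using assms
proof (induction \<pi> rule: rev_induct)
  case (snoc p \<pi>)
  show ?case
  proof (cases "\<pi> = []")
    case True
    then show ?thesis using snoc by auto
  next
    case False
    then have *: "hd \<pi> = (1, 1)" "successively up_right \<pi>" "up_right (last \<pi>) p"
      using snoc.prems by (auto simp: successively_append_iff)
    obtain i j where ij: "last \<pi> = (i, j)" by force
    have "(i, j) \<in> set \<pi>" using False ij by (metis last_in_set)
    then have pos: "i \<ge> 1" "j \<ge> 1" using up_right_path_bounds[OF False *(1,2)] by auto
    then obtain i' j' where s: "i = Suc i'" "j = Suc j'" by (metis Suc_le_D One_nat_def)
    have IH: "(\<Sum>p\<leftarrow>\<pi>. w p) \<le> bulk w i j"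
      using snoc.IH[OF False *(1,2)] snoc.prems(4) *(3) ij by force
    from *(3) ij consider "p = (i+1, j)" | "p = (i, j+1)" by auto
    then show ?thesis
      using IH unfolding s by cases auto
  qed
qed simp

lemma bulk_attained:
  assumes "\<And>p. p \<in> {1..Suc m} \<times> {1..Suc n} \<Longrightarrow> w p \<ge> 0"
  shows "\<exists>\<pi>\<in>up_right_paths (Suc m) (Suc n). (\<Sum>p\<leftarrow>\<pi>. w p) = bulk w (Suc m) (Suc n)"
  using assms
proof (induction "m + n" arbitrary: m n)
  case 0
  then show ?case by (intro bexI[of _ "[(1, 1)]"]) (auto simp: up_right_paths_def)
next
  case (Suc k)
  have ext: ?case if "\<pi> \<in> up_right_paths i j" "(\<Sum>p\<leftarrow>\<pi>. w p) + w (Suc m, Suc n) = bulk w (Suc m) (Suc n)"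
     "up_right (i, j) (Suc m, Suc n)" for \<pi> i j
    using that by (intro bexI[of _ "\<pi> @ [(Suc m, Suc n)]"])
      (auto simp: up_right_paths_def successively_append_iff)
  have left: ?case if "m = Suc m'" "bulk w m (Suc n) \<ge> bulk w (Suc m) n" for m'
  proof -
    have "\<exists>\<pi>\<in>up_right_paths (Suc m') (Suc n). (\<Sum>p\<leftarrow>\<pi>. w p) = bulk w (Suc m') (Suc n)"
      using Suc that by (intro Suc.hyps(1)) auto
    then show ?case using that ext[of _ m "Suc n"] by (auto simp: max_def)
  qed
  have down: ?case if "n = Suc n'" "bulk w m (Suc n) \<le> bulk w (Suc m) n" for n'
  proof -
    have "\<exists>\<pi>\<in>up_right_paths (Suc m) (Suc n'). (\<Sum>p\<leftarrow>\<pi>. w p) = bulk w (Suc m) (Suc n')"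
      using Suc that by (intro Suc.hyps(1)) auto
    then show ?case using that ext[of _ "Suc m" n] by (auto simp: max_def)
  qed
  consider "m = 0" | "n = 0" | m' n' where "m = Suc m'" "n = Suc n'" by (metis not0_implies_Suc)
  then show ?case
  proof cases
    \<comment> \<open>In the first column the recursion compares the true predecessor below with the
      zero axis on the left; nonnegativity makes the true one win.\<close>
    case 1
    then have "bulk w (Suc m) n \<ge> 0" using Suc by (intro bulk_nonneg) auto
    moreover obtain n' where "n = Suc n'" using 1 Suc by auto
    ultimately show ?thesis using 1 down by simp
  next
    case 2
    then have "bulk w m (Suc n) \<ge> 0" using Suc by (intro bulk_nonneg) auto
    moreover obtain m' where "m = Suc m'" using 2 Suc by auto
    ultimately show ?thesis using 2 left by simp
  next
    case 3
    then show ?thesis using left[OF 3(1)] down[OF 3(2)] by (meson linear)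
  qed
qed

lemma last_passage_eq_bulk:
  assumes "m \<ge> 1" "n \<ge> 1" and "\<And>p. p \<in> {1..m} \<times> {1..n} \<Longrightarrow> w p \<ge> 0"
  shows "last_passage w m n = bulk w m n"
proof -
  obtain \<pi> where "\<pi> \<in> up_right_paths m n" "(\<Sum>p\<leftarrow>\<pi>. w p) = bulk w m n"
    using bulk_attained[of "m-1" "n-1" w] assms by auto
  moreover have "(\<Sum>p\<leftarrow>\<pi>. w p) \<le> bulk w m n" if "\<pi> \<in> up_right_paths m n" for \<pi>
    using up_right_path_sum_le_bulk[of \<pi> w] that assms by (auto simp: up_right_paths_def)
  ultimately show ?thesis
    unfolding last_passage_def by (intro Max_eqI) (force simp: finite_up_right_paths)+
qed

subsection \<open>The Burke map\<close>

text \<open>During a sweep, \<open>x (i, 0)\<close> and \<open>x (0, j)\<close> hold the horizontal and vertical increments on the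
  current down-right path, and \<open>x (i, j)\<close> the weights above it.\<close>

definition burke_step :: "nat \<Rightarrow> nat \<Rightarrow> (nat \<times> nat \<Rightarrow> real) \<Rightarrow> nat \<times> nat \<Rightarrow> real" where
  "burke_step i j x = x(
     (i, 0) := x (i, j) + x (i, 0) - min (x (i, 0)) (x (0, j)),
     (0, j) := x (i, j) + x (0, j) - min (x (i, 0)) (x (0, j)),
     (i, j) := min (x (i, 0)) (x (0, j)))"

fun burke_col :: "nat \<Rightarrow> nat \<Rightarrow> (nat \<times> nat \<Rightarrow> real) \<Rightarrow> nat \<times> nat \<Rightarrow> real" where
  "burke_col i 0 x = x"
| "burke_col i (Suc j) x = burke_step i (Suc j) (burke_col i j x)"

fun burke :: "nat \<Rightarrow> nat \<Rightarrow> (nat \<times> nat \<Rightarrow> real) \<Rightarrow> nat \<times> nat \<Rightarrow> real" where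
  "burke 0 n x = x"
| "burke (Suc i) n x = burke_col (Suc i) n (burke i n x)"

text \<open>Let I and J be the increments on the bottom and left edges of a cell of weight w.
  Subtracting corner values in the recursion gives w + max I J - J = w + I - min I J on the top
  edge, and symmetrically on the right edge. After k cells the entries (0, j) describe column Suc i
  up to height k and still column i above it.\<close>

lemma burke_col_increments:
  assumes "\<And>j. j < n \<Longrightarrow> y (0, Suc j) = lpp x i (Suc j) - lpp x i j"
    and "\<And>j. y (Suc i, j) = x (Suc i, j)" and "k \<le> n"
  shows "(\<forall>j<n. burke_col (Suc i) k y (0, Suc j) =
             (if j < k then lpp x (Suc i) (Suc j) - lpp x (Suc i) j else lpp x i (Suc j) - lpp x i j)) \<and>
         burke_col (Suc i) k y (Suc i, 0) = lpp x (Suc i) k - lpp x i k \<and>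
         (\<forall>j>k. burke_col (Suc i) k y (Suc i, j) = x (Suc i, j)) \<and>
         (\<forall>i'>Suc i. \<forall>j. burke_col (Suc i) k y (i', j) = y (i', j))"
  using assms(3)
proof (induction k)
  case 0
  then show ?case using assms by simp
next
  case (Suc k)
  then show ?case
    by (auto simp: burke_step_def less_Suc_eq max_def min_def)
qed

lemma burke_increments:
  "(\<forall>j<n. burke i n x (0, Suc j) = lpp x i (Suc j) - lpp x i j) \<and> (\<forall>i'>i. \<forall>j. burke i n x (i', j) = x (i', j))"
proof (induction i)
  case 0
  then show ?case by simp
next
  case (Suc i)
  then show ?case using burke_col_increments[of n "burke i n x" x i n] by auto
qed

text \<open>Telescoping along the bottom side and then up the right side. The first sum consists of
  raw boundary weights and the second of coordinates of the Burke image, so each can be controlled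
  separately, without their joint law.\<close>

lemma lpp_eq_sum_burke:
  "lpp x m n = (\<Sum>i=1..m. x (i, 0)) + (\<Sum>j=1..n. burke m n x (0, j))"
proof -
  have "lpp x m k = lpp x m 0 + (\<Sum>j=1..k. burke m n x (0, j))" if "k \<le> n" for k
    using that by (induction k) (use burke_increments[of n m x] in auto)
  then show ?thesis by (simp add: lpp_axes)
qed

subsection \<open>Independent exponential families\<close>

definition exp_measure :: "real \<Rightarrow> real measure" where
  "exp_measure r = density lborel (\<lambda>x. ennreal (exponential_density r x))"

definition indep_exp ::
    "'s measure \<Rightarrow> (nat \<times> nat \<Rightarrow> 's \<Rightarrow> real) \<Rightarrow> (nat \<times> nat) set \<Rightarrow> (nat \<times> nat \<Rightarrow> real) \<Rightarrow> bool" where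
  "indep_exp M X K r \<longleftrightarrow> prob_space M \<and> prob_space.indep_vars M (\<lambda>_. borel) X K \<and>
     (\<forall>k\<in>K. 0 < r k \<and> distributed M lborel (X k) (exponential_density (r k)))"

lemma sets_exp_measure [simp, measurable_cong]: "sets (exp_measure r) = sets borel"
  by (simp add: exp_measure_def)

lemma space_exp_measure [simp]: "space (exp_measure r) = UNIV"
  by (simp add: exp_measure_def)

lemma prob_space_exp_measure: "r > 0 \<Longrightarrow> prob_space (exp_measure r)"
  unfolding exp_measure_def by (rule prob_space_exponential_density)

lemma indep_exp_prob_space: "indep_exp M X K r \<Longrightarrow> prob_space M"
  by (simp add: indep_exp_def)

lemma indep_exp_rate_pos: "indep_exp M X K r \<Longrightarrow> k \<in> K \<Longrightarrow> 0 < r k"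
  by (simp add: indep_exp_def)

lemma indep_exp_measurable: "indep_exp M X K r \<Longrightarrow> k \<in> K \<Longrightarrow> X k \<in> borel_measurable M"
  by (auto simp: indep_exp_def distributed_def)

lemma indep_exp_distr: "indep_exp M X K r \<Longrightarrow> k \<in> K \<Longrightarrow> distr M borel (X k) = exp_measure (r k)"
  by (auto simp: indep_exp_def distributed_def exp_measure_def cong: distr_cong)

lemma indep_exp_subset: "indep_exp M X K r \<Longrightarrow> J \<subseteq> K \<Longrightarrow> indep_exp M X J r"
  unfolding indep_exp_def by (auto intro: prob_space.indep_vars_subset)

lemma indep_exp_cong_rate: "indep_exp M X K r \<Longrightarrow> (\<And>k. k \<in> K \<Longrightarrow> r k = r' k) \<Longrightarrow> indep_exp M X K r'"
  unfolding indep_exp_def by auto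

text \<open>The coupling device of the whole proof: rates are changed by multiplying the weights on
  the same space, so that passage times with different rates can be compared pathwise.\<close>

lemma indep_exp_scale:
  assumes "indep_exp M X K r" "\<And>k. k \<in> K \<Longrightarrow> c k > 0"
  shows "indep_exp M (\<lambda>k x. c k * X k x) K (\<lambda>k. r k / c k)"
proof -
  interpret prob_space M using assms by (rule_tac indep_exp_prob_space)
  have "indep_vars (\<lambda>_. borel) (\<lambda>k x. c k * X k x) K"
    using assms by (intro indep_vars_compose2[where Y="\<lambda>k x. c k * x" and X=X]) (auto simp: indep_exp_def)
  moreover have "distributed M lborel (\<lambda>x. c k * X k x) (exponential_density (r k / c k))" if k: "k \<in> K" for k
  proof -
    have r: "r k > 0" "c k > 0" using assms k by (auto simp: indep_exp_def)
    have X: "X k \<in> borel_measurable M" "\<And>a. a \<ge> 0 \<Longrightarrow> \<P>(x in M. X k x \<le> a) = 1 - exp (- a * r k)"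
      using assms k r exponential_distributed_iff[of "r k" "X k"] by (auto simp: indep_exp_def)
    show ?thesis
      unfolding exponential_distributed_iff[OF divide_pos_pos[OF r]]
    proof (intro conjI allI impI)
      fix a :: real assume "a \<ge> 0"
      then have "\<P>(x in M. X k x \<le> a / c k) = 1 - exp (- (a / c k) * r k)" using r by (intro X) auto
      then show "\<P>(x in M. c k * X k x \<le> a) = 1 - exp (- a * (r k / c k))"
        using r by (simp add: field_simps)
    qed (use X in auto)
  qed
  ultimately show ?thesis using assms prob_space_axioms by (auto simp: indep_exp_def)
qed

text \<open>Serves translated sub-rectangles and the reflection in the diagonal.\<close>

lemma indep_exp_reindex:
  assumes "indep_exp M X K r" "inj_on f J" "f ` J \<subseteq> K"
  shows "indep_exp M (\<lambda>k. X (f k)) J (\<lambda>k. r (f k))"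
proof -
  interpret prob_space M using assms by (rule_tac indep_exp_prob_space)
  have ind: "indep_vars (\<lambda>_. borel) X (f ` J)"
    using assms by (auto simp: indep_exp_def intro: indep_vars_subset)
  have "indep_vars (\<lambda>_. borel) (\<lambda>k. X (f k)) J"
    unfolding indep_vars_def2
  proof (intro conjI ballI indep_setsI)
    fix A L assume L: "L \<noteq> {}" "L \<subseteq> J" "finite L"
      "\<forall>j\<in>L. A j \<in> {X (f j) -` B \<inter> space M |B. B \<in> sets borel}"
    have inj: "inj_on f L" using assms L inj_on_subset by blast
    define g where "g = the_inv_into L f"
    have g: "g (f l) = l" if "l \<in> L" for l
      using the_inv_into_f_f[OF inj that] by (simp add: g_def)
    have "prob (\<Inter>j\<in>f ` L. A (g j)) = (\<Prod>j\<in>f ` L. prob (A (g j)))"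
      using ind L g unfolding indep_vars_def2
      by (intro indep_setsD[of _ "f ` J"]) auto
    then show "prob (\<Inter>j\<in>L. A j) = (\<Prod>j\<in>L. prob (A j))"
      using inj g by (simp add: prod.reindex cong: prod.cong INF_cong)
  qed (use ind in \<open>auto simp: indep_vars_def2\<close>)
  then show ?thesis using assms prob_space_axioms by (auto simp: indep_exp_def)
qed

lemma indep_exp_joint_law:
  assumes "indep_exp M X K r" "K \<noteq> {}"
  shows "distr M (\<Pi>\<^sub>M k\<in>K. borel) (\<lambda>\<omega>. \<lambda>k\<in>K. X k \<omega>) = (\<Pi>\<^sub>M k\<in>K. exp_measure (r k))"
proof -
  interpret prob_space M using assms by (rule_tac indep_exp_prob_space)
  have "distr M (\<Pi>\<^sub>M k\<in>K. borel) (\<lambda>\<omega>. \<lambda>k\<in>K. X k \<omega>) = (\<Pi>\<^sub>M k\<in>K. distr M borel (X k))"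
    using assms indep_exp_measurable[OF assms(1)]
    by (subst indep_vars_iff_distr_eq_PiM'[symmetric]) (auto simp: indep_exp_def)
  also have "\<dots> = (\<Pi>\<^sub>M k\<in>K. exp_measure (r k))"
    using indep_exp_distr[OF assms(1)] by (intro PiM_cong) auto
  finally show ?thesis .
qed

lemma indep_exp_coordinates:
  assumes "K \<noteq> {}" "\<And>k. k \<in> K \<Longrightarrow> r k > 0"
  shows "indep_exp (\<Pi>\<^sub>M k\<in>K. exp_measure (r k)) (\<lambda>k x. x k) K r"
proof -
  let ?Q = "\<Pi>\<^sub>M k\<in>K. exp_measure (r k)"
  have pQ: "prob_space ?Q" using assms by (intro prob_space_PiM prob_space_exp_measure)
  then interpret prob_space ?Q .
  have comp: "distr ?Q borel (\<lambda>x. x k) = exp_measure (r k)" if "k \<in> K" for k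
  proof -
    have "distr ?Q borel (\<lambda>x. x k) = distr ?Q (exp_measure (r k)) (\<lambda>x. x k)"
      by (intro distr_cong) auto
    also have "\<dots> = exp_measure (r k)"
    proof -
      \<comment> \<open>Rates outside K are set to 1, so that the factor at every index is a
        probability space.\<close>
      define r' where "r' k = (if k \<in> K then r k else 1)" for k
      have "?Q = (\<Pi>\<^sub>M k\<in>K. exp_measure (r' k))" by (intro PiM_cong) (auto simp: r'_def)
      moreover have "distr (\<Pi>\<^sub>M k\<in>K. exp_measure (r' k)) (exp_measure (r' k)) (\<lambda>x. x k) = exp_measure (r' k)"
        using that assms by (intro distr_PiM_component prob_space_exp_measure) (auto simp: r'_def)
      ultimately show ?thesis using that by (simp add: r'_def)
    qed
    finally show ?thesis .
  qed
  have m: "(\<lambda>x. x k) \<in> borel_measurable ?Q" if "k \<in> K" for k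
    using that by (metis measurable_component_singleton measurable_cong_sets sets_exp_measure)
  have "distr ?Q (\<Pi>\<^sub>M k\<in>K. borel) (\<lambda>x. \<lambda>k\<in>K. x k) = distr ?Q ?Q (\<lambda>x. x)"
    by (intro distr_cong sets_PiM_cong) (auto simp: space_PiM extensional_restrict PiE_def)
  also have "\<dots> = ?Q" by simp
  also have "\<dots> = (\<Pi>\<^sub>M k\<in>K. distr ?Q borel (\<lambda>x. x k))"
    using comp by (intro PiM_cong) auto
  finally have "indep_vars (\<lambda>_. borel) (\<lambda>k x. x k) K"
    using assms(1) m by (subst indep_vars_iff_distr_eq_PiM') auto
  moreover have "distributed ?Q lborel (\<lambda>x. x k) (exponential_density (r k))" if "k \<in> K" for k
    using comp[OF that] m[OF that]
    by (auto simp: distributed_def exp_measure_def cong: distr_cong)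
  ultimately show ?thesis using assms pQ by (auto simp: indep_exp_def)
qed

text \<open>The joint law of the family decides the event. This is how statements leave M, which
  carries only the interior weights of one (m, n), for a product space that carries boundary weights
  too. The congruence assumption makes the values of a configuration off K irrelevant.\<close>

lemma indep_exp_transfer:
  assumes "indep_exp M X K r" "indep_exp M' X' K r"
    and "{x \<in> space (\<Pi>\<^sub>M k\<in>K. borel). P x} \<in> sets (\<Pi>\<^sub>M k\<in>K. borel)"
    and cong: "\<And>x y. (\<And>k. k \<in> K \<Longrightarrow> x k = y k) \<Longrightarrow> P x \<longleftrightarrow> P y"
  shows "measure M {\<omega>\<in>space M. P (\<lambda>k. X k \<omega>)} = measure M' {\<omega>\<in>space M'. P (\<lambda>k. X' k \<omega>)}"
proof (cases "K = {}")
  \<comment> \<open>Without indices the predicate is constant, so both probabilities equal 1 or both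
    equal 0.\<close>
  case True
  interpret M: prob_space M using assms by (rule_tac indep_exp_prob_space)
  interpret M': prob_space M' using assms by (rule_tac indep_exp_prob_space)
  have "P x \<longleftrightarrow> P y" for x y using cong True by blast
  then consider "\<And>x. P x" | "\<And>x. \<not> P x" by blast
  then show ?thesis by cases (auto simp: M.prob_space M'.prob_space)
next
  case False
  have *: "measure M {\<omega>\<in>space M. P (\<lambda>k. X k \<omega>)} = measure (\<Pi>\<^sub>M k\<in>K. exp_measure (r k)) {x \<in> space (\<Pi>\<^sub>M k\<in>K. borel). P x}"
    if "indep_exp M X K r" for X and M :: "'x measure"
  proof -
    have "(\<lambda>\<omega>. \<lambda>k\<in>K. X k \<omega>) \<in> measurable M (\<Pi>\<^sub>M k\<in>K. borel)"
      using indep_exp_measurable[OF that] by (intro measurable_restrict) auto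
    then have "measure (\<Pi>\<^sub>M k\<in>K. exp_measure (r k)) {x \<in> space (\<Pi>\<^sub>M k\<in>K. borel). P x} =
      measure M ((\<lambda>\<omega>. \<lambda>k\<in>K. X k \<omega>) -` {x \<in> space (\<Pi>\<^sub>M k\<in>K. borel). P x} \<inter> space M)"
      using assms(3) by (simp add: indep_exp_joint_law[OF that False, symmetric] measure_distr)
    also have "(\<lambda>\<omega>. \<lambda>k\<in>K. X k \<omega>) -` {x \<in> space (\<Pi>\<^sub>M k\<in>K. borel). P x} \<inter> space M
      = {\<omega>\<in>space M. P (\<lambda>k. X k \<omega>)}"
      using cong[of "\<lambda>k\<in>K. X k _" "\<lambda>k. X k _"] by (auto simp: space_PiM)
    finally show ?thesis by simp
  qed
  show ?thesis using *[OF assms(1)] *[OF assms(2)] by simp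
qed

lemma indep_exp_AE_nonneg:
  assumes "indep_exp M X K r" "countable K"
  shows "AE \<omega> in M. \<forall>k\<in>K. X k \<omega> \<ge> 0"
proof -
  have "AE \<omega> in M. X k \<omega> \<ge> 0" if "k \<in> K" for k
  proof -
    have "AE x in exp_measure (r k). x \<ge> 0"
      unfolding exp_measure_def by (subst AE_density) (auto simp: exponential_density_def)
    then have "AE x in distr M borel (X k). x \<ge> 0"
      by (simp only: indep_exp_distr[OF assms(1) that])
    then show ?thesis
      using indep_exp_measurable[OF assms(1) that] by (simp add: AE_distr_iff)
  qed
  then show ?thesis using assms(2) by (simp add: AE_ball_countable)
qed

subsection \<open>Chernoff bounds\<close>

text \<open>Exponential tilting: exp (s x) times the density of rate r is r / (r - s) times the
  density of rate r - s, which has total mass one.\<close>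

lemma nn_integral_exp_exp_measure:
  assumes "r > 0" "s < r"
  shows "(\<integral>\<^sup>+x. ennreal (exp (s * x)) \<partial>exp_measure r) = ennreal (r / (r - s))"
proof -
  interpret prob_space "exp_measure (r - s)" using assms by (intro prob_space_exp_measure) auto
  have "(\<integral>\<^sup>+x. ennreal (exp (s * x)) \<partial>exp_measure r) =
    (\<integral>\<^sup>+x. ennreal (exponential_density r x) * ennreal (exp (s * x)) \<partial>lborel)"
    by (simp add: exp_measure_def nn_integral_density)
  also have "\<dots> = (\<integral>\<^sup>+x. ennreal (r / (r - s)) * ennreal (exponential_density (r - s) x) \<partial>lborel)"
  proof (intro nn_integral_cong)
    fix x :: real
    have "exponential_density r x * exp (s * x) = r / (r - s) * exponential_density (r - s) x"
    proof (cases "x < 0")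
      case False
      have "exp (- x * r) * exp (s * x) = exp (- x * (r - s))"
        by (simp add: exp_add[symmetric] algebra_simps)
      then show ?thesis using assms False by (simp add: exponential_density_def)
    qed (simp add: exponential_density_def)
    then show "ennreal (exponential_density r x) * ennreal (exp (s * x)) =
      ennreal (r / (r - s)) * ennreal (exponential_density (r - s) x)"
      using assms by (simp add: ennreal_mult''[symmetric] ennreal_mult'[symmetric] exponential_density_nonneg)
  qed
  also have "\<dots> = ennreal (r / (r - s)) * emeasure (exp_measure (r - s)) UNIV"
    by (subst nn_integral_cmult) (auto simp: exp_measure_def emeasure_density)
  also have "\<dots> = ennreal (r / (r - s))" using emeasure_space_1 by simp
  finally show ?thesis .
qed

text \<open>With t = s / r this says - ln (1 - t) \<le> t + t^2. For t \<ge> 0 the difference has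
  derivative x (1 - 2 x) / (1 - x), nonnegative exactly up to x = 1/2; hence the restriction on
  s.\<close>

lemma exponential_mgf_bound:
  fixes r s :: real
  assumes "r > 0" "\<bar>s\<bar> \<le> r / 2"
  shows "r / (r - s) \<le> exp (s / r + (s / r)\<^sup>2)"
proof -
  define t where "t = s / r"
  have t: "\<bar>t\<bar> \<le> 1/2" using assms by (simp add: t_def field_simps abs_divide)
  have "- t - t\<^sup>2 \<le> ln (1 - t)"
  proof (cases "t \<ge> 0")
    case True

    define f where "f x = ln (1 - x) + x + x\<^sup>2" for x :: real
    have "f 0 \<le> f t"
    proof (rule DERIV_nonneg_imp_nondecreasing[OF True])
      fix x :: real assume x: "0 \<le> x" "x \<le> t"
      have "(f has_real_derivative (- 1 / (1 - x) + 1 + 2 * x)) (at x)"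
        using x t unfolding f_def by (auto intro!: derivative_eq_intros)
      moreover have "- 1 / (1 - x) + 1 + 2 * x \<ge> 0"
      proof -
        have "- 1 / (1 - x) + 1 + 2 * x = x * (1 - 2 * x) / (1 - x)" using x t by (simp add: field_simps)
        also have "\<dots> \<ge> 0" using x t by (intro divide_nonneg_nonneg mult_nonneg_nonneg) auto
        finally show ?thesis .
      qed
      ultimately show "\<exists>y. (f has_real_derivative y) (at x) \<and> 0 \<le> y" by blast
    qed
    then show ?thesis by (simp add: f_def)
  next
    case False
    have "(- t) - (- t)\<^sup>2 \<le> ln (1 + (- t))" using False t by (intro ln_one_plus_pos_lower_bound) auto
    then show ?thesis by simp
  qed
  then have "exp (- t - t\<^sup>2) \<le> 1 - t" using t by (simp add: ln_ge_iff)
  then have "inverse (1 - t) \<le> inverse (exp (- t - t\<^sup>2))" by (intro le_imp_inverse_le) auto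
  also have "\<dots> = exp (t + t\<^sup>2)" by (simp add: exp_minus[symmetric])
  also have "inverse (1 - t) = r / (r - s)" using assms by (simp add: t_def field_simps)
  finally show ?thesis by (simp add: t_def)
qed

text \<open>Centering by 1 / r k cancels the linear term of the exponent. What remains depends on
  the rates only through their lower bound \<eta>, so arbitrarily inhomogeneous families share one
  bound.\<close>

lemma indep_exp_mgf:
  assumes X: "indep_exp M X K r" and "finite K" "\<eta> > 0" "\<And>k. k \<in> K \<Longrightarrow> r k \<ge> \<eta>" "\<bar>s\<bar> \<le> \<eta> / 2"
  shows "(\<integral>\<^sup>+\<omega>. ennreal (exp (s * (\<Sum>k\<in>K. X k \<omega> - 1 / r k))) \<partial>M) \<le> ennreal (exp (real (card K) * (s / \<eta>)\<^sup>2))"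
proof -
  interpret prob_space M using X by (rule indep_exp_prob_space)
  have r: "r k > 0" if "k \<in> K" for k using assms(3) assms(4)[OF that] by linarith
  have one: "(\<integral>\<^sup>+\<omega>. ennreal (exp (s * (X k \<omega> - 1 / r k))) \<partial>M) \<le> ennreal (exp ((s / \<eta>)\<^sup>2))" if k: "k \<in> K" for k
  proof -
    have sk: "\<bar>s\<bar> \<le> r k / 2" using assms(4)[OF k] assms(5) by linarith
    have "(\<integral>\<^sup>+\<omega>. ennreal (exp (s * (X k \<omega> - 1 / r k))) \<partial>M) =
       (\<integral>\<^sup>+x. ennreal (exp (s * (x - 1 / r k))) \<partial>distr M borel (X k))"
      using indep_exp_measurable[OF X k] by (subst nn_integral_distr) auto
    also have "\<dots> = (\<integral>\<^sup>+x. ennreal (exp (- s / r k)) * ennreal (exp (s * x)) \<partial>exp_measure (r k))"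
      unfolding indep_exp_distr[OF X k]
      by (intro nn_integral_cong) (simp add: ennreal_mult'[symmetric] exp_add[symmetric] algebra_simps)
    also have "\<dots> = ennreal (exp (- s / r k)) * ennreal (r k / (r k - s))"
      using nn_integral_exp_exp_measure[of "r k" s] r[OF k] sk by (subst nn_integral_cmult) auto
    also have "\<dots> = ennreal (exp (- s / r k) * (r k / (r k - s)))"
      by (simp only: ennreal_mult' exp_ge_zero)
    also have "\<dots> \<le> ennreal (exp (- s / r k) * exp (s / r k + (s / r k)\<^sup>2))"
      using exponential_mgf_bound[OF r[OF k] sk] by (intro ennreal_leI mult_left_mono) auto
    also have "\<dots> = ennreal (exp ((s / r k)\<^sup>2))" by (simp add: exp_add[symmetric])
    also have "\<dots> \<le> ennreal (exp ((s / \<eta>)\<^sup>2))"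
    proof -
      have "\<bar>s / r k\<bar> \<le> \<bar>s / \<eta>\<bar>"
        using assms(3) assms(4)[OF k] r[OF k] by (simp add: abs_divide frac_le)
      then have "(s / r k)\<^sup>2 \<le> (s / \<eta>)\<^sup>2" by (simp only: abs_le_square_iff)
      then show ?thesis by (intro ennreal_leI) simp
    qed
    finally show ?thesis .
  qed
  have ind: "indep_vars (\<lambda>_. borel) (\<lambda>k \<omega>. ennreal (exp (s * (X k \<omega> - 1 / r k)))) K"
    using X by (intro indep_vars_compose2[where X=X and Y="\<lambda>k x. ennreal (exp (s * (x - 1 / r k)))"]) (auto simp: indep_exp_def)
  have "(\<integral>\<^sup>+\<omega>. ennreal (exp (s * (\<Sum>k\<in>K. X k \<omega> - 1 / r k))) \<partial>M) =
    (\<integral>\<^sup>+\<omega>. (\<Prod>k\<in>K. ennreal (exp (s * (X k \<omega> - 1 / r k)))) \<partial>M)"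
    using \<open>finite K\<close> by (intro nn_integral_cong) (simp add: sum_distrib_left exp_sum prod_ennreal)
  also have "\<dots> = (\<Prod>k\<in>K. \<integral>\<^sup>+\<omega>. ennreal (exp (s * (X k \<omega> - 1 / r k))) \<partial>M)"
    by (intro indep_vars_nn_integral ind \<open>finite K\<close>) auto
  also have "\<dots> \<le> (\<Prod>k\<in>K. ennreal (exp ((s / \<eta>)\<^sup>2)))"
    using \<open>finite K\<close> one by (induction K rule: finite_induct) (auto intro!: mult_mono)
  also have "\<dots> = ennreal (exp (real (card K) * (s / \<eta>)\<^sup>2))"
    by (simp add: ennreal_power exp_of_nat_mult)
  finally show ?thesis .
qed

text \<open>The exponent s^2 / \<eta>^2 - s \<delta> is minimal at s = \<eta>^2 \<delta> / 2. This s
  is capped at \<eta> / 2, where the moment bound stops, and in both cases the exponent is at most -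
  s \<delta> / 2.\<close>

definition chernoff :: "real \<Rightarrow> real \<Rightarrow> real" where
  "chernoff \<eta> \<delta> = min (\<eta> / 2) (\<eta>\<^sup>2 * \<delta> / 2) * \<delta> / 2"

lemma chernoff_pos: "\<eta> > 0 \<Longrightarrow> \<delta> > 0 \<Longrightarrow> chernoff \<eta> \<delta> > 0"
  by (simp add: chernoff_def)

lemma chernoff_one_sided:
  assumes X: "indep_exp M X K r" and "finite K" "\<eta> > 0" "\<And>k. k \<in> K \<Longrightarrow> r k \<ge> \<eta>" "\<delta> > 0"
    and N: "real (card K) \<le> N" and \<sigma>: "\<sigma> \<in> {1, - 1}"
  shows "measure M {\<omega>\<in>space M. \<sigma> * (\<Sum>k\<in>K. X k \<omega> - 1 / r k) \<ge> \<delta> * N} \<le> exp (- chernoff \<eta> \<delta> * N)"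
proof -
  interpret prob_space M using X by (rule indep_exp_prob_space)
  have [measurable]: "X k \<in> borel_measurable M" if "k \<in> K" for k using indep_exp_measurable[OF X that] .
  define s where "s = min (\<eta> / 2) (\<eta>\<^sup>2 * \<delta> / 2)"
  have s: "s > 0" "s \<le> \<eta> / 2" "s \<le> \<eta>\<^sup>2 * \<delta> / 2" using assms by (auto simp: s_def)
  define Y where "Y \<omega> = (\<Sum>k\<in>K. X k \<omega> - 1 / r k)" for \<omega>
  have [measurable]: "Y \<in> borel_measurable M" unfolding Y_def by simp
  have N0: "N \<ge> 0" using N by linarith
  have "emeasure M ({\<omega>\<in>space M. 1 \<le> ennreal (exp (- s * \<delta> * N)) * ennreal (exp (\<sigma> * s * Y \<omega>))} \<inter> space M) \<le>
    ennreal (exp (- s * \<delta> * N)) * (\<integral>\<^sup>+\<omega>. ennreal (exp (\<sigma> * s * Y \<omega>)) * indicator (space M) \<omega> \<partial>M)"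
    using nn_integral_Markov_inequality[of "\<lambda>\<omega>. ennreal (exp (\<sigma> * s * Y \<omega>))" "space M" M "ennreal (exp (- s * \<delta> * N))"]
    by (simp add: Int_def conj_commute)
  also have "{\<omega>\<in>space M. 1 \<le> ennreal (exp (- s * \<delta> * N)) * ennreal (exp (\<sigma> * s * Y \<omega>))} \<inter> space M =
    {\<omega>\<in>space M. \<sigma> * Y \<omega> \<ge> \<delta> * N}"
  proof -
    have "1 \<le> ennreal (exp (- s * \<delta> * N)) * ennreal (exp (\<sigma> * s * Y \<omega>)) \<longleftrightarrow> \<sigma> * Y \<omega> \<ge> \<delta> * N" for \<omega>
    proof -
      have "ennreal (exp (- s * \<delta> * N)) * ennreal (exp (\<sigma> * s * Y \<omega>)) = ennreal (exp (s * (\<sigma> * Y \<omega> - \<delta> * N)))"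
        by (simp add: ennreal_mult'[symmetric] exp_add[symmetric] algebra_simps)
      then show ?thesis using s by (simp add: ennreal_1[symmetric] zero_le_mult_iff del: ennreal_1)
    qed
    then show ?thesis by auto
  qed
  also have "(\<integral>\<^sup>+\<omega>. ennreal (exp (\<sigma> * s * Y \<omega>)) * indicator (space M) \<omega> \<partial>M) = (\<integral>\<^sup>+\<omega>. ennreal (exp (\<sigma> * s * Y \<omega>)) \<partial>M)"
    by (intro nn_integral_cong) (simp add: indicator_def)
  also have "\<dots> \<le> ennreal (exp (real (card K) * (\<sigma> * s / \<eta>)\<^sup>2))"
    unfolding Y_def using assms s by (intro indep_exp_mgf[OF X]) (auto simp: abs_mult)
  also have "(\<sigma> * s / \<eta>)\<^sup>2 = (s / \<eta>)\<^sup>2" using \<sigma> by (auto simp: power_divide)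
  also have "ennreal (exp (- s * \<delta> * N)) * ennreal (exp (real (card K) * (s / \<eta>)\<^sup>2)) =
     ennreal (exp (- s * \<delta> * N + real (card K) * (s / \<eta>)\<^sup>2))"
     by (simp only: exp_add ennreal_mult' exp_ge_zero)
  also have "\<dots> \<le> ennreal (exp (- chernoff \<eta> \<delta> * N))"
  proof -
    have "(s / \<eta>)\<^sup>2 \<le> s * \<delta> / 2"
    proof -
      have "s * s \<le> s * (\<eta>\<^sup>2 * \<delta> / 2)" using s by (intro mult_left_mono) auto
      then show ?thesis using assms by (simp add: power_divide power2_eq_square field_simps)
    qed
    then have "real (card K) * (s / \<eta>)\<^sup>2 \<le> N * (s * \<delta> / 2)" using N by (intro mult_mono) (auto simp: N0)
    then show ?thesis unfolding chernoff_def s_def[symmetric] by (intro ennreal_leI) (simp add: algebra_simps)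
  qed
  finally show ?thesis
    unfolding Y_def by (simp add: emeasure_eq_measure mult_left_mono)
qed

lemma chernoff_two_sided:
  assumes X: "indep_exp M X K r" and "finite K" "\<eta> > 0" "\<And>k. k \<in> K \<Longrightarrow> r k \<ge> \<eta>" "\<delta> > 0"
    and N: "real (card K) \<le> N"
  shows "measure M {\<omega>\<in>space M. \<bar>(\<Sum>k\<in>K. X k \<omega>) - (\<Sum>k\<in>K. 1 / r k)\<bar> \<ge> \<delta> * N} \<le> 2 * exp (- chernoff \<eta> \<delta> * N)"
proof -
  interpret prob_space M using X by (rule indep_exp_prob_space)
  have [measurable]: "X k \<in> borel_measurable M" if "k \<in> K" for k using indep_exp_measurable[OF X that] .
  let ?E = "\<lambda>\<sigma>. {\<omega>\<in>space M. \<sigma> * (\<Sum>k\<in>K. X k \<omega> - 1 / r k) \<ge> \<delta> * N}"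
  have "measure M {\<omega>\<in>space M. \<bar>(\<Sum>k\<in>K. X k \<omega>) - (\<Sum>k\<in>K. 1 / r k)\<bar> \<ge> \<delta> * N} \<le> measure M (?E 1 \<union> ?E (- 1))"
    by (intro finite_measure_mono) (auto simp: sum_subtractf)
  also have "\<dots> \<le> measure M (?E 1) + measure M (?E (- 1))"
    by (intro measure_Un_le) auto
  also have "\<dots> \<le> exp (- chernoff \<eta> \<delta> * N) + exp (- chernoff \<eta> \<delta> * N)"
    using assms by (intro add_mono chernoff_one_sided[OF X]) auto
  finally show ?thesis by simp
qed

subsection \<open>Burke's theorem\<close>

definition burke_density :: "real \<Rightarrow> real \<Rightarrow> real \<Rightarrow> real \<Rightarrow> real \<Rightarrow> ennreal" where
  "burke_density u v x y w = ennreal (exponential_density u x) * ennreal (exponential_density v y) *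
     ennreal (exponential_density (u + v) w)"

lemma burke_density_measurable [measurable]:
  assumes [measurable]: "f \<in> borel_measurable M" "g \<in> borel_measurable M" "h \<in> borel_measurable M"
  shows "(\<lambda>z. burke_density u v (f z) (g z) (h z)) \<in> borel_measurable M"
  unfolding burke_density_def by measurable

text \<open>Each branch of the Burke map preserves the linear form u x + v y + (u + v) w in the
  exponent: for x \<ge> y the image is (w + x - y, w, y). The condition t \<ge> w makes the sign
  constraints on both sides agree.\<close>

lemma burke_density_swap:
  assumes "u > 0" "v > 0"
  shows "t \<ge> w \<Longrightarrow> burke_density u v (t + y - w) y w = burke_density u v t w y"
    and "t \<ge> w \<Longrightarrow> burke_density u v y (t + y - w) w = burke_density u v w t y"
proof -
  have e: "ennreal a * ennreal b * ennreal c = ennreal (a * b * c)" if "a \<ge> 0" "b \<ge> 0" "c \<ge> 0" for a b c :: real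
    using that by (simp add: ennreal_mult')
  have nn: "exponential_density r x \<ge> 0" if "r > 0" for r x
    using that by (rule exponential_density_nonneg)
  have m: "exp a * exp b * exp c = exp (a + b + c)" for a b c :: real by (simp add: exp_add)
  show "burke_density u v (t + y - w) y w = burke_density u v t w y" if "t \<ge> w"
  proof -
    have "exp (- (t + y - w) * u) * exp (- y * v) * exp (- w * (u + v)) =
       exp (- t * u) * exp (- w * v) * exp (- y * (u + v))"
      unfolding m by (simp add: algebra_simps)
    then show ?thesis
      using assms that unfolding burke_density_def
      by (simp add: e nn) (auto simp: exponential_density_def algebra_simps)
  qed
  show "burke_density u v y (t + y - w) w = burke_density u v w t y" if "t \<ge> w"
  proof -
    have "exp (- y * u) * exp (- (t + y - w) * v) * exp (- w * (u + v)) =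
       exp (- w * u) * exp (- t * v) * exp (- y * (u + v))"
      unfolding m by (simp add: algebra_simps)
    then show ?thesis
      using assms that unfolding burke_density_def
      by (simp add: e nn) (auto simp: exponential_density_def algebra_simps)
  qed
qed

lemma nn_integral_lborel_translate:
  fixes f :: "real \<Rightarrow> ennreal"
  assumes "f \<in> borel_measurable borel"
  shows "(\<integral>\<^sup>+x. f x \<partial>lborel) = (\<integral>\<^sup>+x. f (x + c) \<partial>lborel)"
  using nn_integral_real_affine[of f 1 c] assms by (simp add: add.commute)

lemma measure_preserving_comp:
  assumes "f \<in> measurable M M \<and> distr M M f = M" "g \<in> measurable M M \<and> distr M M g = M"
  shows "g \<circ> f \<in> measurable M M \<and> distr M M (g \<circ> f) = M"
proof -
  have "distr M M (g \<circ> f) = distr (distr M M f) M g"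
    using assms by (intro distr_distr[symmetric]) auto
  then show ?thesis using assms by (simp only: measurable_comp[of f M M g M])
qed

lemma nn_integral_exp_measure3:
  assumes [measurable]: "(\<lambda>(x, y, w). F x y w) \<in> borel_measurable (borel \<Otimes>\<^sub>M borel \<Otimes>\<^sub>M borel :: (real \<times> real \<times> real) measure)"
    and "u > 0" "v > 0"
  shows "(\<integral>\<^sup>+w. \<integral>\<^sup>+y. \<integral>\<^sup>+x. F x y w \<partial>exp_measure u \<partial>exp_measure v \<partial>exp_measure (u + v)) =
     (\<integral>\<^sup>+w. \<integral>\<^sup>+y. \<integral>\<^sup>+x. burke_density u v x y w * F x y w \<partial>lborel \<partial>lborel \<partial>lborel)"
proof -
  have [measurable]: "(\<lambda>z. F (f1 z) (f2 z) (f3 z)) \<in> borel_measurable M"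
    if [measurable]: "f1 \<in> borel_measurable M" "f2 \<in> borel_measurable M" "f3 \<in> borel_measurable M" for f1 f2 f3 and M :: "'x measure"
    using measurable_compose[OF _ assms(1), of "\<lambda>z. (f1 z, f2 z, f3 z)" M] by simp
  have "(\<integral>\<^sup>+w. \<integral>\<^sup>+y. \<integral>\<^sup>+x. F x y w \<partial>exp_measure u \<partial>exp_measure v \<partial>exp_measure (u + v)) =
    (\<integral>\<^sup>+w. ennreal (exponential_density (u + v) w) * (\<integral>\<^sup>+y. ennreal (exponential_density v y) *
        (\<integral>\<^sup>+x. ennreal (exponential_density u x) * F x y w \<partial>lborel) \<partial>lborel) \<partial>lborel)"
    unfolding exp_measure_def by (simp add: nn_integral_density)
  also have "\<dots> = (\<integral>\<^sup>+w. \<integral>\<^sup>+y. \<integral>\<^sup>+x. burke_density u v x y w * F x y w \<partial>lborel \<partial>lborel \<partial>lborel)"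
    unfolding burke_density_def by (simp add: nn_integral_cmult[symmetric] mult_ac)
  finally show ?thesis .
qed

text \<open>On each of the regions where \<open>min x y\<close> is \<open>y\<close> or \<open>x\<close>, the Burke map is a translation in one
  variable followed by a permutation of the variables, and the joint density is invariant.\<close>

lemma burke_invariance:
  assumes F [measurable]: "(\<lambda>(x, y, w). F x y w) \<in> borel_measurable (borel \<Otimes>\<^sub>M borel \<Otimes>\<^sub>M borel :: (real \<times> real \<times> real) measure)"
    and uv: "u > 0" "v > 0"
  shows "(\<integral>\<^sup>+w. \<integral>\<^sup>+y. \<integral>\<^sup>+x. F (w + x - min x y) (w + y - min x y) (min x y) \<partial>exp_measure u \<partial>exp_measure v \<partial>exp_measure (u + v)) =
     (\<integral>\<^sup>+w. \<integral>\<^sup>+y. \<integral>\<^sup>+x. F x y w \<partial>exp_measure u \<partial>exp_measure v \<partial>exp_measure (u + v))"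
proof -
  define g where "g = burke_density u v"
  have [measurable]: "(\<lambda>z. g (f1 z) (f2 z) (f3 z)) \<in> borel_measurable M"
    if [measurable]: "f1 \<in> borel_measurable M" "f2 \<in> borel_measurable M" "f3 \<in> borel_measurable M" for f1 f2 f3 and M :: "'x measure"
    unfolding g_def by measurable
  have [measurable]: "(\<lambda>z. F (f1 z) (f2 z) (f3 z)) \<in> borel_measurable M"
    if [measurable]: "f1 \<in> borel_measurable M" "f2 \<in> borel_measurable M" "f3 \<in> borel_measurable M" for f1 f2 f3 and M :: "'x measure"
    using measurable_compose[OF _ F, of "\<lambda>z. (f1 z, f2 z, f3 z)" M] by simp
  have swap: "(\<integral>\<^sup>+x. \<integral>\<^sup>+y. H x y \<partial>lborel \<partial>lborel) = (\<integral>\<^sup>+y. \<integral>\<^sup>+x. H x y \<partial>lborel \<partial>lborel)"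
    if "(\<lambda>(x, y). H x y) \<in> borel_measurable (borel \<Otimes>\<^sub>M borel)" for H :: "real \<Rightarrow> real \<Rightarrow> ennreal"
    by (rule lborel_pair.Fubini'[symmetric]) (use that in simp)
  have split: "(\<integral>\<^sup>+w. \<integral>\<^sup>+y. \<integral>\<^sup>+x. H x y w \<partial>lborel \<partial>lborel \<partial>lborel) =
     (\<integral>\<^sup>+w. \<integral>\<^sup>+y. \<integral>\<^sup>+x. H x y w * indicator {y..} x \<partial>lborel \<partial>lborel \<partial>lborel) +
     (\<integral>\<^sup>+w. \<integral>\<^sup>+y. \<integral>\<^sup>+x. H x y w * indicator {..<y} x \<partial>lborel \<partial>lborel \<partial>lborel)"
    if that': "(\<lambda>(x, y, w). H x y w) \<in> borel_measurable (borel \<Otimes>\<^sub>M borel \<Otimes>\<^sub>M borel :: (real \<times> real \<times> real) measure)"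
    for H :: "real \<Rightarrow> real \<Rightarrow> real \<Rightarrow> ennreal"
  proof -
    have "H x y w = H x y w * indicator {y..} x + H x y w * indicator {..<y} x" for x y w
      by (auto simp: indicator_def)
    moreover have [measurable]: "(\<lambda>z. H (f1 z) (f2 z) (f3 z)) \<in> borel_measurable M"
      if [measurable]: "f1 \<in> borel_measurable M" "f2 \<in> borel_measurable M" "f3 \<in> borel_measurable M" for f1 f2 f3 and M :: "'x measure"
      using measurable_compose[OF _ that', of "\<lambda>z. (f1 z, f2 z, f3 z)" M] by simp
    have "(\<integral>\<^sup>+w. \<integral>\<^sup>+y. \<integral>\<^sup>+x. H x y w * indicator {y..} x + H x y w * indicator {..<y} x \<partial>lborel \<partial>lborel \<partial>lborel) =
     (\<integral>\<^sup>+w. \<integral>\<^sup>+y. \<integral>\<^sup>+x. H x y w * indicator {y..} x \<partial>lborel \<partial>lborel \<partial>lborel) +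
     (\<integral>\<^sup>+w. \<integral>\<^sup>+y. \<integral>\<^sup>+x. H x y w * indicator {..<y} x \<partial>lborel \<partial>lborel \<partial>lborel)"
      unfolding indicator_def by (simp add: nn_integral_add)
    ultimately show ?thesis by simp
  qed
  \<comment> \<open>For x \<ge> y the map sends (x, y, w) to (w + x - y, w, y). Substituting x = t +
    y - w turns the region into t \<ge> w and evaluates F at (t, w, y); exchanging the integrals
    over y and w restores the names.\<close>
  have A: "(\<integral>\<^sup>+w. \<integral>\<^sup>+y. \<integral>\<^sup>+x. g x y w * F (w + x - min x y) (w + y - min x y) (min x y) * indicator {y..} x \<partial>lborel \<partial>lborel \<partial>lborel) =
    (\<integral>\<^sup>+w. \<integral>\<^sup>+y. \<integral>\<^sup>+x. g x y w * F x y w * indicator {y..} x \<partial>lborel \<partial>lborel \<partial>lborel)"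
  proof -
    have "(\<integral>\<^sup>+x. g x y w * F (w + x - min x y) (w + y - min x y) (min x y) * indicator {y..} x \<partial>lborel) =
      (\<integral>\<^sup>+t. g t w y * F t w y * indicator {w..} t \<partial>lborel)" for y w
      unfolding g_def
    proof (subst nn_integral_lborel_translate[where c="y - w"])
      show "(\<integral>\<^sup>+x. burke_density u v (x + (y - w)) y w *
         F (w + (x + (y - w)) - min (x + (y - w)) y) (w + y - min (x + (y - w)) y) (min (x + (y - w)) y) *
         indicator {y..} (x + (y - w)) \<partial>lborel) =
        (\<integral>\<^sup>+t. burke_density u v t w y * F t w y * indicator {w..} t \<partial>lborel)"
      proof (rule nn_integral_cong)
        fix t
        show "burke_density u v (t + (y - w)) y w *
         F (w + (t + (y - w)) - min (t + (y - w)) y) (w + y - min (t + (y - w)) y) (min (t + (y - w)) y) *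
         indicator {y..} (t + (y - w)) = burke_density u v t w y * F t w y * indicator {w..} t"
        proof (cases "t \<ge> w")
          case True
          have "burke_density u v (t + (y - w)) y w = burke_density u v t w y"
            using burke_density_swap(1)[OF uv True, of y] by (simp only: add_diff_eq)
          moreover have "min (t + (y - w)) y = y" "w + (t + (y - w)) - y = t" "w + y - y = w" using True by auto
          ultimately show ?thesis using True by (simp only:) (simp add: indicator_def)
        qed (simp add: indicator_def)
      qed
    qed (simp add: indicator_def)
    then have "(\<integral>\<^sup>+w. \<integral>\<^sup>+y. \<integral>\<^sup>+x. g x y w * F (w + x - min x y) (w + y - min x y) (min x y) * indicator {y..} x \<partial>lborel \<partial>lborel \<partial>lborel) =
      (\<integral>\<^sup>+w. \<integral>\<^sup>+y. \<integral>\<^sup>+t. g t w y * F t w y * indicator {w..} t \<partial>lborel \<partial>lborel \<partial>lborel)"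
      by (simp only:)
    also have "\<dots> = (\<integral>\<^sup>+y. \<integral>\<^sup>+w. \<integral>\<^sup>+t. g t w y * F t w y * indicator {w..} t \<partial>lborel \<partial>lborel \<partial>lborel)"
      by (rule swap) (simp add: indicator_def)
    finally show ?thesis .
  qed
  \<comment> \<open>For x < y the map sends (x, y, w) to (w, w + y - x, x). The translation now acts
    on y, which is first moved innermost; the new triple is (w, t, x), and two exchanges bring it
    back into order.\<close>
  have B: "(\<integral>\<^sup>+w. \<integral>\<^sup>+y. \<integral>\<^sup>+x. g x y w * F (w + x - min x y) (w + y - min x y) (min x y) * indicator {..<y} x \<partial>lborel \<partial>lborel \<partial>lborel) =
    (\<integral>\<^sup>+w. \<integral>\<^sup>+y. \<integral>\<^sup>+x. g x y w * F x y w * indicator {..<y} x \<partial>lborel \<partial>lborel \<partial>lborel)"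
  proof -
    have "(\<integral>\<^sup>+w. \<integral>\<^sup>+y. \<integral>\<^sup>+x. g x y w * F (w + x - min x y) (w + y - min x y) (min x y) * indicator {..<y} x \<partial>lborel \<partial>lborel \<partial>lborel) =
      (\<integral>\<^sup>+w. \<integral>\<^sup>+x. \<integral>\<^sup>+y. g x y w * F (w + x - min x y) (w + y - min x y) (min x y) * indicator {..<y} x \<partial>lborel \<partial>lborel \<partial>lborel)"
      by (intro nn_integral_cong swap) (simp add: indicator_def)
    also have "\<dots> = (\<integral>\<^sup>+w. \<integral>\<^sup>+x. \<integral>\<^sup>+t. g w t x * F w t x * indicator {..<t} w \<partial>lborel \<partial>lborel \<partial>lborel)"
    proof (rule nn_integral_cong, rule nn_integral_cong)
      fix w x :: real
      show "(\<integral>\<^sup>+y. g x y w * F (w + x - min x y) (w + y - min x y) (min x y) * indicator {..<y} x \<partial>lborel) =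
        (\<integral>\<^sup>+t. g w t x * F w t x * indicator {..<t} w \<partial>lborel)"
      unfolding g_def
      proof (subst nn_integral_lborel_translate[where c="x - w"])
        show "(\<integral>\<^sup>+y. burke_density u v x (y + (x - w)) w *
           F (w + x - min x (y + (x - w))) (w + (y + (x - w)) - min x (y + (x - w))) (min x (y + (x - w))) *
           indicator {..<y + (x - w)} x \<partial>lborel) =
          (\<integral>\<^sup>+t. burke_density u v w t x * F w t x * indicator {..<t} w \<partial>lborel)"
        proof (rule nn_integral_cong)
          fix t
          show "burke_density u v x (t + (x - w)) w *
           F (w + x - min x (t + (x - w))) (w + (t + (x - w)) - min x (t + (x - w))) (min x (t + (x - w))) *
           indicator {..<t + (x - w)} x = burke_density u v w t x * F w t x * indicator {..<t} w"
          proof (cases "w < t")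
            case True
            have "burke_density u v x (t + (x - w)) w = burke_density u v w t x"
              using burke_density_swap(2)[OF uv, of w t x] True by (simp only: add_diff_eq)
            moreover have "min x (t + (x - w)) = x" "w + (t + (x - w)) - x = t" "w + x - x = w" using True by auto
            ultimately show ?thesis using True by (simp only:) (simp add: indicator_def)
          qed (simp add: indicator_def)
        qed
      qed (simp add: indicator_def)
    qed
    also have "\<dots> = (\<integral>\<^sup>+x. \<integral>\<^sup>+w. \<integral>\<^sup>+t. g w t x * F w t x * indicator {..<t} w \<partial>lborel \<partial>lborel \<partial>lborel)"
      by (rule swap) (simp add: indicator_def)
    also have "\<dots> = (\<integral>\<^sup>+x. \<integral>\<^sup>+t. \<integral>\<^sup>+w. g w t x * F w t x * indicator {..<t} w \<partial>lborel \<partial>lborel \<partial>lborel)"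
      by (intro nn_integral_cong swap) (simp add: indicator_def)
    finally show ?thesis .
  qed
  show ?thesis
  proof -
    have "(\<integral>\<^sup>+w. \<integral>\<^sup>+y. \<integral>\<^sup>+x. F (w + x - min x y) (w + y - min x y) (min x y) \<partial>exp_measure u \<partial>exp_measure v \<partial>exp_measure (u + v)) =
      (\<integral>\<^sup>+w. \<integral>\<^sup>+y. \<integral>\<^sup>+x. g x y w * F (w + x - min x y) (w + y - min x y) (min x y) \<partial>lborel \<partial>lborel \<partial>lborel)"
      unfolding g_def by (rule nn_integral_exp_measure3[OF _ uv]) (simp add: case_prod_beta')
    also have "\<dots> = (\<integral>\<^sup>+w. \<integral>\<^sup>+y. \<integral>\<^sup>+x. g x y w * F x y w * indicator {y..} x \<partial>lborel \<partial>lborel \<partial>lborel) +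
      (\<integral>\<^sup>+w. \<integral>\<^sup>+y. \<integral>\<^sup>+x. g x y w * F x y w * indicator {..<y} x \<partial>lborel \<partial>lborel \<partial>lborel)"
      unfolding A[symmetric] B[symmetric] by (rule split) (simp add: case_prod_beta')
    also have "\<dots> = (\<integral>\<^sup>+w. \<integral>\<^sup>+y. \<integral>\<^sup>+x. g x y w * F x y w \<partial>lborel \<partial>lborel \<partial>lborel)"
      by (rule split[symmetric]) (simp add: case_prod_beta')
    also have "\<dots> = (\<integral>\<^sup>+w. \<integral>\<^sup>+y. \<integral>\<^sup>+x. F x y w \<partial>exp_measure u \<partial>exp_measure v \<partial>exp_measure (u + v))"
      unfolding g_def by (rule nn_integral_exp_measure3[OF F uv, symmetric])
    finally show ?thesis .
  qed
qed

text \<open>The corner (0, 0) falls under the first case and gets the rate u 0. It is a dummy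
  coordinate, but it must have a positive rate for the product over the full square of indices to be
  a probability measure; this is why u and v are later reset at index 0.\<close>

definition boundary_rate :: "(nat \<Rightarrow> real) \<Rightarrow> (nat \<Rightarrow> real) \<Rightarrow> nat \<times> nat \<Rightarrow> real" where
  "boundary_rate u v p = (if snd p = 0 then u (fst p) else if fst p = 0 then v (snd p) else u (fst p) + v (snd p))"

locale boundary_product =
  fixes m n :: nat and u v :: "nat \<Rightarrow> real"
  assumes u: "\<And>i. i \<le> m \<Longrightarrow> u i > 0" and v: "\<And>j. j \<le> n \<Longrightarrow> v j > 0"
begin

abbreviation "Q \<equiv> \<Pi>\<^sub>M p\<in>{..m}\<times>{..n}. exp_measure (boundary_rate u v p)"

lemma boundary_rate_pos: "p \<in> {..m}\<times>{..n} \<Longrightarrow> boundary_rate u v p > 0"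
  using u v by (auto simp: boundary_rate_def intro!: add_pos_pos)

lemma coord_measurable [measurable]: "p \<in> {..m}\<times>{..n} \<Longrightarrow> (\<lambda>x. x p) \<in> borel_measurable Q"
  using measurable_component_singleton[of p "{..m}\<times>{..n}" "\<lambda>p. exp_measure (boundary_rate u v p)"]
  by (simp add: measurable_cong_sets[OF refl sets_exp_measure])

lemma burke_step_measurable [measurable]:
  assumes "i \<in> {1..m}" "j \<in> {1..n}"
  shows "burke_step i j \<in> measurable Q Q"
proof -
  have Un: "{..m}\<times>{..n} = {..m}\<times>{..n} \<union> {p}" if "p \<in> {..m}\<times>{..n}" for p using that by auto
  show ?thesis
    unfolding burke_step_def
    by (intro measurable_fun_upd[OF Un] measurable_ident) (use assms in \<open>auto intro!: coord_measurable\<close>)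
qed

text \<open>A step touches three coordinates only. Fubini freezes the others, and the three carry
  the rates u i, v j and u i + v j before and after the step, so the three-variable invariance
  applies. Since Q itself is preserved, steps can be iterated over the whole rectangle.\<close>

lemma burke_step_distr:
  assumes ij: "i \<in> {1..m}" "j \<in> {1..n}"
  shows "distr Q Q (burke_step i j) = Q"
proof -
  \<comment> \<open>The value 1 outside the rectangle makes the measure at every index sigma-finite,
    as the locale for finite products demands.\<close>
  define r where "r p = (if p \<in> {..m}\<times>{..n} then boundary_rate u v p else 1)" for p
  have r_pos: "r p > 0" for p using boundary_rate_pos by (auto simp: r_def)
  have Q_r: "Q = (\<Pi>\<^sub>M p\<in>{..m}\<times>{..n}. exp_measure (r p))" by (intro PiM_cong) (auto simp: r_def)
  have sf: "sigma_finite_measure (exp_measure (r p))" for p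
    using prob_space_exp_measure[OF r_pos] prob_space_imp_sigma_finite by blast
  interpret product_sigma_finite "\<lambda>p. exp_measure (r p)" unfolding product_sigma_finite_def using sf by simp
  define K where "K = {..m}\<times>{..n} - {(i, 0), (0, j), (i, j)}"
  have K: "{..m}\<times>{..n} = insert (i, 0) (insert (0, j) (insert (i, j) K))" using ij by (auto simp: K_def)
  have fin: "finite K" by (simp add: K_def)
  have notin: "(i, j) \<notin> K" "(0, j) \<notin> insert (i, j) K" "(i, 0) \<notin> insert (0, j) (insert (i, j) K)"
    using ij by (auto simp: K_def)
  have rr: "r (i, 0) = u i" "r (0, j) = v j" "r (i, j) = u i + v j"
    using ij by (auto simp: r_def boundary_rate_def)
  have uv: "u i > 0" "v j > 0" using ij u v by auto
  let ?R = "\<lambda>K. \<Pi>\<^sub>M p\<in>K. exp_measure (r p)"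
  have fold3: "(\<integral>\<^sup>+x. f x \<partial>Q) = (\<integral>\<^sup>+x. (\<integral>\<^sup>+w. \<integral>\<^sup>+y. \<integral>\<^sup>+z. f (x((i, j) := w, (0, j) := y, (i, 0) := z))
     \<partial>exp_measure (u i) \<partial>exp_measure (v j) \<partial>exp_measure (u i + v j)) \<partial>?R K)"
    if "f \<in> borel_measurable Q" for f
  proof -
    have f [measurable]: "f \<in> borel_measurable (?R (insert (i, 0) (insert (0, j) (insert (i, j) K))))"
      using that unfolding Q_r unfolding K .
    have meas: "(\<lambda>x. \<integral>\<^sup>+z. g (x(p := z)) \<partial>exp_measure (r p)) \<in> borel_measurable (?R L)"
      if g: "g \<in> borel_measurable (?R (insert p L))" for g p L
      using measurable_compose[OF measurable_add_dim g]
      by (intro sigma_finite_measure.borel_measurable_nn_integral sf) (simp add: case_prod_beta')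
    note f1 = meas[OF f] and f2 = meas[OF meas[OF f]]
    have "(\<integral>\<^sup>+x. f x \<partial>Q) = (\<integral>\<^sup>+x. \<integral>\<^sup>+z. f (x((i, 0) := z)) \<partial>exp_measure (r (i, 0)) \<partial>?R (insert (0, j) (insert (i, j) K)))"
      unfolding Q_r unfolding K using fin notin by (intro product_nn_integral_insert f) auto
    also have "\<dots> = (\<integral>\<^sup>+x. \<integral>\<^sup>+y. \<integral>\<^sup>+z. f (x((0, j) := y, (i, 0) := z)) \<partial>exp_measure (r (i, 0)) \<partial>exp_measure (r (0, j)) \<partial>?R (insert (i, j) K))"
      using fin notin by (intro product_nn_integral_insert f1) auto
    also have "\<dots> = (\<integral>\<^sup>+x. (\<integral>\<^sup>+w. \<integral>\<^sup>+y. \<integral>\<^sup>+z. f (x((i, j) := w, (0, j) := y, (i, 0) := z))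
     \<partial>exp_measure (r (i, 0)) \<partial>exp_measure (r (0, j)) \<partial>exp_measure (r (i, j))) \<partial>?R K)"
      using fin notin by (intro product_nn_integral_insert f2) auto
    finally show ?thesis unfolding rr .
  qed
  show ?thesis
  proof (rule measure_eqI)
    fix A assume "A \<in> sets (distr Q Q (burke_step i j))"
    then have A [measurable]: "A \<in> sets Q" by simp
    have m: "(\<lambda>x. indicator A (burke_step i j x) :: ennreal) \<in> borel_measurable Q"
      using burke_step_measurable[OF ij] by measurable
    have "emeasure (distr Q Q (burke_step i j)) A = (\<integral>\<^sup>+x. indicator A x \<partial>distr Q Q (burke_step i j))"
      by (subst nn_integral_indicator) auto
    also have "\<dots> = (\<integral>\<^sup>+x. indicator A (burke_step i j x) \<partial>Q)"
      using burke_step_measurable[OF ij] by (subst nn_integral_distr) auto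
    also have "\<dots> = (\<integral>\<^sup>+x. indicator A x \<partial>Q)"
      unfolding fold3[OF m] fold3[OF borel_measurable_indicator[OF A]]
    proof (rule nn_integral_cong)
      fix x assume x: "x \<in> space (?R K)"
      define F where "F z y w = (indicator A (x((i, j) := w, (0, j) := y, (i, 0) := z)) :: ennreal)" for z y w
      have "(\<lambda>(z, y, w). F z y w) \<in> borel_measurable (exp_measure (r (i, 0)) \<Otimes>\<^sub>M exp_measure (r (0, j)) \<Otimes>\<^sub>M exp_measure (r (i, j)))"
      proof -
        have [measurable]: "A \<in> sets (?R (insert (i, 0) (insert (0, j) (insert (i, j) K))))"
          using A unfolding Q_r unfolding K .
        have "(\<lambda>t. x((i, j) := snd (snd t), (0, j) := fst (snd t), (i, 0) := fst t)) \<in>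
          measurable (exp_measure (r (i, 0)) \<Otimes>\<^sub>M exp_measure (r (0, j)) \<Otimes>\<^sub>M exp_measure (r (i, j))) (?R (insert (i, 0) (insert (0, j) (insert (i, j) K))))"
          using x by (intro measurable_fun_upd[where J="insert (0, j) (insert (i, j) K)"]
            measurable_fun_upd[where J="insert (i, j) K"] measurable_fun_upd[where J=K] measurable_const) auto
        then have "(\<lambda>t. indicator A (x((i, j) := snd (snd t), (0, j) := fst (snd t), (i, 0) := fst t)) :: ennreal) \<in>
          borel_measurable (exp_measure (r (i, 0)) \<Otimes>\<^sub>M exp_measure (r (0, j)) \<Otimes>\<^sub>M exp_measure (r (i, j)))"
          by measurable
        then show ?thesis by (simp add: F_def case_prod_beta')
      qed
      moreover have "sets (exp_measure (r (i, 0)) \<Otimes>\<^sub>M exp_measure (r (0, j)) \<Otimes>\<^sub>M exp_measure (r (i, j))) = sets (borel \<Otimes>\<^sub>M borel \<Otimes>\<^sub>M borel)"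
        by (intro sets_pair_measure_cong) auto
      ultimately have F: "(\<lambda>(z, y, w). F z y w) \<in> borel_measurable (borel \<Otimes>\<^sub>M borel \<Otimes>\<^sub>M borel)"
        by (simp cong: measurable_cong_sets)
      have upd: "burke_step i j (x((i, j) := w, (0, j) := y, (i, 0) := z)) =
        x((i, j) := min z y, (0, j) := w + y - min z y, (i, 0) := w + z - min z y)" for w y z
        using ij by (auto simp: burke_step_def fun_eq_iff)
      show "(\<integral>\<^sup>+w. \<integral>\<^sup>+y. \<integral>\<^sup>+z. indicator A (burke_step i j (x((i, j) := w, (0, j) := y, (i, 0) := z)))
          \<partial>exp_measure (u i) \<partial>exp_measure (v j) \<partial>exp_measure (u i + v j)) =
        (\<integral>\<^sup>+w. \<integral>\<^sup>+y. \<integral>\<^sup>+z. indicator A (x((i, j) := w, (0, j) := y, (i, 0) := z))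
          \<partial>exp_measure (u i) \<partial>exp_measure (v j) \<partial>exp_measure (u i + v j))"
        using burke_invariance[OF F uv] unfolding F_def upd .
    qed
    also have "\<dots> = emeasure Q A" by simp
    finally show "emeasure (distr Q Q (burke_step i j)) A = emeasure Q A" .
  qed simp
qed

lemma burke_col_distr:
  assumes "i \<in> {1..m}" "k \<le> n"
  shows "burke_col i k \<in> measurable Q Q \<and> distr Q Q (burke_col i k) = Q"
  using assms(2)
proof (induction k)
  case 0
  have "burke_col i 0 = (\<lambda>x. x)" by auto
  then show ?case by simp
next
  case (Suc k)
  have c: "burke_col i (Suc k) = burke_step i (Suc k) \<circ> burke_col i k" by auto
  show ?case
    unfolding c using Suc assms
    by (intro measure_preserving_comp conjI burke_step_measurable burke_step_distr) auto
qed

lemma burke_distr: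
  assumes "k \<le> m"
  shows "burke k n \<in> measurable Q Q \<and> distr Q Q (burke k n) = Q"
  using assms
proof (induction k)
  case 0
  have "burke 0 n = (\<lambda>x. x)" by auto
  then show ?case by simp
next
  case (Suc k)
  have c: "burke (Suc k) n = burke_col (Suc k) n \<circ> burke k n" by auto
  show ?case
    unfolding c using Suc by (intro measure_preserving_comp burke_col_distr) auto
qed

end

section \<open>Measurability and concentration of the stationary passage time\<close>

lemma lpp_measurable:
  assumes "\<And>p. p \<in> {..m} \<times> {..n} \<Longrightarrow> (\<lambda>\<omega>. X \<omega> p) \<in> borel_measurable M"
  shows "(\<lambda>\<omega>. lpp (X \<omega>) m n) \<in> borel_measurable M"
  using assms
proof (induction "m + n" arbitrary: m n rule: less_induct)
  case less
  show ?case
  proof (cases m; cases n)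
    fix m' n' assume s: "m = Suc m'" "n = Suc n'"
    have "(\<lambda>\<omega>. lpp (X \<omega>) m' (Suc n')) \<in> borel_measurable M" "(\<lambda>\<omega>. lpp (X \<omega>) (Suc m') n') \<in> borel_measurable M"
      "(\<lambda>\<omega>. X \<omega> (Suc m', Suc n')) \<in> borel_measurable M"
      using less s by auto
    then show ?thesis using s by simp
  qed (use less in \<open>auto simp: lpp_axes simp del: lpp.simps\<close>)
qed

lemma bulk_measurable:
  assumes "\<And>p. p \<in> {1..m} \<times> {1..n} \<Longrightarrow> (\<lambda>\<omega>. X \<omega> p) \<in> borel_measurable M"
  shows "(\<lambda>\<omega>. bulk (X \<omega>) m n) \<in> borel_measurable M"
  unfolding bulk_def
proof (rule lpp_measurable)
  fix p assume "p \<in> {..m} \<times> {..n}"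
  then show "(\<lambda>\<omega>. if fst p = 0 \<or> snd p = 0 then 0 else X \<omega> p) \<in> borel_measurable M"
    using assms[of p] by (cases "fst p = 0 \<or> snd p = 0") auto
qed

text \<open>The stationary passage time is a bottom sum plus a right-side sum, each of independent
  exponentials. They are dependent on each other, so each gets half of \<delta> and a union bound;
  two two-sided estimates give the factor 4.\<close>

lemma lpp_concentration:
  fixes M :: "'s measure"
  assumes X: "indep_exp M X ({..m}\<times>{..n}) (boundary_rate u v)"
    and uv: "\<And>i. i \<le> m \<Longrightarrow> u i \<ge> \<eta>" "\<And>j. j \<le> n \<Longrightarrow> v j \<ge> \<eta>"
    and pos: "\<eta> > 0" "\<delta> > 0" and N: "real (m + n) \<le> N"
  shows "measure M {\<omega>\<in>space M. \<bar>lpp (\<lambda>p. X p \<omega>) m n - ((\<Sum>i=1..m. 1 / u i) + (\<Sum>j=1..n. 1 / v j))\<bar> \<ge> \<delta> * N}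
    \<le> 4 * exp (- chernoff \<eta> (\<delta> / 2) * N)"
proof -
  interpret boundary_product m n u v using uv pos by unfold_locales (force dest: order.strict_trans2)+
  have cQ: "indep_exp Q (\<lambda>k x. x k) ({..m}\<times>{..n}) (boundary_rate u v)"
    using boundary_rate_pos by (intro indep_exp_coordinates) auto
  interpret Q: prob_space Q using cQ by (rule indep_exp_prob_space)
  define a where "a = (\<Sum>i=1..m. 1 / u i)"
  define b where "b = (\<Sum>j=1..n. 1 / v j)"
  have [measurable]: "burke m n \<in> measurable Q Q" using burke_distr[of m] by auto
  define SI where "SI x = (\<Sum>i=1..m. x (i, 0))" for x :: "nat \<times> nat \<Rightarrow> real"
  define SJ where "SJ x = (\<Sum>j=1..n. x (0, j))" for x :: "nat \<times> nat \<Rightarrow> real"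
  have [measurable]: "SI \<in> borel_measurable Q" "SJ \<in> borel_measurable Q"
    unfolding SI_def SJ_def by (auto intro!: borel_measurable_sum coord_measurable)
  have "measure M {\<omega>\<in>space M. \<bar>lpp (\<lambda>p. X p \<omega>) m n - (a + b)\<bar> \<ge> \<delta> * N} =
    measure Q {x\<in>space Q. \<bar>lpp x m n - (a + b)\<bar> \<ge> \<delta> * N}"
  proof (rule indep_exp_transfer[OF X cQ])
    have [measurable]: "(\<lambda>x. lpp x m n) \<in> borel_measurable (\<Pi>\<^sub>M k\<in>{..m}\<times>{..n}. borel)"
      by (rule lpp_measurable) auto
    show "{x \<in> space (\<Pi>\<^sub>M k\<in>{..m} \<times> {..n}. borel). \<delta> * N \<le> \<bar>lpp x m n - (a + b)\<bar>} \<in> sets (\<Pi>\<^sub>M k\<in>{..m} \<times> {..n}. borel)"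
      by measurable
    show "(\<delta> * N \<le> \<bar>lpp x m n - (a + b)\<bar>) \<longleftrightarrow> (\<delta> * N \<le> \<bar>lpp y m n - (a + b)\<bar>)"
      if "\<And>k. k \<in> {..m} \<times> {..n} \<Longrightarrow> x k = y k" for x y
      using lpp_cong[of m n x y] that by simp
  qed
  also have "\<dots> \<le> measure Q ({x\<in>space Q. \<bar>SI x - a\<bar> \<ge> \<delta> / 2 * N} \<union> {x\<in>space Q. \<bar>SJ (burke m n x) - b\<bar> \<ge> \<delta> / 2 * N})"
  proof (rule Q.finite_measure_mono)
    have "lpp x m n = SI x + SJ (burke m n x)" for x
      unfolding lpp_eq_sum_burke SI_def SJ_def ..
    then show "{x\<in>space Q. \<bar>lpp x m n - (a + b)\<bar> \<ge> \<delta> * N} \<subseteq> {x\<in>space Q. \<bar>SI x - a\<bar> \<ge> \<delta> / 2 * N} \<union>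
      {x\<in>space Q. \<bar>SJ (burke m n x) - b\<bar> \<ge> \<delta> / 2 * N}"
      by (auto simp: abs_if field_simps split: if_splits)
  qed measurable
  also have "\<dots> \<le> measure Q {x\<in>space Q. \<bar>SI x - a\<bar> \<ge> \<delta> / 2 * N} +
     measure Q {x\<in>space Q. \<bar>SJ (burke m n x) - b\<bar> \<ge> \<delta> / 2 * N}"
    by (rule measure_Un_le) measurable
  \<comment> \<open>The increments on the right side are coordinates of the Burke image, which has
    law Q again; hence their sum is distributed like the raw vertical boundary sum.\<close>
  also have "measure Q {x\<in>space Q. \<bar>SJ (burke m n x) - b\<bar> \<ge> \<delta> / 2 * N} =
      measure Q {x\<in>space Q. \<bar>SJ x - b\<bar> \<ge> \<delta> / 2 * N}"
  proof -
    have "measure Q {x\<in>space Q. \<bar>SJ x - b\<bar> \<ge> \<delta> / 2 * N} =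
      measure (distr Q Q (burke m n)) {x\<in>space Q. \<bar>SJ x - b\<bar> \<ge> \<delta> / 2 * N}"
      using burke_distr[of m] by simp
    also have "\<dots> = measure Q (burke m n -` {x\<in>space Q. \<bar>SJ x - b\<bar> \<ge> \<delta> / 2 * N} \<inter> space Q)"
      by (subst measure_distr) auto
    also have "burke m n -` {x\<in>space Q. \<bar>SJ x - b\<bar> \<ge> \<delta> / 2 * N} \<inter> space Q =
       {x\<in>space Q. \<bar>SJ (burke m n x) - b\<bar> \<ge> \<delta> / 2 * N}"
      using measurable_space[OF \<open>burke m n \<in> measurable Q Q\<close>] by auto
    finally show ?thesis by simp
  qed
  also have "measure Q {x\<in>space Q. \<bar>SI x - a\<bar> \<ge> \<delta> / 2 * N} \<le> 2 * exp (- chernoff \<eta> (\<delta> / 2) * N)"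
  proof -
    have *: "(\<Sum>k\<in>{1..m}\<times>{0}. f k) = (\<Sum>i=1..m. f (i, 0))" for f :: "nat \<times> nat \<Rightarrow> real"
      by (rule sum.reindex_bij_witness[of _ "\<lambda>i. (i, 0)" fst]) auto
    have r: "boundary_rate u v (i, 0) = u i" for i by (simp add: boundary_rate_def)
    have "real (card ({1..m}\<times>{0::nat})) \<le> N" using N by simp
    moreover have "\<eta> \<le> boundary_rate u v k" if "k \<in> {1..m}\<times>{0}" for k
      using that uv by (auto simp: boundary_rate_def)
    ultimately show ?thesis
      using chernoff_two_sided[OF indep_exp_subset[OF cQ, of "{1..m}\<times>{0}"], of \<eta> "\<delta>/2" N] pos
      unfolding * r a_def SI_def by fastforce
  qed
  also have "measure Q {x\<in>space Q. \<bar>SJ x - b\<bar> \<ge> \<delta> / 2 * N} \<le> 2 * exp (- chernoff \<eta> (\<delta> / 2) * N)"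
  proof -
    have *: "(\<Sum>k\<in>{0}\<times>{1..n}. f k) = (\<Sum>j=1..n. f (0, j))" for f :: "nat \<times> nat \<Rightarrow> real"
      by (rule sum.reindex_bij_witness[of _ "\<lambda>j. (0, j)" snd]) auto
    have r: "(\<Sum>j=1..n. 1 / boundary_rate u v (0, j)) = b" unfolding b_def
      by (intro sum.cong) (auto simp: boundary_rate_def)
    have "real (card ({0::nat}\<times>{1..n})) \<le> N" using N by simp
    moreover have "\<eta> \<le> boundary_rate u v k" if "k \<in> {0}\<times>{1..n}" for k
      using that uv by (auto simp: boundary_rate_def)
    ultimately show ?thesis
      using chernoff_two_sided[OF indep_exp_subset[OF cQ, of "{0}\<times>{1..n}"], of \<eta> "\<delta>/2" N] pos
      unfolding * r SJ_def by fastforce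
  qed
  finally show ?thesis by (simp add: a_def b_def)
qed

subsection \<open>Tail bounds for bulk passage times\<close>

text \<open>The space M has no boundary weights and need not be rich enough to carry them. An event
  about the interior has the same probability in the canonical model, where the axes are
  present.\<close>

lemma bulk_law_product:
  fixes M :: "'s measure"
  assumes Y: "indep_exp M Y ({1..m}\<times>{1..n}) (\<lambda>p. u (fst p) + v (snd p))"
    and uv: "\<And>i. i \<le> m \<Longrightarrow> u i > 0" "\<And>j. j \<le> n \<Longrightarrow> v j > 0" and S: "S \<in> sets borel"
  shows "measure M {\<omega>\<in>space M. bulk (\<lambda>p. Y p \<omega>) m n \<in> S} =
    measure (\<Pi>\<^sub>M p\<in>{..m}\<times>{..n}. exp_measure (boundary_rate u v p))
      {x\<in>space (\<Pi>\<^sub>M p\<in>{..m}\<times>{..n}. exp_measure (boundary_rate u v p)). bulk x m n \<in> S}"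
proof -
  interpret boundary_product m n u v using uv by unfold_locales
  have cQ: "indep_exp Q (\<lambda>k x. x k) ({..m}\<times>{..n}) (boundary_rate u v)"
    using boundary_rate_pos by (intro indep_exp_coordinates) auto
  have "indep_exp Q (\<lambda>k x. x k) ({1..m}\<times>{1..n}) (boundary_rate u v)"
    by (rule indep_exp_subset[OF cQ]) auto
  then have cQ': "indep_exp Q (\<lambda>k x. x k) ({1..m}\<times>{1..n}) (\<lambda>p. u (fst p) + v (snd p))"
    by (rule indep_exp_cong_rate) (auto simp: boundary_rate_def)
  show ?thesis
  proof (rule indep_exp_transfer[OF Y cQ'])
    have [measurable]: "(\<lambda>x. bulk x m n) \<in> borel_measurable (\<Pi>\<^sub>M k\<in>{1..m}\<times>{1..n}. borel)"
      by (rule bulk_measurable) auto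
    show "{x \<in> space (\<Pi>\<^sub>M k\<in>{1..m} \<times> {1..n}. borel). bulk x m n \<in> S} \<in> sets (\<Pi>\<^sub>M k\<in>{1..m} \<times> {1..n}. borel)"
      using S by measurable
    show "(bulk x m n \<in> S) \<longleftrightarrow> (bulk y m n \<in> S)"
      if "\<And>k. k \<in> {1..m} \<times> {1..n} \<Longrightarrow> x k = y k" for x y
      using bulk_cong[of m n x y] that by simp
  qed
qed

text \<open>Monotone coupling with rates of the exact form u i + v j: lowering a rate enlarges the
  weight on the same sample point. The slack in the inequalities matters for slow columns, where the
  shifts of the two parameter sets do not cancel.\<close>

lemma bulk_rescale:
  fixes M :: "'s measure"
  assumes X: "indep_exp M X ({1..m}\<times>{1..n}) r"
    and uv: "\<And>i. i \<in> {1..m} \<Longrightarrow> u i > 0" "\<And>j. j \<in> {1..n} \<Longrightarrow> v j > 0"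
  defines "Y \<equiv> \<lambda>p \<omega>. r p / (u (fst p) + v (snd p)) * X p \<omega>"
  shows "indep_exp M Y ({1..m}\<times>{1..n}) (\<lambda>p. u (fst p) + v (snd p))"
    and "(\<And>i j. i \<in> {1..m} \<Longrightarrow> j \<in> {1..n} \<Longrightarrow> u i + v j \<le> r (i, j)) \<Longrightarrow>
      AE \<omega> in M. bulk (\<lambda>p. X p \<omega>) m n \<le> bulk (\<lambda>p. Y p \<omega>) m n"
    and "(\<And>i j. i \<in> {1..m} \<Longrightarrow> j \<in> {1..n} \<Longrightarrow> u i + v j \<ge> r (i, j)) \<Longrightarrow>
      AE \<omega> in M. bulk (\<lambda>p. X p \<omega>) m n \<ge> bulk (\<lambda>p. Y p \<omega>) m n"
proof -
  have pos: "r p > 0" "u (fst p) + v (snd p) > 0" if "p \<in> {1..m}\<times>{1..n}" for p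
    using indep_exp_rate_pos[OF X that] uv that by (auto intro!: add_pos_pos)
  have "indep_exp M Y ({1..m}\<times>{1..n}) (\<lambda>p. r p / (r p / (u (fst p) + v (snd p))))"
    unfolding Y_def using pos by (intro indep_exp_scale X) auto
  then show "indep_exp M Y ({1..m}\<times>{1..n}) (\<lambda>p. u (fst p) + v (snd p))"
    by (rule indep_exp_cong_rate) (use pos in force)
  have AE: "AE \<omega> in M. \<forall>p\<in>{1..m}\<times>{1..n}. X p \<omega> \<ge> 0"
    by (rule indep_exp_AE_nonneg[OF X]) auto
  show "AE \<omega> in M. bulk (\<lambda>p. X p \<omega>) m n \<le> bulk (\<lambda>p. Y p \<omega>) m n"
    if le: "\<And>i j. i \<in> {1..m} \<Longrightarrow> j \<in> {1..n} \<Longrightarrow> u i + v j \<le> r (i, j)"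
    using AE
  proof eventually_elim
    case (elim \<omega>)
    show ?case
    proof (rule bulk_mono)
      fix p assume p: "p \<in> {1..m}\<times>{1..n}"
      then have "1 * X p \<omega> \<le> Y p \<omega>"
        unfolding Y_def using elim pos[OF p] le[of "fst p" "snd p"] by (intro mult_right_mono) auto
      then show "X p \<omega> \<le> Y p \<omega>" by simp
    qed
  qed
  show "AE \<omega> in M. bulk (\<lambda>p. X p \<omega>) m n \<ge> bulk (\<lambda>p. Y p \<omega>) m n"
    if le: "\<And>i j. i \<in> {1..m} \<Longrightarrow> j \<in> {1..n} \<Longrightarrow> u i + v j \<ge> r (i, j)"
    using AE
  proof eventually_elim
    case (elim \<omega>)
    show ?case
    proof (rule bulk_mono)
      fix p assume p: "p \<in> {1..m}\<times>{1..n}"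
      then have "Y p \<omega> \<le> 1 * X p \<omega>"
        unfolding Y_def using elim pos[OF p] le[of "fst p" "snd p"] by (intro mult_right_mono) auto
      then show "Y p \<omega> \<le> X p \<omega>" by simp
    qed
  qed
qed

lemma indep_exp_bulk_measurable:
  assumes "indep_exp M X ({1..m}\<times>{1..n}) r"
  shows "(\<lambda>\<omega>. bulk (\<lambda>p. X p \<omega>) m n) \<in> borel_measurable M"
  using indep_exp_measurable[OF assms] by (intro bulk_measurable) auto

text \<open>Nonnegative boundary weights only help, so \<open>bulk\<close> lies below the stationary
  \<open>lpp\<close>, which concentrates. No choice of parameter is involved, so the bound is
  available for every admissible shift.\<close>

lemma bulk_upper_tail:
  fixes M :: "'s measure"
  assumes X: "indep_exp M X ({1..m}\<times>{1..n}) r"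
    and r: "\<And>i j. i \<in> {1..m} \<Longrightarrow> j \<in> {1..n} \<Longrightarrow> u i + v j \<le> r (i, j)"
    and uv: "\<And>i. i \<in> {1..m} \<Longrightarrow> u i \<ge> \<eta>" "\<And>j. j \<in> {1..n} \<Longrightarrow> v j \<ge> \<eta>"
    and pos: "\<eta> > 0" "\<delta> > 0" and N: "real (m + n) \<le> N"
  shows "measure M {\<omega>\<in>space M. bulk (\<lambda>p. X p \<omega>) m n \<ge> (\<Sum>i=1..m. 1 / u i) + (\<Sum>j=1..n. 1 / v j) + \<delta> * N}
    \<le> 4 * exp (- chernoff \<eta> (\<delta> / 2) * N)"
proof -
  interpret prob_space M using X by (rule indep_exp_prob_space)
  \<comment> \<open>Index 0 does not enter the sums; the value \<eta> only gives the dummy corner a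
    legitimate rate.\<close>
  define u' where "u' = u(0 := \<eta>)"
  define v' where "v' = v(0 := \<eta>)"
  have uv': "i \<le> m \<Longrightarrow> u' i \<ge> \<eta>" "j \<le> n \<Longrightarrow> v' j \<ge> \<eta>" for i j
    using uv by (auto simp: u'_def v'_def)
  have uv'_pos: "i \<le> m \<Longrightarrow> u' i > 0" "j \<le> n \<Longrightarrow> v' j > 0" for i j
    using uv'(1)[of i] uv'(2)[of j] pos by auto
  interpret boundary_product m n u' v' using uv'_pos by unfold_locales auto
  have cQ: "indep_exp Q (\<lambda>k x. x k) ({..m}\<times>{..n}) (boundary_rate u' v')"
    using boundary_rate_pos by (intro indep_exp_coordinates) auto
  interpret Q: prob_space Q using cQ by (rule indep_exp_prob_space)
  define s where "s = (\<Sum>i=1..m. 1 / u i) + (\<Sum>j=1..n. 1 / v j)"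
  have s': "s = (\<Sum>i=1..m. 1 / u' i) + (\<Sum>j=1..n. 1 / v' j)" by (simp add: s_def u'_def v'_def)
  define Y where "Y p \<omega> = r p / (u' (fst p) + v' (snd p)) * X p \<omega>" for p \<omega>
  have Y: "indep_exp M Y ({1..m}\<times>{1..n}) (\<lambda>p. u' (fst p) + v' (snd p))"
    unfolding Y_def using uv'_pos by (intro bulk_rescale(1)[OF X]) auto
  have "AE \<omega> in M. bulk (\<lambda>p. X p \<omega>) m n \<le> bulk (\<lambda>p. Y p \<omega>) m n"
  proof -
    have "u' i + v' j \<le> r (i, j)" if "i \<in> {1..m}" "j \<in> {1..n}" for i j
      using r[OF that] that by (simp add: u'_def v'_def)
    then show ?thesis
      unfolding Y_def using uv'_pos by (intro bulk_rescale(2)[OF X]) auto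
  qed
  then have "measure M {\<omega>\<in>space M. bulk (\<lambda>p. X p \<omega>) m n \<ge> s + \<delta> * N} \<le>
    measure M {\<omega>\<in>space M. bulk (\<lambda>p. Y p \<omega>) m n \<in> {s + \<delta> * N..}}"
    using indep_exp_bulk_measurable[OF Y] by (intro finite_measure_mono_AE) auto
  also have "\<dots> = measure Q {x\<in>space Q. bulk x m n \<in> {s + \<delta> * N..}}"
    using uv'_pos by (intro bulk_law_product Y) auto
  also have "\<dots> \<le> measure Q {x\<in>space Q. \<bar>lpp x m n - s\<bar> \<ge> \<delta> * N}"
  proof (rule Q.finite_measure_mono_AE)
    have [measurable]: "(\<lambda>x. lpp x m n) \<in> borel_measurable Q"
      by (rule lpp_measurable) (rule coord_measurable)
    show "{x\<in>space Q. \<bar>lpp x m n - s\<bar> \<ge> \<delta> * N} \<in> Q.events" by measurable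
    have "AE x in Q. \<forall>p\<in>{..m}\<times>{..n}. x p \<ge> 0" by (rule indep_exp_AE_nonneg[OF cQ]) auto
    then show "AE x in Q. x \<in> {x\<in>space Q. bulk x m n \<in> {s + \<delta> * N..}} \<longrightarrow> x \<in> {x\<in>space Q. \<bar>lpp x m n - s\<bar> \<ge> \<delta> * N}"
    proof eventually_elim
      case (elim x)
      then show ?case using bulk_le_lpp[of m n x] by auto
    qed
  qed
  also have "\<dots> \<le> 4 * exp (- chernoff \<eta> (\<delta> / 2) * N)"
    unfolding s' using uv' pos N by (intro lpp_concentration[OF cQ]) auto
  finally show ?thesis unfolding s_def .
qed

text \<open>Exactly, 1 / (x - h) = 1 / x + h / x^2 + h^2 / (x^2 (x - h)), and likewise with - h. The
  linear terms combine to the imbalance, and each remainder is at most 2 h^2 / \<eta>^3 because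
  denominators stay above \<eta> / 2. Only one sign of the imbalance is assumed; the other shift
  follows by exchanging u and v.\<close>

lemma boundary_shift_expansion:
  fixes u v :: "nat \<Rightarrow> real"
  assumes "\<And>i. i \<in> {1..m} \<Longrightarrow> u i \<ge> \<eta>" "\<And>j. j \<in> {1..n} \<Longrightarrow> v j \<ge> \<eta>" "\<eta> > 0" "0 < h" "h \<le> \<eta> / 2"
    and N: "real (m + n) \<le> N"
    and bal: "(\<Sum>i=1..m. 1 / (u i)\<^sup>2) - (\<Sum>j=1..n. 1 / (v j)\<^sup>2) \<le> \<kappa> * N"
  shows "(\<Sum>i=1..m. 1 / (u i - h)) + (\<Sum>j=1..n. 1 / (v j + h)) - ((\<Sum>i=1..m. 1 / u i) + (\<Sum>j=1..n. 1 / v j))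
     \<le> h * (\<kappa> + 2 * h / \<eta> ^ 3) * N"
proof -
  have c: "h\<^sup>2 / (x\<^sup>2 * y) \<le> h\<^sup>2 * (2 / \<eta> ^ 3)" if "x \<ge> \<eta>" "y \<ge> \<eta> / 2" for x y
  proof -
    have "\<eta>\<^sup>2 * (\<eta> / 2) \<le> x\<^sup>2 * y" using that assms by (intro mult_mono power_mono) auto
    then have "h\<^sup>2 / (x\<^sup>2 * y) \<le> h\<^sup>2 / (\<eta>\<^sup>2 * (\<eta> / 2))" using assms that by (intro divide_left_mono mult_pos_pos) auto
    then show ?thesis by (simp add: power2_eq_square power3_eq_cube)
  qed
  have "1 / (u i - h) \<le> 1 / u i + h * (1 / (u i)\<^sup>2) + h\<^sup>2 * (2 / \<eta> ^ 3)" if "i \<in> {1..m}" for i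
  proof -
    have p: "u i \<ge> \<eta>" "u i > 0" "u i - h > 0" "u i - h \<ge> \<eta> / 2" using assms(1)[OF that] assms(3,4,5) by auto
    have "1 / (u i - h) = 1 / u i + h * (1 / (u i)\<^sup>2) + h\<^sup>2 / ((u i)\<^sup>2 * (u i - h))"
      using p by (simp add: divide_simps) (simp add: power2_eq_square algebra_simps)
    then show ?thesis using c[OF p(1,4)] by simp
  qed
  then have A: "(\<Sum>i=1..m. 1 / (u i - h)) \<le> (\<Sum>i=1..m. 1 / u i + h * (1 / (u i)\<^sup>2) + h\<^sup>2 * (2 / \<eta> ^ 3))"
    by (rule sum_mono)
  have "1 / (v j + h) \<le> 1 / v j - h * (1 / (v j)\<^sup>2) + h\<^sup>2 * (2 / \<eta> ^ 3)" if "j \<in> {1..n}" for j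
  proof -
    have p: "v j \<ge> \<eta>" "v j > 0" "v j + h \<ge> \<eta> / 2" using assms(2)[OF that] assms(3,4,5) by auto
    have "1 / (v j + h) = 1 / v j - h * (1 / (v j)\<^sup>2) + h\<^sup>2 / ((v j)\<^sup>2 * (v j + h))"
      using p \<open>h > 0\<close> by (simp add: divide_simps) (simp add: power2_eq_square algebra_simps)
    then show ?thesis using c[OF p(1,3)] by simp
  qed
  then have B: "(\<Sum>j=1..n. 1 / (v j + h)) \<le> (\<Sum>j=1..n. 1 / v j - h * (1 / (v j)\<^sup>2) + h\<^sup>2 * (2 / \<eta> ^ 3))"
    by (rule sum_mono)
  define P where "P = (\<Sum>i=1..m. 1 / (u i)\<^sup>2)"
  define R where "R = (\<Sum>j=1..n. 1 / (v j)\<^sup>2)"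
  have "(\<Sum>i=1..m. 1 / (u i - h)) + (\<Sum>j=1..n. 1 / (v j + h)) - ((\<Sum>i=1..m. 1 / u i) + (\<Sum>j=1..n. 1 / v j))
     \<le> h * P - h * R + real (m + n) * (h\<^sup>2 * (2 / \<eta> ^ 3))"
    using A B unfolding P_def R_def sum.distrib sum_subtractf sum_distrib_left[symmetric]
    by (simp add: algebra_simps add_divide_distrib)
  also have "real (m + n) * (h\<^sup>2 * (2 / \<eta> ^ 3)) \<le> N * (h\<^sup>2 * (2 / \<eta> ^ 3))"
    using N assms by (intro mult_right_mono) auto
  also have "h * P - h * R \<le> h * (\<kappa> * N)"
    using mult_left_mono[OF bal, of h] assms unfolding P_def R_def by (simp add: algebra_simps)
  finally show ?thesis by (simp add: power2_eq_square algebra_simps)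
qed

text \<open>Widening the boundary weights \<open>I i\<close> by the factors \<open>u i / (u i - h)\<close> raises the boundary sum
  to any point by an amount that controls the sum itself, up to an arbitrarily small multiple of \<open>N\<close>.\<close>

lemma exit_budget:
  fixes u I :: "nat \<Rightarrow> real"
  assumes "\<And>i. i \<in> {1..m} \<Longrightarrow> u i > h" "\<And>i. i \<in> {1..m} \<Longrightarrow> I i \<ge> 0" "k \<le> m" "h > 0" "\<tau> > 0"
    and "(\<Sum>i=1..m. u i * I i) \<le> 2 * N"
    and "(\<Sum>i=1..k. u i / (u i - h) * I i) - (\<Sum>i=1..k. I i) \<le> h * \<beta> * N"
  shows "(\<Sum>i=1..k. I i) \<le> 2 * \<tau> * N + \<beta> * N / (4 * \<tau>)"
proof -
  have "(\<Sum>i=1..k. I i) \<le> (\<Sum>i=1..k. \<tau> * (u i * I i) + (u i / (u i - h) * I i - I i) / (4 * \<tau> * h))"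
  proof (rule sum_mono)
    fix i assume "i \<in> {1..k}"
    then have i: "u i > h" "I i \<ge> 0" using assms by auto
    \<comment> \<open>From (2 \<tau> u - 1)^2 \<ge> 0. It splits the unit mass of each weight: where
      u is large, \<tau> u pays, charged to the sum of u i * I i; where u is small, the relative
      gain of at least h / u pays, charged to the increase of the boundary sum.\<close>
    have "4 * \<tau> * u i \<le> 4 * \<tau> * \<tau> * (u i * u i) + 1"
      using zero_le_power2[of "2 * \<tau> * u i - 1"] by (simp add: power2_eq_square algebra_simps)
    then have "1 \<le> \<tau> * u i + 1 / (4 * \<tau> * u i)"
      using i assms by (simp add: field_simps)
    also have "1 / (4 * \<tau> * u i) \<le> (u i / (u i - h) - 1) / (4 * \<tau> * h)"
    proof -
      have "(u i / (u i - h) - 1) / (4 * \<tau> * h) = 1 / (4 * \<tau> * (u i - h))"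
        using i assms by (simp add: field_simps)
      also have "\<dots> \<ge> 1 / (4 * \<tau> * u i)" using i assms by (intro divide_left_mono) auto
      finally show ?thesis .
    qed
    finally have "1 * I i \<le> (\<tau> * u i + (u i / (u i - h) - 1) / (4 * \<tau> * h)) * I i"
      using i by (intro mult_right_mono) auto
    then show "I i \<le> \<tau> * (u i * I i) + (u i / (u i - h) * I i - I i) / (4 * \<tau> * h)"
      by (simp add: algebra_simps)
  qed
  also have "\<dots> = \<tau> * (\<Sum>i=1..k. u i * I i) + ((\<Sum>i=1..k. u i / (u i - h) * I i) - (\<Sum>i=1..k. I i)) / (4 * \<tau> * h)"
    by (simp add: sum.distrib sum_distrib_left sum_subtractf sum_divide_distrib diff_divide_distrib)
  also have "(\<Sum>i=1..k. u i * I i) \<le> (\<Sum>i=1..m. u i * I i)"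
  proof (rule sum_mono2)
    fix i assume "i \<in> {1..m} - {1..k}"
    then show "0 \<le> u i * I i" using assms(1,2)[of i] \<open>h > 0\<close> by auto
  qed (use assms in auto)
  also have "\<dots> \<le> 2 * N" by fact
  also have "((\<Sum>i=1..k. u i / (u i - h) * I i) - (\<Sum>i=1..k. I i)) / (4 * \<tau> * h) \<le> h * \<beta> * N / (4 * \<tau> * h)"
    using assms by (intro divide_right_mono) auto
  also have "h * \<beta> * N / (4 * \<tau> * h) = \<beta> * N / (4 * \<tau>)" using assms by simp
  finally show ?thesis using assms by simp
qed

text \<open>Only boundary weights are multiplied. The interior rates need no change because (u - h)
  + (v + h) = u + v, so the rescaled configuration is again stationary, and it shares its interior
  with the original one.\<close>

lemma rate_shift_concentration:
  assumes uv: "\<And>i. i \<le> m \<Longrightarrow> u i \<ge> \<eta>" "\<And>j. j \<le> n \<Longrightarrow> v j \<ge> \<eta>"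
    and pos: "\<eta> > 0" "\<delta> > 0" and N: "real (m + n) \<le> N" and h: "\<bar>h\<bar> \<le> \<eta> / 2"
    and X: "indep_exp M X ({..m}\<times>{..n}) (boundary_rate u v)"
  defines "c \<equiv> \<lambda>p. if snd p = 0 then u (fst p) / (u (fst p) - h) else if fst p = 0 then v (snd p) / (v (snd p) + h) else 1"
  shows "measure M {\<omega>\<in>space M. \<bar>lpp (\<lambda>p. c p * X p \<omega>) m n - ((\<Sum>i=1..m. 1 / (u i - h)) + (\<Sum>j=1..n. 1 / (v j + h)))\<bar> \<ge> \<delta> * N}
    \<le> 4 * exp (- chernoff (\<eta> / 2) (\<delta> / 2) * N)"
proof (rule lpp_concentration)
  have p: "u i > 0" "u i - h > 0" "u i - h \<ge> \<eta> / 2" if "i \<le> m" for i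
    using uv(1)[OF that] pos h by (auto simp: abs_if split: if_splits)
  have q: "v j > 0" "v j + h > 0" "v j + h \<ge> \<eta> / 2" if "j \<le> n" for j
    using uv(2)[OF that] pos h by (auto simp: abs_if split: if_splits)
  have "indep_exp M (\<lambda>k \<omega>. c k * X k \<omega>) ({..m} \<times> {..n}) (\<lambda>k. boundary_rate u v k / c k)"
    using p q by (intro indep_exp_scale X) (auto simp: c_def)
  then show "indep_exp M (\<lambda>k \<omega>. c k * X k \<omega>) ({..m} \<times> {..n}) (boundary_rate (\<lambda>i. u i - h) (\<lambda>j. v j + h))"
    by (rule indep_exp_cong_rate) (use p q in \<open>force simp: c_def boundary_rate_def\<close>)
  show "u i - h \<ge> \<eta> / 2" if "i \<le> m" for i using p[OF that] by simp
  show "v j + h \<ge> \<eta> / 2" if "j \<le> n" for j using q[OF that] by simp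
qed (use pos N in auto)

text \<open>Balance of the two second-order sums makes the mean of the stationary model stationary under
  perturbation of its parameter, so that leaving the axes at macroscopic distance is too expensive.\<close>

lemma balanced_bulk_lower_tail:
  fixes \<eta> \<delta> :: real
  assumes pos: "\<eta> > 0" "\<delta> > 0"
  shows "\<exists>\<kappa>>0. \<exists>c>0. \<forall>(M :: 's measure) X r u v m n N.
    indep_exp M X ({1..m}\<times>{1..n}) r \<longrightarrow>
    (\<forall>i\<in>{1..m}. \<forall>j\<in>{1..n}. r (i, j) \<le> u i + v j) \<longrightarrow>
    (\<forall>i\<in>{1..m}. u i \<ge> \<eta>) \<longrightarrow> (\<forall>j\<in>{1..n}. v j \<ge> \<eta>) \<longrightarrow> real (m + n) \<le> N \<longrightarrow>
    \<bar>(\<Sum>i=1..m. 1 / (u i)\<^sup>2) - (\<Sum>j=1..n. 1 / (v j)\<^sup>2)\<bar> \<le> \<kappa> * N \<longrightarrow>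
    measure M {\<omega>\<in>space M. bulk (\<lambda>p. X p \<omega>) m n < (\<Sum>i=1..m. 1 / u i) + (\<Sum>j=1..n. 1 / v j) - \<delta> * N}
      \<le> 16 * exp (- c * N)"
proof -
  \<comment> \<open>Per unit of h N, \<beta> collects the imbalance \<kappa>, the second-order term
    and two fluctuations \<epsilon>, each at most \<delta>^2 / 32. With \<tau> = \<delta> / 8 the
    exit budget 2 \<tau> + \<beta> / (4 \<tau>) is at most \<delta> / 2, and \<epsilon> \<le>
    \<delta> / 4 leaves room for the fluctuation of the stationary time itself.\<close>
  define \<kappa> where "\<kappa> = \<delta>\<^sup>2 / 32"
  define h where "h = min (\<eta> / 2) (\<eta> ^ 3 * \<delta>\<^sup>2 / 64)"
  define \<epsilon> where "\<epsilon> = min (\<delta> / 4) (h * \<delta>\<^sup>2 / 64)"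
  define \<tau> where "\<tau> = \<delta> / 8"
  define \<beta> where "\<beta> = \<kappa> + 2 * h / \<eta> ^ 3 + 2 * \<epsilon> / h"
  have h: "h > 0" "h \<le> \<eta> / 2" using pos by (auto simp: h_def)
  have c0: "\<kappa> > 0" "\<epsilon> > 0" "\<tau> > 0" using pos h by (auto simp: \<kappa>_def \<epsilon>_def \<tau>_def)
  have "2 * h / \<eta> ^ 3 \<le> \<delta>\<^sup>2 / 32"
  proof -
    have "h \<le> \<eta> ^ 3 * \<delta>\<^sup>2 / 64" by (simp add: h_def)
    then show ?thesis using pos by (simp add: field_simps)
  qed
  moreover have "2 * \<epsilon> / h \<le> \<delta>\<^sup>2 / 32"
  proof -
    have "\<epsilon> \<le> h * \<delta>\<^sup>2 / 64" by (simp add: \<epsilon>_def)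
    then show ?thesis using h by (simp add: field_simps)
  qed
  moreover have "\<delta>\<^sup>2 \<ge> 0" by simp
  ultimately have "\<beta> \<le> \<delta>\<^sup>2 / 8" unfolding \<beta>_def \<kappa>_def by linarith
  then have "\<beta> / (4 * \<tau>) \<le> \<delta>\<^sup>2 / 8 / (4 * \<tau>)" using c0 by (intro divide_right_mono) auto
  also have "\<delta>\<^sup>2 / 8 / (4 * \<tau>) = \<delta> / 4" using pos by (simp add: \<tau>_def power2_eq_square)
  finally have budget: "2 * \<tau> + \<beta> / (4 * \<tau>) \<le> \<delta> / 2" by (simp add: \<tau>_def)
  define c where "c = min (chernoff (\<eta> / 2) (\<epsilon> / 2)) (chernoff 1 1)"
  have c: "c > 0" "c \<le> chernoff (\<eta> / 2) (\<epsilon> / 2)" "c \<le> chernoff 1 1"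
    using chernoff_pos pos c0 by (auto simp: c_def)
  show ?thesis
  proof (rule exI[of _ \<kappa>], rule conjI[OF c0(1)], rule exI[of _ c], rule conjI[OF c(1)], intro allI impI)
    fix M :: "'s measure" and X r and u v :: "nat \<Rightarrow> real" and m n :: nat and N :: real
    assume X: "indep_exp M X ({1..m}\<times>{1..n}) r"
      and r: "\<forall>i\<in>{1..m}. \<forall>j\<in>{1..n}. r (i, j) \<le> u i + v j"
      and u: "\<forall>i\<in>{1..m}. u i \<ge> \<eta>" and v: "\<forall>j\<in>{1..n}. v j \<ge> \<eta>" and N: "real (m + n) \<le> N"
      and bal: "\<bar>(\<Sum>i=1..m. 1 / (u i)\<^sup>2) - (\<Sum>j=1..n. 1 / (v j)\<^sup>2)\<bar> \<le> \<kappa> * N"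
    interpret prob_space M using X by (rule indep_exp_prob_space)
    define u' where "u' = u(0 := \<eta>)"
    define v' where "v' = v(0 := \<eta>)"
    have uv': "i \<le> m \<Longrightarrow> u' i \<ge> \<eta>" "j \<le> n \<Longrightarrow> v' j \<ge> \<eta>" for i j
      using u v by (auto simp: u'_def v'_def)
    have uv'_pos: "i \<le> m \<Longrightarrow> u' i > 0" "j \<le> n \<Longrightarrow> v' j > 0" for i j
      using uv'(1)[of i] uv'(2)[of j] pos by auto
    interpret boundary_product m n u' v' using uv'_pos by unfold_locales auto
    have cQ: "indep_exp Q (\<lambda>k x. x k) ({..m}\<times>{..n}) (boundary_rate u' v')"
      using boundary_rate_pos by (intro indep_exp_coordinates) auto
    interpret Q: prob_space Q using cQ by (rule indep_exp_prob_space)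
    define s where "s h = (\<Sum>i=1..m. 1 / (u' i - h)) + (\<Sum>j=1..n. 1 / (v' j + h))" for h
    have s0: "s 0 = (\<Sum>i=1..m. 1 / u i) + (\<Sum>j=1..n. 1 / v j)" by (simp add: s_def u'_def v'_def)
    define Y where "Y p \<omega> = r p / (u' (fst p) + v' (snd p)) * X p \<omega>" for p \<omega>
    have Y: "indep_exp M Y ({1..m}\<times>{1..n}) (\<lambda>p. u' (fst p) + v' (snd p))"
      unfolding Y_def using uv'_pos by (intro bulk_rescale(1)[OF X]) auto
    have "AE \<omega> in M. bulk (\<lambda>p. X p \<omega>) m n \<ge> bulk (\<lambda>p. Y p \<omega>) m n"
    proof -
      have "r (i, j) \<le> u' i + v' j" if "i \<in> {1..m}" "j \<in> {1..n}" for i j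
        using r that by (simp add: u'_def v'_def)
      then show ?thesis
        unfolding Y_def using uv'_pos by (intro bulk_rescale(3)[OF X]) auto
    qed
    then have "prob {\<omega>\<in>space M. bulk (\<lambda>p. X p \<omega>) m n < s 0 - \<delta> * N} \<le>
      prob {\<omega>\<in>space M. bulk (\<lambda>p. Y p \<omega>) m n \<in> {..<s 0 - \<delta> * N}}"
      using indep_exp_bulk_measurable[OF Y] by (intro finite_measure_mono_AE) auto
    also have "\<dots> = Q.prob {x\<in>space Q. bulk x m n \<in> {..<s 0 - \<delta> * N}}"
      using uv'_pos by (intro bulk_law_product Y) auto
    also have "\<dots> \<le> 16 * exp (- c * N)"
    proof -
      \<comment> \<open>Five bad events: the stationary time misbehaves at shift 0, h or - h, or one
        of the two weighted boundary sums exceeds its mean by N. The products u i * x (i, 0) are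
        Exp(1), so the weighted sums are otherwise at most 2 N. The bounds add up to 3 * 4 + 2 * 2 =
        16.\<close>
      define f where "f h p = (if snd p = 0 then u' (fst p) / (u' (fst p) - h)
          else if fst p = 0 then v' (snd p) / (v' (snd p) + h) else 1)" for h p
      define E where "E h = {x\<in>space Q. \<bar>lpp (\<lambda>p. f h p * x p) m n - s h\<bar> \<ge> \<epsilon> * N}" for h
      define EI where "EI = {x\<in>space Q. \<bar>(\<Sum>p\<in>{1..m}\<times>{0}. u' (fst p) * x p) - (\<Sum>p\<in>{1..m}\<times>{0::nat}. 1 / 1)\<bar> \<ge> 1 * N}"
      define EJ where "EJ = {x\<in>space Q. \<bar>(\<Sum>p\<in>{0}\<times>{1..n}. v' (snd p) * x p) - (\<Sum>p\<in>{0::nat}\<times>{1..n}. 1 / 1)\<bar> \<ge> 1 * N}"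
      have E: "Q.prob (E h') \<le> 4 * exp (- c * N)" if "\<bar>h'\<bar> \<le> \<eta> / 2" for h'
      proof -
        have "Q.prob (E h') \<le> 4 * exp (- chernoff (\<eta> / 2) (\<epsilon> / 2) * N)"
          unfolding E_def f_def s_def using uv' pos c0 N that cQ by (intro rate_shift_concentration) auto
        also have "\<dots> \<le> 4 * exp (- c * N)" using c N by (simp add: mult_right_mono)
        finally show ?thesis .
      qed
      have EI: "Q.prob EI \<le> 2 * exp (- c * N)"
      proof -
        have "indep_exp Q (\<lambda>k x. x k) ({1..m}\<times>{0}) (boundary_rate u' v')"
          by (rule indep_exp_subset[OF cQ]) auto
        then have "indep_exp Q (\<lambda>k x. u' (fst k) * x k) ({1..m}\<times>{0}) (\<lambda>k. boundary_rate u' v' k / u' (fst k))"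
          using uv'_pos by (intro indep_exp_scale) auto
        then have "indep_exp Q (\<lambda>k x. u' (fst k) * x k) ({1..m}\<times>{0}) (\<lambda>_. 1)"
          by (rule indep_exp_cong_rate) (use uv'_pos in \<open>force simp: boundary_rate_def\<close>)
        then have "Q.prob EI \<le> 2 * exp (- chernoff 1 1 * N)"
          unfolding EI_def using N by (intro chernoff_two_sided) auto
        also have "\<dots> \<le> 2 * exp (- c * N)" using c N by (simp add: mult_right_mono)
        finally show ?thesis .
      qed
      have EJ: "Q.prob EJ \<le> 2 * exp (- c * N)"
      proof -
        have "indep_exp Q (\<lambda>k x. x k) ({0}\<times>{1..n}) (boundary_rate u' v')"
          by (rule indep_exp_subset[OF cQ]) auto
        then have "indep_exp Q (\<lambda>k x. v' (snd k) * x k) ({0}\<times>{1..n}) (\<lambda>k. boundary_rate u' v' k / v' (snd k))"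
          using uv'_pos by (intro indep_exp_scale) auto
        then have "indep_exp Q (\<lambda>k x. v' (snd k) * x k) ({0}\<times>{1..n}) (\<lambda>_. 1)"
          by (rule indep_exp_cong_rate) (use uv'_pos in \<open>force simp: boundary_rate_def\<close>)
        then have "Q.prob EJ \<le> 2 * exp (- chernoff 1 1 * N)"
          unfolding EJ_def using N by (intro chernoff_two_sided) auto
        also have "\<dots> \<le> 2 * exp (- c * N)" using c N by (simp add: mult_right_mono)
        finally show ?thesis .
      qed
      have coord: "(\<lambda>x. x p) \<in> borel_measurable Q" if "p \<in> {..m}\<times>{..n}" for p
        using that by (rule coord_measurable)
      have [measurable]: "E h' \<in> Q.events" for h'
      proof -
        have [measurable]: "(\<lambda>x. lpp (\<lambda>p. f h' p * x p) m n) \<in> borel_measurable Q"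
          using coord by (intro lpp_measurable) auto
        show ?thesis unfolding E_def by measurable
      qed
      have EI_ev [measurable]: "EI \<in> Q.events"
      proof -
        have [measurable]: "(\<lambda>x. \<Sum>p\<in>{1..m}\<times>{0}. u' (fst p) * x p) \<in> borel_measurable Q"
          using coord by (intro borel_measurable_sum borel_measurable_times) auto
        show ?thesis unfolding EI_def by measurable
      qed
      have EJ_ev [measurable]: "EJ \<in> Q.events"
      proof -
        have [measurable]: "(\<lambda>x. \<Sum>p\<in>{0}\<times>{1..n}. v' (snd p) * x p) \<in> borel_measurable Q"
          using coord by (intro borel_measurable_sum borel_measurable_times) auto
        show ?thesis unfolding EJ_def by measurable
      qed
      have sumI: "(\<Sum>p\<in>{1..m}\<times>{0}. g p) = (\<Sum>i=1..m. g (i, 0))" for g :: "nat \<times> nat \<Rightarrow> real"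
        by (rule sum.reindex_bij_witness[of _ "\<lambda>i. (i, 0)" fst]) auto
      have sumJ: "(\<Sum>p\<in>{0}\<times>{1..n}. g p) = (\<Sum>j=1..n. g (0, j))" for g :: "nat \<times> nat \<Rightarrow> real"
        by (rule sum.reindex_bij_witness[of _ "\<lambda>j. (0, j)" snd]) auto
      have good: "bulk x m n \<ge> s 0 - \<delta> * N"
        if x: "x \<in> space Q" "\<forall>p\<in>{..m}\<times>{..n}. x p \<ge> 0" and nE: "x \<notin> E 0" "x \<notin> E h" "x \<notin> E (- h)" "x \<notin> EI" "x \<notin> EJ" for x
      proof -
        have N0: "N \<ge> 0" using N by linarith
        have f1: "f h' p = 1" if "p \<in> {1..}\<times>{1..}" for h' p using that by (auto simp: f_def)
        have "lpp (\<lambda>p. f 0 p * x p) m n = lpp x m n"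
          using uv'_pos by (intro lpp_cong) (force simp: f_def)
        then have L0: "lpp x m n \<ge> s 0 - \<epsilon> * N" using x nE by (auto simp: E_def)
        have Lh: "lpp (\<lambda>p. f h p * x p) m n \<le> s h + \<epsilon> * N" using x nE by (auto simp: E_def)
        have Lh': "lpp (\<lambda>p. f (- h) p * x p) m n \<le> s (- h) + \<epsilon> * N" using x nE by (auto simp: E_def)
        have I: "(\<Sum>i=1..m. u' i * x (i, 0)) \<le> 2 * N"
          using x nE(4) N unfolding EI_def sumI by (auto simp: abs_if split: if_splits)
        have J: "(\<Sum>j=1..n. v' j * x (0, j)) \<le> 2 * N"
          using x nE(5) N unfolding EJ_def sumJ by (auto simp: abs_if split: if_splits)
        have bal': "\<bar>(\<Sum>i=1..m. 1 / (u' i)\<^sup>2) - (\<Sum>j=1..n. 1 / (v' j)\<^sup>2)\<bar> \<le> \<kappa> * N"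
          using bal by (simp add: u'_def v'_def)
        have "(\<Sum>i=1..m. 1 / (u' i - h)) + (\<Sum>j=1..n. 1 / (v' j + h)) - ((\<Sum>i=1..m. 1 / u' i) + (\<Sum>j=1..n. 1 / v' j))
          \<le> h * (\<kappa> + 2 * h / \<eta> ^ 3) * N"
          using uv' pos h N bal' by (intro boundary_shift_expansion) auto
        then have sh: "s h - s 0 \<le> h * (\<kappa> + 2 * h / \<eta> ^ 3) * N" by (simp add: s_def)
        have "(\<Sum>j=1..n. 1 / (v' j - h)) + (\<Sum>i=1..m. 1 / (u' i + h)) - ((\<Sum>j=1..n. 1 / v' j) + (\<Sum>i=1..m. 1 / u' i))
          \<le> h * (\<kappa> + 2 * h / \<eta> ^ 3) * N"
          using uv' pos h N bal' by (intro boundary_shift_expansion) auto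
        then have sh': "s (- h) - s 0 \<le> h * (\<kappa> + 2 * h / \<eta> ^ 3) * N" by (simp add: s_def)
        have \<beta>: "h * \<beta> * N = h * (\<kappa> + 2 * h / \<eta> ^ 3) * N + 2 * \<epsilon> * N"
          using h by (simp add: \<beta>_def algebra_simps)
        obtain R where R: "R \<le> bulk x m n" and
          "(\<exists>k\<le>m. lpp x m n = (\<Sum>i=1..k. x (i, 0)) + R \<and>
              (\<forall>y. (\<forall>p\<in>{1..}\<times>{1..}. y p = x p) \<longrightarrow> (\<Sum>i=1..k. y (i, 0)) + R \<le> lpp y m n)) \<or>
           (\<exists>k\<le>n. lpp x m n = (\<Sum>j=1..k. x (0, j)) + R \<and>
              (\<forall>y. (\<forall>p\<in>{1..}\<times>{1..}. y p = x p) \<longrightarrow> (\<Sum>j=1..k. y (0, j)) + R \<le> lpp y m n))"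
          (is "(\<exists>k. ?P k) \<or> (\<exists>k. ?R k)")
          using lpp_exit_point[of x m n] by blast
        then consider k where "?P k" | k where "?R k" by blast
        then have "lpp x m n - R \<le> 2 * \<tau> * N + \<beta> * N / (4 * \<tau>)"
        proof cases
          case (1 k)
          \<comment> \<open>The path leaves the horizontal axis at k, so shift h enlarges the
            weights it collects there. Followed in the shifted model it is still below the maximum;
            subtracting the original value bounds the enlargement by s h - s 0 plus two
            fluctuations.\<close>
          have "\<forall>p\<in>{1..}\<times>{1..}. f h p * x p = x p" using f1 by simp
          then have "(\<Sum>i=1..k. f h (i, 0) * x (i, 0)) + R \<le> lpp (\<lambda>p. f h p * x p) m n"
            using 1[THEN conjunct2, THEN conjunct2, THEN spec[of _ "\<lambda>p. f h p * x p"]] by blast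
          moreover have "(\<Sum>i=1..k. f h (i, 0) * x (i, 0)) = (\<Sum>i=1..k. u' i / (u' i - h) * x (i, 0))"
            by (intro sum.cong) (auto simp: f_def)
          ultimately have "(\<Sum>i=1..k. u' i / (u' i - h) * x (i, 0)) - (\<Sum>i=1..k. x (i, 0)) \<le> h * \<beta> * N"
            using 1 L0 Lh sh unfolding \<beta> by linarith
          moreover have "u' i > h" if "i \<in> {1..m}" for i using uv'(1)[of i] that h pos by auto
          ultimately have "(\<Sum>i=1..k. x (i, 0)) \<le> 2 * \<tau> * N + \<beta> * N / (4 * \<tau>)"
            using 1 I x h c0 by (intro exit_budget[where m=m and h=h and u=u']) auto
          then show ?thesis using 1 by linarith
        next
          case (2 k)
          \<comment> \<open>The vertical weights are enlarged by the opposite shift: v / (v + h) at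
            - h is v / (v - h).\<close>
          have "\<forall>p\<in>{1..}\<times>{1..}. f (- h) p * x p = x p" using f1 by simp
          then have "(\<Sum>j=1..k. f (- h) (0, j) * x (0, j)) + R \<le> lpp (\<lambda>p. f (- h) p * x p) m n"
            using 2[THEN conjunct2, THEN conjunct2, THEN spec[of _ "\<lambda>p. f (- h) p * x p"]] by blast
          moreover have "(\<Sum>j=1..k. f (- h) (0, j) * x (0, j)) = (\<Sum>j=1..k. v' j / (v' j - h) * x (0, j))"
            by (intro sum.cong) (auto simp: f_def)
          ultimately have "(\<Sum>j=1..k. v' j / (v' j - h) * x (0, j)) - (\<Sum>j=1..k. x (0, j)) \<le> h * \<beta> * N"
            using 2 L0 Lh' sh' unfolding \<beta> by linarith
          moreover have "v' j > h" if "j \<in> {1..n}" for j using uv'(2)[of j] that h pos by auto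
          ultimately have "(\<Sum>j=1..k. x (0, j)) \<le> 2 * \<tau> * N + \<beta> * N / (4 * \<tau>)"
            using 2 J x h c0 by (intro exit_budget[where m=n and h=h and u=v']) auto
          then show ?thesis using 2 by linarith
        qed
        also have "\<dots> = (2 * \<tau> + \<beta> / (4 * \<tau>)) * N" by (simp add: algebra_simps)
        also have "\<dots> \<le> \<delta> / 2 * N" using budget N0 by (rule mult_right_mono)
        finally have "lpp x m n - R \<le> \<delta> / 2 * N" .
        moreover have "\<epsilon> * N \<le> \<delta> / 4 * N" using N0 by (intro mult_right_mono) (auto simp: \<epsilon>_def)
        moreover have "\<delta> * N \<ge> 0" using N0 pos by simp
        ultimately show ?thesis using L0 R by linarith
      qed
      have "Q.prob {x\<in>space Q. bulk x m n \<in> {..<s 0 - \<delta> * N}} \<le> Q.prob (E 0 \<union> (E h \<union> (E (- h) \<union> (EI \<union> EJ))))"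
      proof (rule Q.finite_measure_mono_AE)
        have "AE x in Q. \<forall>p\<in>{..m}\<times>{..n}. x p \<ge> 0" by (rule indep_exp_AE_nonneg[OF cQ]) auto
        then show "AE x in Q. x \<in> {x\<in>space Q. bulk x m n \<in> {..<s 0 - \<delta> * N}} \<longrightarrow> x \<in> E 0 \<union> (E h \<union> (E (- h) \<union> (EI \<union> EJ)))"
        proof eventually_elim
          case (elim x)
          then show ?case using good[of x] by force
        qed
      qed simp
      also have "\<dots> \<le> Q.prob (E 0) + (Q.prob (E h) + (Q.prob (E (- h)) + (Q.prob EI + Q.prob EJ)))"
        by (intro order_trans[OF measure_Un_le] add_left_mono sets.Un) auto
      also have "\<dots> \<le> 4 * exp (- c * N) + (4 * exp (- c * N) + (4 * exp (- c * N) + (2 * exp (- c * N) + 2 * exp (- c * N))))"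
        using h pos by (intro add_mono E EI EJ) auto
      finally show ?thesis by simp
    qed
    finally show "prob {\<omega>\<in>space M. bulk (\<lambda>p. X p \<omega>) m n < (\<Sum>i=1..m. 1 / u i) + (\<Sum>j=1..n. 1 / v j) - \<delta> * N} \<le> 16 * exp (- c * N)"
      unfolding s0 .
  qed
qed

text \<open>A discrete intermediate value: the first partial sum above t overshoots by at most one
  term. It selects the row at which sums of 1 / v^2 match a prescribed sum of 1 / u^2.\<close>

lemma partial_sum_crossing:
  fixes q :: "nat \<Rightarrow> real"
  assumes "\<And>j. j \<in> {1..n} \<Longrightarrow> 0 \<le> q j \<and> q j \<le> B" "0 \<le> t" "t \<le> (\<Sum>j=1..n. q j)" "B \<ge> 0"
  defines "l \<equiv> LEAST l. t \<le> (\<Sum>j=1..l. q j)"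
  shows "l \<le> n" "t \<le> (\<Sum>j=1..l. q j)" "(\<Sum>j=1..l. q j) \<le> t + B"
proof -
  show le: "l \<le> n" unfolding l_def using assms(3) by (rule Least_le)
  show "t \<le> (\<Sum>j=1..l. q j)" unfolding l_def using assms(3) by (rule LeastI)
  show "(\<Sum>j=1..l. q j) \<le> t + B"
  proof (cases l)
    case (Suc l')
    have "\<not> t \<le> (\<Sum>j=1..l'. q j)" using not_less_Least[of l' "\<lambda>l. t \<le> (\<Sum>j=1..l. q j)"] Suc unfolding l_def by simp
    moreover have "q l \<le> B" using assms(1) le Suc by auto
    ultimately show ?thesis using Suc by simp
  qed (use assms in auto)
qed

text \<open>If a single column \<open>i0\<close> is slow enough to play the role of the vertical boundary, no balance
  condition is needed: the path crosses the columns left of \<open>i0\<close> in balanced rows, follows column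
  \<open>i0\<close>, and crosses the remaining columns in balanced rows.\<close>

lemma slow_column_bulk_lower_tail:
  fixes \<eta> \<delta> :: real
  assumes pos: "\<eta> > 0" "\<delta> > 0"
  shows "\<exists>C. \<exists>c>0. \<forall>(M :: 's measure) X r u v m n N i0.
    indep_exp M X ({1..m}\<times>{1..n}) r \<longrightarrow>
    (\<forall>i\<in>{1..m}. \<forall>j\<in>{1..n}. r (i, j) \<le> u i + v j) \<longrightarrow>
    i0 \<in> {1..m} \<longrightarrow> (\<forall>j\<in>{1..n}. r (i0, j) \<le> v j) \<longrightarrow>
    (\<forall>i\<in>{1..m}. u i \<ge> \<eta>) \<longrightarrow> (\<forall>j\<in>{1..n}. v j \<ge> \<eta>) \<longrightarrow> real (m + n) \<le> N \<longrightarrow>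
    (\<Sum>i=1..m. 1 / (u i)\<^sup>2) \<le> (\<Sum>j=1..n. 1 / (v j)\<^sup>2) \<longrightarrow>
    measure M {\<omega>\<in>space M. bulk (\<lambda>p. X p \<omega>) m n < (\<Sum>i=1..m. 1 / u i) + (\<Sum>j=1..n. 1 / v j) - \<delta> * N}
      \<le> C * exp (- c * N)"
proof -
  obtain \<kappa> c1 where k: "\<kappa> > 0" "c1 > 0" and L: "\<And>(M :: 's measure) X r u v m n N.
    indep_exp M X ({1..m}\<times>{1..n}) r \<Longrightarrow>
    (\<forall>i\<in>{1..m}. \<forall>j\<in>{1..n}. r (i, j) \<le> u i + v j) \<Longrightarrow>
    (\<forall>i\<in>{1..m}. u i \<ge> \<eta>) \<Longrightarrow> (\<forall>j\<in>{1..n}. v j \<ge> \<eta>) \<Longrightarrow> real (m + n) \<le> N \<Longrightarrow>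
    \<bar>(\<Sum>i=1..m. 1 / (u i)\<^sup>2) - (\<Sum>j=1..n. 1 / (v j)\<^sup>2)\<bar> \<le> \<kappa> * N \<Longrightarrow>
    measure M {\<omega>\<in>space M. bulk (\<lambda>p. X p \<omega>) m n < (\<Sum>i=1..m. 1 / u i) + (\<Sum>j=1..n. 1 / v j) - \<delta> / 4 * N}
      \<le> 16 * exp (- c1 * N)"
    using balanced_bulk_lower_tail[of \<eta> "\<delta> / 4", where 's='s] pos by auto
  define c where "c = min c1 (chernoff \<eta> (\<delta> / 4))"
  have c: "c > 0" "c \<le> c1" "c \<le> chernoff \<eta> (\<delta> / 4)" using k pos chernoff_pos by (auto simp: c_def)
  \<comment> \<open>For N \<ge> N0 a crossing overshoot 1 / \<eta>^2 is within the tolerance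
    \<kappa> N, and the lost term 1 / u i0 is at most \<delta> / 4 * N. For smaller N the constant C
    makes the bound exceed 1. The number 33 is 16 + 1 + 16, for the two blocks and the
    column.\<close>
  define N0 where "N0 = max (1 / \<eta>\<^sup>2 / \<kappa>) (4 / (\<eta> * \<delta>))"
  define C where "C = max 33 (exp (c * N0))"
  show ?thesis
  proof (rule exI[of _ C], rule exI[of _ c], rule conjI[OF c(1)], intro allI impI)
    fix M :: "'s measure" and X r and u v :: "nat \<Rightarrow> real" and m n :: nat and N :: real and i0
    assume X: "indep_exp M X ({1..m}\<times>{1..n}) r"
      and r: "\<forall>i\<in>{1..m}. \<forall>j\<in>{1..n}. r (i, j) \<le> u i + v j"
      and i0: "i0 \<in> {1..m}" and r0: "\<forall>j\<in>{1..n}. r (i0, j) \<le> v j"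
      and u: "\<forall>i\<in>{1..m}. u i \<ge> \<eta>" and v: "\<forall>j\<in>{1..n}. v j \<ge> \<eta>" and N: "real (m + n) \<le> N"
      and le: "(\<Sum>i=1..m. 1 / (u i)\<^sup>2) \<le> (\<Sum>j=1..n. 1 / (v j)\<^sup>2)"
    interpret prob_space M using X by (rule indep_exp_prob_space)
    define s where "s = (\<Sum>i=1..m. 1 / u i) + (\<Sum>j=1..n. 1 / v j)"
    have u0: "u i > 0" if "i \<in> {1..m}" for i using u pos that by (meson less_le_trans)
    have v0: "v j > 0" if "j \<in> {1..n}" for j using v pos that by (meson less_le_trans)
    show "prob {\<omega>\<in>space M. bulk (\<lambda>p. X p \<omega>) m n < (\<Sum>i=1..m. 1 / u i) + (\<Sum>j=1..n. 1 / v j) - \<delta> * N} \<le> C * exp (- c * N)"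
      unfolding s_def[symmetric]
    proof (cases "N \<ge> N0")
      case False
      have "prob {\<omega>\<in>space M. bulk (\<lambda>p. X p \<omega>) m n < s - \<delta> * N} \<le> 1" by simp
      also have "1 = exp (c * N) * exp (- c * N)" by (simp add: exp_add[symmetric])
      also have "\<dots> \<le> C * exp (- c * N)"
        using False c by (intro mult_right_mono) (auto simp: C_def le_max_iff_disj)
      finally show "prob {\<omega>\<in>space M. bulk (\<lambda>p. X p \<omega>) m n < s - \<delta> * N} \<le> C * exp (- c * N)" .
    next
      case True
      have N1: "1 / \<eta>\<^sup>2 \<le> \<kappa> * N" "1 / \<eta> \<le> \<delta> / 4 * N"
      proof -
        have "1 / \<eta>\<^sup>2 / \<kappa> \<le> N" "4 / (\<eta> * \<delta>) \<le> N" using True by (auto simp: N0_def)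
        then show "1 / \<eta>\<^sup>2 \<le> \<kappa> * N" "1 / \<eta> \<le> \<delta> / 4 * N"
          using k pos by (auto simp: field_simps)
      qed
      define q where "q j = 1 / (v j)\<^sup>2" for j
      define p where "p i = 1 / (u i)\<^sup>2" for i
      have qB: "0 \<le> q j \<and> q j \<le> 1 / \<eta>\<^sup>2" if "j \<in> {1..n}" for j
      proof -
        have "v j \<ge> \<eta>" "v j > 0" using v v0 that by auto
        then show ?thesis
          unfolding q_def using pos by (auto intro!: divide_left_mono power_mono)
      qed
      have p0: "p i \<ge> 0" for i by (simp add: p_def)
      have splitm: "(\<Sum>i=1..m. g i) = (\<Sum>i=1..i0-1. g i) + g i0 + (\<Sum>i=1..m-i0. g (i0 + i))" for g :: "nat \<Rightarrow> real"
      proof -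
        have "(\<Sum>i=1..m. g i) = (\<Sum>i=1..i0. g i) + (\<Sum>i=i0+1..m. g i)"
          using sum.ub_add_nat[of 1 i0 g "m - i0"] i0 by simp
        moreover have "(\<Sum>i=1..i0. g i) = (\<Sum>i=1..i0-1. g i) + g i0"
          using i0 by (cases i0) auto
        moreover have "(\<Sum>i=i0+1..m. g i) = (\<Sum>i=1..m-i0. g (i0 + i))"
          using i0 by (intro sum.reindex_bij_witness[of _ "\<lambda>i. i0 + i" "\<lambda>i. i - i0"]) auto
        ultimately show ?thesis by simp
      qed
      \<comment> \<open>The rows up to level t1 balance the columns left of i0, and the rows beyond
        level t2 balance those right of it. The assumed inequality of the two totals gives t1 \<le>
        t2; the surplus rows in between are spent in column i0.\<close>
      define t1 where "t1 = (\<Sum>i=1..i0-1. p i)"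
      define t2 where "t2 = (\<Sum>j=1..n. q j) - (\<Sum>i=1..m-i0. p (i0 + i))"
      define l where "l t = (LEAST l. t \<le> (\<Sum>j=1..l. q j))" for t
      have t: "0 \<le> t1" "t1 \<le> t2" "t2 \<le> (\<Sum>j=1..n. q j)"
      proof -
        have "(\<Sum>i=1..m. p i) \<le> (\<Sum>j=1..n. q j)" using le unfolding p_def q_def .
        moreover have "(\<Sum>i=1..m-i0. p (i0 + i)) \<ge> 0" "t1 \<ge> 0" unfolding t1_def using p0 by (auto intro!: sum_nonneg)
        ultimately show "0 \<le> t1" "t1 \<le> t2" "t2 \<le> (\<Sum>j=1..n. q j)"
          using splitm[of p] p0[of i0] unfolding t1_def t2_def by linarith+
      qed
      note cross = partial_sum_crossing[of n q "1/\<eta>\<^sup>2", OF qB, folded l_def]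
      have l1: "l t1 \<le> n" "t1 \<le> (\<Sum>j=1..l t1. q j)" "(\<Sum>j=1..l t1. q j) \<le> t1 + 1/\<eta>\<^sup>2"
        using cross[of t1] t by auto
      have l2: "l t2 \<le> n" "t2 \<le> (\<Sum>j=1..l t2. q j)" "(\<Sum>j=1..l t2. q j) \<le> t2 + 1/\<eta>\<^sup>2"
        using cross[of t2] t by auto
      have l12: "l t1 \<le> l t2" unfolding l_def
        by (rule Least_le) (use l2 t in \<open>unfold l_def, linarith\<close>)
      define a b where "a = l t1" and "b = l t2"
      have ab: "a \<le> b" "b \<le> n" using l12 l2 by (auto simp: a_def b_def)
      have splitn: "(\<Sum>j=1..n. g j) = (\<Sum>j=1..a. g j) + (\<Sum>j=a+1..b. g j) + (\<Sum>j=1..n-b. g (b + j))" for g :: "nat \<Rightarrow> real"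
      proof -
        have "(\<Sum>j=1..n. g j) = (\<Sum>j=1..b. g j) + (\<Sum>j=b+1..n. g j)"
          using sum.ub_add_nat[of 1 b g "n - b"] ab by simp
        moreover have "(\<Sum>j=1..b. g j) = (\<Sum>j=1..a. g j) + (\<Sum>j=a+1..b. g j)"
          using sum.ub_add_nat[of 1 a g "b - a"] ab by simp
        moreover have "(\<Sum>j=b+1..n. g j) = (\<Sum>j=1..n-b. g (b + j))"
          using ab by (intro sum.reindex_bij_witness[of _ "\<lambda>i. b + i" "\<lambda>i. i - b"]) auto
        ultimately show ?thesis by simp
      qed
      define s1 where "s1 = (\<Sum>i=1..i0-1. 1 / u i) + (\<Sum>j=1..a. 1 / v j)"
      define s2 where "s2 = (\<Sum>j=a+1..b. 1 / v j)"
      define s3 where "s3 = (\<Sum>i=1..m-i0. 1 / u (i0 + i)) + (\<Sum>j=1..n-b. 1 / v (b + j))"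
      have s_split: "s \<le> s1 + s2 + s3 + \<delta> / 4 * N"
      proof -
        have "1 / u i0 \<le> 1 / \<eta>" using u i0 pos by (intro divide_left_mono) (auto simp: u0)
        then show ?thesis
          using N1 splitm[of "\<lambda>i. 1 / u i"] splitn[of "\<lambda>j. 1 / v j"] unfolding s_def s1_def s2_def s3_def by linarith
      qed
      define X3 where "X3 q = X (i0 + fst q, b + snd q)" for q
      define E1 where "E1 = {\<omega>\<in>space M. bulk (\<lambda>q. X q \<omega>) (i0-1) a < s1 - \<delta> / 4 * N}"
      define E3 where "E3 = {\<omega>\<in>space M. bulk (\<lambda>q. X3 q \<omega>) (m-i0) (n-b) < s3 - \<delta> / 4 * N}"
      define K where "K = {i0}\<times>{a+1..b}"
      \<comment> \<open>The rates in column i0 are at most v j, so its weights dominate their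
        rescalings to rate v j, and a lower tail of the rescaled sum suffices. This column, the two
        blocks and the lost term each use a quarter of \<delta>.\<close>
      define E2 where "E2 = {\<omega>\<in>space M. - 1 * (\<Sum>q\<in>K. r q / v (snd q) * X q \<omega> - 1 / v (snd q)) \<ge> \<delta> / 4 * N}"
      have K: "K \<subseteq> {1..m}\<times>{1..n}" using ab i0 by (auto simp: K_def)
      have X1: "indep_exp M X ({1..i0-1}\<times>{1..a}) r"
        by (rule indep_exp_subset[OF X]) (use ab i0 in auto)
      have inj: "inj_on (\<lambda>q. (i0 + fst q, b + snd q)) A" for A :: "(nat \<times> nat) set"
        by (auto simp: inj_on_def prod_eq_iff)
      have X3: "indep_exp M X3 ({1..m-i0}\<times>{1..n-b}) (\<lambda>q. r (i0 + fst q, b + snd q))"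
        unfolding X3_def by (rule indep_exp_reindex[OF X inj]) (use ab i0 in auto)
      have P1: "prob E1 \<le> 16 * exp (- c1 * N)"
        unfolding E1_def s1_def
      proof (rule L[OF X1])
        show "\<bar>(\<Sum>i=1..i0-1. 1 / (u i)\<^sup>2) - (\<Sum>j=1..a. 1 / (v j)\<^sup>2)\<bar> \<le> \<kappa> * N"
          unfolding p_def[symmetric] q_def[symmetric] using l1 N1 unfolding a_def t1_def by linarith
      qed (use r u v N ab i0 in auto)
      have P3: "prob E3 \<le> 16 * exp (- c1 * N)"
        unfolding E3_def s3_def
      proof (rule L[OF X3])
        show "\<bar>(\<Sum>i=1..m-i0. 1 / (u (i0 + i))\<^sup>2) - (\<Sum>j=1..n-b. 1 / (v (b + j))\<^sup>2)\<bar> \<le> \<kappa> * N"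
        proof -
          have "(\<Sum>j=1..n. q j) = (\<Sum>j=1..b. q j) + (\<Sum>j=1..n-b. q (b + j))"
            using splitn[of q] ab sum.ub_add_nat[of 1 a q "b - a"] by simp
          then show ?thesis
            unfolding p_def[symmetric] q_def[symmetric] using l2[folded b_def] N1 t2_def by linarith
        qed
      qed (use r u v N ab i0 in auto)
      have P2: "prob E2 \<le> exp (- chernoff \<eta> (\<delta> / 4) * N)"
        unfolding E2_def
      proof (rule chernoff_one_sided)
        have "indep_exp M (\<lambda>q \<omega>. r q / v (snd q) * X q \<omega>) K (\<lambda>q. r q / (r q / v (snd q)))"
          using K indep_exp_rate_pos[OF X] v0 by (intro indep_exp_scale indep_exp_subset[OF X] divide_pos_pos) auto
        then show "indep_exp M (\<lambda>q \<omega>. r q / v (snd q) * X q \<omega>) K (\<lambda>q. v (snd q))"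
          by (rule indep_exp_cong_rate) (use K indep_exp_rate_pos[OF X] in \<open>fastforce simp: less_imp_neq\<close>)
        show "v (snd q) \<ge> \<eta>" if "q \<in> K" for q using that K v by auto
        have "card K = b - a" by (simp add: K_def)
        then show "real (card K) \<le> N" using N ab by linarith
      qed (use pos in \<open>auto simp: K_def\<close>)
      have AE: "AE \<omega> in M. \<forall>q\<in>{1..m}\<times>{1..n}. X q \<omega> \<ge> 0"
        by (rule indep_exp_AE_nonneg[OF X]) auto
      have [measurable]: "E1 \<in> events" "E3 \<in> events" "E2 \<in> events"
      proof -
        show "E1 \<in> events" unfolding E1_def using indep_exp_bulk_measurable[OF X1] by measurable
        show "E3 \<in> events" unfolding E3_def using indep_exp_bulk_measurable[OF X3] by measurable
        have "(\<lambda>\<omega>. - 1 * (\<Sum>q\<in>K. r q / v (snd q) * X q \<omega> - 1 / v (snd q))) \<in> borel_measurable M"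
          using K indep_exp_measurable[OF X]
          by (intro borel_measurable_times borel_measurable_sum borel_measurable_diff) auto
        then show "E2 \<in> events" unfolding E2_def by measurable
      qed
      have "prob {\<omega>\<in>space M. bulk (\<lambda>p. X p \<omega>) m n < s - \<delta> * N} \<le> prob (E1 \<union> (E2 \<union> E3))"
      proof (rule finite_measure_mono_AE)
        show "AE \<omega> in M. \<omega> \<in> {\<omega>\<in>space M. bulk (\<lambda>p. X p \<omega>) m n < s - \<delta> * N} \<longrightarrow> \<omega> \<in> E1 \<union> (E2 \<union> E3)"
          using AE
        proof eventually_elim
          case (elim \<omega>)
          show ?case
          proof (rule impI, rule ccontr)
            assume asm: "\<omega> \<in> {\<omega>\<in>space M. bulk (\<lambda>p. X p \<omega>) m n < s - \<delta> * N}" "\<omega> \<notin> E1 \<union> (E2 \<union> E3)"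
            define x where "x q = X q \<omega>" for q
            have x0: "x q \<ge> 0" if "q \<in> {1..m}\<times>{1..n}" for q using elim that unfolding x_def by blast
            \<comment> \<open>The offset is i0 - 1 and not i0, so that column 1 of y is the slow
              column. The third block begins one column later, after that column has been
              climbed.\<close>
            define y where "y q = x (i0 - 1 + fst q, a + snd q)" for q
            have i0m: "i0 - 1 + (1 + (m - i0)) = m" "a + ((b - a) + (n - b)) = n" using i0 ab by auto
            have "bulk x (i0-1) a + bulk y (1 + (m - i0)) ((b - a) + (n - b)) \<le> bulk x (i0 - 1 + (1 + (m - i0))) (a + ((b - a) + (n - b)))"
              unfolding y_def by (rule bulk_superadditive) (rule x0, simp only: i0m)
            also have "\<dots> = bulk x m n" unfolding i0m ..
            finally have A: "bulk x (i0-1) a + bulk y (1 + (m - i0)) ((b - a) + (n - b)) \<le> bulk x m n" .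
            have y0: "y q \<ge> 0" if "q \<in> {1..1 + (m - i0)}\<times>{1..(b-a)+(n-b)}" for q
              unfolding y_def by (rule x0) (use that i0 ab in auto)
            have B: "bulk y 1 (b - a) + bulk (\<lambda>q. y (1 + fst q, (b - a) + snd q)) (m - i0) (n - b) \<le>
              bulk y (1 + (m - i0)) ((b - a) + (n - b))"
              by (rule bulk_superadditive) (rule y0)
            have "(\<lambda>q. y (1 + fst q, (b - a) + snd q)) = (\<lambda>q. X3 q \<omega>)"
              using i0 ab by (auto simp: y_def X3_def x_def fun_eq_iff)
            then have B3: "bulk (\<lambda>q. y (1 + fst q, (b - a) + snd q)) (m - i0) (n - b) \<ge> s3 - \<delta> / 4 * N"
              using asm by (auto simp: E3_def)
            have B1: "bulk x (i0-1) a \<ge> s1 - \<delta> / 4 * N"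
              using asm unfolding x_def by (auto simp: E1_def)
            have "bulk y 1 (b - a) = (\<Sum>j=1..b-a. y (1, j))"
              by (rule bulk_one_col) (rule y0, auto)
            also have "\<dots> = (\<Sum>q\<in>K. x q)"
              unfolding y_def K_def using i0 ab
              by (intro sum.reindex_bij_witness[of _ "\<lambda>q. snd q - a" "\<lambda>j. (i0, a + j)"]) auto
            also have "\<dots> \<ge> (\<Sum>q\<in>K. r q / v (snd q) * X q \<omega>)"
            proof (rule sum_mono)
              fix q assume q: "q \<in> K"
              then have "fst q = i0" "snd q \<in> {1..n}" using K by (auto simp: K_def)
              then have "r q \<le> v (snd q)" "v (snd q) > 0" using r0 v0 by (metis prod.collapse)+
              then have "r q / v (snd q) \<le> 1" by simp
              then have "r q / v (snd q) * X q \<omega> \<le> 1 * X q \<omega>"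
                using x0[of q] q K by (intro mult_right_mono) (auto simp: x_def)
              then show "r q / v (snd q) * X q \<omega> \<le> x q" by (simp add: x_def)
            qed
            finally have "bulk y 1 (b - a) \<ge> (\<Sum>q\<in>K. r q / v (snd q) * X q \<omega>)" .
            moreover have "(\<Sum>q\<in>K. 1 / v (snd q)) = s2"
              unfolding s2_def K_def by (rule sum.reindex_bij_witness[of _ "\<lambda>j. (i0, j)" snd]) auto
            ultimately have "bulk y 1 (b - a) \<ge> s2 - \<delta> / 4 * N"
              using asm by (auto simp: E2_def sum_subtractf)
            then have "bulk x m n \<ge> s - \<delta> * N" using A B B1 B3 s_split by linarith
            then show False using asm by (simp add: x_def[abs_def])
          qed
        qed
      qed simp
      also have "\<dots> \<le> prob E1 + (prob E2 + prob E3)"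
        by (intro order_trans[OF measure_Un_le] add_left_mono sets.Un) auto
      also have "\<dots> \<le> 16 * exp (- c1 * N) + (exp (- chernoff \<eta> (\<delta> / 4) * N) + 16 * exp (- c1 * N))"
        by (intro add_mono P1 P2 P3)
      also have "\<dots> \<le> 16 * exp (- c * N) + (exp (- c * N) + 16 * exp (- c * N))"
        using c N by (intro add_mono mult_left_mono) (auto intro!: mult_right_mono)
      also have "\<dots> = 33 * exp (- c * N)" by simp
      also have "\<dots> \<le> C * exp (- c * N)" by (intro mult_right_mono) (auto simp: C_def)
      finally show "prob {\<omega>\<in>space M. bulk (\<lambda>p. X p \<omega>) m n < s - \<delta> * N} \<le> C * exp (- c * N)" .
    qed
  qed
qed

subsection \<open>Limits of empirical transforms\<close>

text \<open>\<open>A(z)\<close> is \<open>inv_moment \<alpha> 1 z\<close>, and \<open>B(z)\<close> is \<open>inv_moment \<beta> 1 (- z)\<close>.\<close>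

definition inv_moment :: "real measure \<Rightarrow> nat \<Rightarrow> real \<Rightarrow> real" where
  "inv_moment \<mu> k z = (\<integral>x. 1 / (x + z) ^ k \<partial>\<mu>)"

lemma tendsto_0_at_infinity_real:
  fixes f :: "real \<Rightarrow> real"
  assumes "\<And>x. \<bar>f x\<bar> * \<bar>x - c\<bar> \<le> K"
  shows "(f \<longlongrightarrow> 0) at_infinity"
  unfolding Lim_at_infinity
proof (intro allI impI)
  fix e :: real assume "e > 0"
  have K: "K \<ge> 0" using assms[of c] by simp
  show "\<exists>b. \<forall>x. b \<le> norm x \<longrightarrow> dist (f x) 0 < e"
  proof (intro exI[of _ "K / e + \<bar>c\<bar> + 1"] allI impI)
    fix x :: real assume "K / e + \<bar>c\<bar> + 1 \<le> norm x"
    then have "K / e < \<bar>x - c\<bar>" by auto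
    then have "K < e * \<bar>x - c\<bar>" using \<open>e > 0\<close> by (simp add: field_simps)
    moreover have "\<bar>x - c\<bar> > 0" using \<open>K / e < \<bar>x - c\<bar>\<close> K \<open>e > 0\<close> by (smt (verit) divide_nonneg_pos)
    ultimately have "\<bar>f x\<bar> * \<bar>x - c\<bar> < e * \<bar>x - c\<bar>" using assms[of x] by linarith
    then show "dist (f x) 0 < e" using \<open>\<bar>x - c\<bar> > 0\<close> by simp
  qed
qed

lemma empirical_integral:
  fixes f :: "real \<Rightarrow> real"
  assumes "f \<in> borel_measurable borel" "m \<ge> 1"
  shows "(\<integral>x. f x \<partial>empirical_distribution a m) = (\<Sum>i=1..m. f (a m i)) / real m"
  unfolding empirical_distribution_def using assms
  by (subst integral_distr) (auto simp: integral_uniform_count_measure measurable_def space_uniform_count_measure sets_uniform_count_measure)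

locale vague_array =
  fixes a :: "nat \<Rightarrow> nat \<Rightarrow> real" and \<mu> :: "real measure" and \<aa> :: ereal
  assumes subprob: "subprob_space \<mu>" and sets_\<mu>: "sets \<mu> = sets borel"
    and nonzero: "emeasure \<mu> (space \<mu>) \<noteq> 0"
    and conv: "vague_conv (empirical_distribution a) \<mu>"
    and not_minf: "\<aa> \<noteq> -\<infinity>"
    and min_conv: "(\<lambda>m. ereal (min_param a m)) \<longlonglongrightarrow> \<aa>"
begin

sublocale subprob_space \<mu> by (rule subprob)

lemma meas_\<mu>: "f \<in> borel_measurable borel \<Longrightarrow> f \<in> borel_measurable \<mu>"
  using sets_\<mu> by (simp cong: measurable_cong_sets)

lemma eventually_ge:
  assumes "ereal c < \<aa>"
  shows "eventually (\<lambda>m. \<forall>i\<in>{1..m}. a m i \<ge> c) sequentially"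
  using order_tendstoD(1)[OF min_conv assms]
proof eventually_elim
  case (elim m)
  have "min_param a m \<le> a m i" if "i \<in> {1..m}" for i
    unfolding min_param_def using that by (intro Min_le) auto
  then show ?case using elim by (auto intro: order_trans[OF less_imp_le])
qed

text \<open>The functions of interest have a pole and are no test functions. For large m all
  parameters lie above c, so g may be replaced by a continuous f that vanishes at infinity and
  agrees with g there.\<close>

lemma integral_limit:
  assumes "continuous_on UNIV f" "\<And>x. \<bar>f x\<bar> * \<bar>x - c\<bar> \<le> K"
    and "ereal c < \<aa>" "\<And>x. x \<ge> c \<Longrightarrow> f x = g x"
  shows "(\<lambda>m. (\<Sum>i=1..m. g (a m i)) / real m) \<longlonglongrightarrow> (\<integral>x. f x \<partial>\<mu>)"
proof -
  have "(\<lambda>m. \<integral>x. f x \<partial>empirical_distribution a m) \<longlonglongrightarrow> (\<integral>x. f x \<partial>\<mu>)"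
    using conv tendsto_0_at_infinity_real[of f c K] assms unfolding vague_conv_def by blast
  moreover have "eventually (\<lambda>m. (\<integral>x. f x \<partial>empirical_distribution a m) = (\<Sum>i=1..m. g (a m i)) / real m) sequentially"
    using eventually_ge[OF assms(3)] eventually_ge_at_top[of 1]
  proof eventually_elim
    case (elim m)
    have "(\<integral>x. f x \<partial>empirical_distribution a m) = (\<Sum>i=1..m. f (a m i)) / real m"
      using elim assms(1) by (intro empirical_integral borel_measurable_continuous_onI) auto
    also have "(\<Sum>i=1..m. f (a m i)) = (\<Sum>i=1..m. g (a m i))"
      using elim assms(4) by (intro sum.cong) auto
    finally show ?case .
  qed
  ultimately show ?thesis by (rule Lim_transform_eventually)
qed

text \<open>The test function below is positive exactly on the half-line under c. Its empirical
  integrals are eventually zero, so its integral against \<mu> is zero as well.\<close>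

lemma AE_ge_less:
  assumes "ereal c < \<aa>"
  shows "AE x in \<mu>. x \<ge> c"
proof -
  define f where "f x = max 0 (c - x) / (1 + (x - c)\<^sup>2)" for x
  have cont: "continuous_on UNIV f"
    unfolding f_def by (intro continuous_intros) (smt (verit) zero_le_power2)
  have bound: "\<bar>f x\<bar> * \<bar>x - c\<bar> \<le> 1" for x
  proof -
    have pos: "1 + (x - c)\<^sup>2 > 0" by (smt (verit) zero_le_power2)
    have "\<bar>f x\<bar> * \<bar>x - c\<bar> = (max 0 (c - x) * \<bar>x - c\<bar>) / (1 + (x - c)\<^sup>2)"
      using pos by (simp add: f_def abs_divide)
    also have "\<dots> \<le> (x - c)\<^sup>2 / (1 + (x - c)\<^sup>2)"
    proof (rule divide_right_mono)
      have "max 0 (c - x) * \<bar>x - c\<bar> \<le> \<bar>x - c\<bar> * \<bar>x - c\<bar>" by (intro mult_right_mono) auto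
      then show "max 0 (c - x) * \<bar>x - c\<bar> \<le> (x - c)\<^sup>2" by (simp add: power2_eq_square)
    qed (use pos in simp)
    also have "\<dots> \<le> 1" using pos by simp
    finally show ?thesis .
  qed
  have "(\<lambda>m. (\<Sum>i=1..m. 0) / real m) \<longlonglongrightarrow> (\<integral>x. f x \<partial>\<mu>)"
    by (rule integral_limit[OF cont bound assms]) (simp add: f_def)
  then have 0: "(\<integral>x. f x \<partial>\<mu>) = 0" by (simp add: LIMSEQ_const_iff)
  have f0: "0 \<le> f x" "f x \<le> 1" for x
  proof -
    have pos: "1 + (x - c)\<^sup>2 > 0" by (smt (verit) zero_le_power2)
    then show "0 \<le> f x" by (simp add: f_def)
    have "max 0 (c - x) \<le> 1 + (x - c)\<^sup>2"
      using zero_le_power2[of "x - c"] zero_le_power2[of "x - c + 1"] zero_le_power2[of "x-c + 1/2"] by (auto simp: max_def power2_eq_square algebra_simps)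
    then show "f x \<le> 1" using pos by (simp add: f_def)
  qed
  have "integrable \<mu> f"
    using f0 cont by (intro integrable_const_bound[where B=1] meas_\<mu> borel_measurable_continuous_onI) auto
  then have "AE x in \<mu>. f x = 0"
    using 0 f0 by (subst (asm) integral_nonneg_eq_0_iff_AE) auto
  then show ?thesis
  proof eventually_elim
    case (elim x)
    have "1 + (x - c)\<^sup>2 > 0" by (smt (verit) zero_le_power2)
    then show ?case using elim by (auto simp: f_def max_def split: if_splits)
  qed
qed

lemma not_AE_False: "\<not> (AE x in \<mu>. False)"
  using nonzero AE_iff_measurable[of "space \<mu>" \<mu> "\<lambda>_. False"] by auto

text \<open>If the minima tended to infinity, \<mu> would charge no half-line bounded above and
  would vanish. Hence the endpoint is the real number \<open>lo\<close>.\<close>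

lemma not_inf: "\<aa> \<noteq> \<infinity>"
proof
  assume "\<aa> = \<infinity>"
  then have "AE x in \<mu>. \<forall>n::nat. x \<ge> real n"
    unfolding AE_all_countable using AE_ge_less by simp
  then have "AE x in \<mu>. False"
    by eventually_elim (metis reals_Archimedean2 not_le)
  then show False using not_AE_False by simp
qed

definition lo :: real where "lo = real_of_ereal \<aa>"

lemma \<aa>_eq: "\<aa> = ereal lo"
  unfolding lo_def using not_inf not_minf by (cases \<aa>) auto

lemma less_lo_iff: "ereal c < \<aa> \<longleftrightarrow> c < lo"
  by (subst \<aa>_eq) simp

lemma AE_ge: "AE x in \<mu>. x \<ge> lo"
proof -
  have "AE x in \<mu>. \<forall>n::nat. x \<ge> lo - 1 / Suc n"
    unfolding AE_all_countable by (intro allI AE_ge_less) (simp add: less_lo_iff)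
  then show ?thesis
  proof eventually_elim
    case (elim x)
    show ?case
    proof (rule ccontr)
      assume "\<not> lo \<le> x"
      then have "0 < lo - x" by simp
      from reals_Archimedean[OF this] obtain n :: nat where "1 / Suc n < lo - x"
        unfolding inverse_eq_divide ..
      then show False using elim[rule_format, of n] by simp
    qed
  qed
qed

lemma inv_moment_limit:
  assumes z: "z > - lo" and k: "k = 1 \<or> k = 2"
  shows "(\<lambda>m. (\<Sum>i=1..m. 1 / (a m i + z) ^ k) / real m) \<longlonglongrightarrow> inv_moment \<mu> k z"
proof -
  \<comment> \<open>The midpoint between the pole - z and \<open>lo\<close>. Replacing x - c by its
    absolute value removes the pole without changing the function on x \<ge> c, since d = c + z >
    0.\<close>
  define c where "c = (lo - z) / 2"
  define d where "d = c + z"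
  have cd: "c < lo" "d > 0" using z by (auto simp: c_def d_def field_simps)
  define f where "f x = 1 / (d + \<bar>x - c\<bar>) ^ k" for x
  have cont: "continuous_on UNIV f"
    unfolding f_def using cd by (intro continuous_intros) (auto simp: add_pos_nonneg dest: add_pos_nonneg)
  have bound: "\<bar>f x\<bar> * \<bar>x - c\<bar> \<le> max 1 (1 / d)" for x
  proof -
    have p: "d + \<bar>x - c\<bar> > 0" using cd by linarith
    have q: "\<bar>x - c\<bar> / (d + \<bar>x - c\<bar>) \<le> 1" using p cd by simp
    show ?thesis
    proof (cases "k = 1")
      case True
      then show ?thesis using q p by (simp add: f_def le_max_iff_disj)
    next
      case False
      then have "\<bar>f x\<bar> * \<bar>x - c\<bar> = \<bar>x - c\<bar> / (d + \<bar>x - c\<bar>) * (1 / (d + \<bar>x - c\<bar>))"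
        using k p by (simp add: f_def power2_eq_square)
      also have "\<dots> \<le> 1 * (1 / d)"
        using q p cd by (intro mult_mono divide_left_mono) auto
      finally show ?thesis by simp
    qed
  qed
  have fg: "f x = 1 / (x + z) ^ k" if "x \<ge> c" for x
    using that by (simp add: f_def d_def algebra_simps)
  have "(\<lambda>m. (\<Sum>i=1..m. 1 / (a m i + z) ^ k) / real m) \<longlonglongrightarrow> (\<integral>x. f x \<partial>\<mu>)"
    by (rule integral_limit[OF cont bound]) (use cd fg in \<open>auto simp: less_lo_iff\<close>)
  also have "(\<integral>x. f x \<partial>\<mu>) = inv_moment \<mu> k z"
    unfolding inv_moment_def
  proof (rule integral_cong_AE)
    show "f \<in> borel_measurable \<mu>" using cont by (intro meas_\<mu> borel_measurable_continuous_onI)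
    show "AE x in \<mu>. f x = 1 / (x + z) ^ k"
      using AE_ge by eventually_elim (use cd fg in auto)
  qed (auto intro!: meas_\<mu>)
  finally show ?thesis .
qed

lemma inv_moment_integrable:
  assumes z: "z > - lo"
  shows "integrable \<mu> (\<lambda>x. 1 / (x + z) ^ k)"
proof (rule integrable_const_bound[where B="1 / (lo + z) ^ k"])
  show "AE x in \<mu>. norm (1 / (x + z) ^ k) \<le> 1 / (lo + z) ^ k"
    using AE_ge
  proof eventually_elim
    case (elim x)
    then have "(lo + z) ^ k \<le> (x + z) ^ k" using z by (intro power_mono) auto
    then show ?case using z elim by (auto intro!: divide_left_mono mult_pos_pos zero_less_power)
  qed
qed (auto intro!: meas_\<mu>)

lemma integral_pos:
  assumes "integrable \<mu> f" "AE x in \<mu>. f x > (0::real)"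
  shows "(\<integral>x. f x \<partial>\<mu>) > 0"
proof -
  have nn: "AE x in \<mu>. 0 \<le> f x" using assms(2) by eventually_elim simp
  have "(\<integral>x. f x \<partial>\<mu>) \<noteq> 0"
  proof
    assume "(\<integral>x. f x \<partial>\<mu>) = 0"
    then have "AE x in \<mu>. f x = 0" using integral_nonneg_eq_0_iff_AE[OF assms(1) nn] by simp
    with assms(2) have "AE x in \<mu>. False" by eventually_elim simp
    then show False using not_AE_False by simp
  qed
  moreover have "(\<integral>x. f x \<partial>\<mu>) \<ge> 0" using nn by (rule integral_nonneg_AE)
  ultimately show ?thesis by simp
qed

lemma inv_moment_pos: "z > - lo \<Longrightarrow> inv_moment \<mu> k z > 0"
  unfolding inv_moment_def
proof (rule integral_pos[OF inv_moment_integrable])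
  assume z: "z > - lo"
  show "AE x in \<mu>. 0 < 1 / (x + z) ^ k"
    using AE_ge by eventually_elim (use z in auto)
qed

lemma inv_moment_antimono:
  assumes "- lo < z" "z \<le> z'"
  shows "inv_moment \<mu> k z' \<le> inv_moment \<mu> k z"
  unfolding inv_moment_def
proof (rule integral_mono_AE)
  show "AE x in \<mu>. 1 / (x + z') ^ k \<le> 1 / (x + z) ^ k"
    using AE_ge
  proof eventually_elim
    case (elim x)
    then show ?case using assms by (auto intro!: divide_left_mono power_mono mult_pos_pos zero_less_power)
  qed
qed (use assms in \<open>auto intro!: inv_moment_integrable\<close>)

lemma inv_moment_strict_antimono:
  assumes "- lo < z" "z < z'"
  shows "inv_moment \<mu> 2 z' < inv_moment \<mu> 2 z"
proof -
  have i: "integrable \<mu> (\<lambda>x. 1 / (x + z)\<^sup>2)" "integrable \<mu> (\<lambda>x. 1 / (x + z')\<^sup>2)"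
    using assms by (auto intro!: inv_moment_integrable)
  have "0 < (\<integral>x. 1 / (x + z)\<^sup>2 - 1 / (x + z')\<^sup>2 \<partial>\<mu>)"
  proof (rule integral_pos)
    show "AE x in \<mu>. 0 < 1 / (x + z)\<^sup>2 - 1 / (x + z')\<^sup>2"
      using AE_ge
    proof eventually_elim
      case (elim x)
      have "1 / (x + z')\<^sup>2 < 1 / (x + z)\<^sup>2"
        using elim assms by (intro divide_strict_left_mono power_strict_mono mult_pos_pos zero_less_power) auto
      then show ?case by simp
    qed
  qed (use i in auto)
  also have "\<dots> = inv_moment \<mu> 2 z - inv_moment \<mu> 2 z'" unfolding inv_moment_def using i by simp
  finally show ?thesis by simp
qed

text \<open>At distance \<eta> from the endpoint the derivatives of 1 / s and 1 / s^2 are bounded by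
  1 / \<eta>^2 and 2 / \<eta>^3; the maximum treats both exponents together. Total mass at most one
  carries the bound through the integral.\<close>

lemma inv_moment_lipschitz:
  assumes "\<eta> > 0" "- lo + \<eta> \<le> z" "z \<le> z'" and k: "k = 1 \<or> k = 2"
  shows "inv_moment \<mu> k z - inv_moment \<mu> k z' \<le> max (1 / \<eta>\<^sup>2) (2 / \<eta> ^ 3) * (z' - z)"
proof -
  have i: "integrable \<mu> (\<lambda>x. 1 / (x + z) ^ k)" "integrable \<mu> (\<lambda>x. 1 / (x + z') ^ k)"
    using assms by (auto intro!: inv_moment_integrable)
  let ?K = "max (1 / \<eta>\<^sup>2) (2 / \<eta> ^ 3)"
  have "inv_moment \<mu> k z - inv_moment \<mu> k z' = (\<integral>x. 1 / (x + z) ^ k - 1 / (x + z') ^ k \<partial>\<mu>)"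
    unfolding inv_moment_def using i by simp
  also have "\<dots> \<le> (\<integral>x. ?K * (z' - z) \<partial>\<mu>)"
  proof (rule integral_mono_AE)
    show "AE x in \<mu>. 1 / (x + z) ^ k - 1 / (x + z') ^ k \<le> ?K * (z' - z)"
      using AE_ge
    proof eventually_elim
      case (elim x)
      define s t where "s = x + z" and "t = x + z'"
      have st: "s \<ge> \<eta>" "t \<ge> s" "s > 0" "t > 0" using elim assms by (auto simp: s_def t_def)
      have one: "1 / s - 1 / t \<le> (t - s) / \<eta>\<^sup>2"
      proof -
        have "1 / s - 1 / t = (t - s) / (s * t)" using st by (simp add: field_simps)
        also have "\<dots> \<le> (t - s) / \<eta>\<^sup>2"
          using st assms unfolding power2_eq_square by (intro divide_left_mono mult_mono) auto
        finally show ?thesis .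
      qed
      show ?case
      proof (cases "k = 1")
        case True
        then have "1 / (x + z) ^ k - 1 / (x + z') ^ k \<le> 1 / \<eta>\<^sup>2 * (z' - z)"
          using one by (simp add: s_def t_def)
        also have "\<dots> \<le> ?K * (z' - z)" using assms by (intro mult_right_mono) auto
        finally show ?thesis .
      next
        case False
        then have "1 / (x + z) ^ k - 1 / (x + z') ^ k = (1 / s - 1 / t) * (1 / s + 1 / t)"
          using k by (simp add: s_def[symmetric] t_def[symmetric] power2_eq_square algebra_simps)
        also have "\<dots> \<le> ((t - s) / \<eta>\<^sup>2) * (1 / \<eta> + 1 / \<eta>)"
        proof (rule mult_mono[OF one])
          show "1 / s + 1 / t \<le> 1 / \<eta> + 1 / \<eta>"
            using st assms by (intro add_mono divide_left_mono) auto
        qed (use st assms in auto)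
        also have "\<dots> = 2 / \<eta> ^ 3 * (z' - z)" using assms by (simp add: s_def t_def power2_eq_square power3_eq_cube field_simps)
        also have "\<dots> \<le> ?K * (z' - z)" using assms by (intro mult_right_mono) auto
        finally show ?thesis .
      qed
    qed
  qed (use i in auto)
  also have "\<dots> = ?K * (z' - z) * measure \<mu> (space \<mu>)" by simp
  also have "\<dots> \<le> ?K * (z' - z) * 1"
    using assms subprob_measure_le_1 by (intro mult_left_mono mult_nonneg_nonneg) (auto simp: le_max_iff_disj)
  finally show ?thesis by simp
qed

lemma inv_moment_isCont:
  assumes "z > - lo" and k: "k = 1 \<or> k = 2"
  shows "isCont (inv_moment \<mu> k) z"
proof -
  define \<eta> where "\<eta> = (lo + z) / 2"
  have \<eta>: "\<eta> > 0" using assms by (simp add: \<eta>_def)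
  define K where "K = max (1 / \<eta>\<^sup>2) (2 / \<eta> ^ 3)"
  have b: "\<bar>inv_moment \<mu> k w - inv_moment \<mu> k z\<bar> \<le> K * \<bar>w - z\<bar>" if "\<bar>w - z\<bar> < \<eta>" for w
  proof (cases "w \<le> z")
    case True
    have "- lo + \<eta> \<le> w" using that assms by (auto simp: \<eta>_def abs_if field_simps split: if_splits)
    then show ?thesis using inv_moment_lipschitz[OF \<eta> _ True k] inv_moment_antimono[of w z k] True \<eta> by (auto simp: K_def)
  next
    case False
    have "- lo + \<eta> \<le> z" using assms by (simp add: \<eta>_def field_simps)
    then show ?thesis using inv_moment_lipschitz[OF \<eta>, of z w k] k inv_moment_antimono[of z w k] False assms by (auto simp: K_def)
  qed
  have "((\<lambda>w. K * \<bar>w - z\<bar>) \<longlongrightarrow> K * \<bar>z - z\<bar>) (at z)" by (intro tendsto_intros)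
  then have lim: "((\<lambda>w. K * \<bar>w - z\<bar>) \<longlongrightarrow> 0) (at z)" by simp
  have "\<forall>\<^sub>F w in at z. norm (inv_moment \<mu> k w - inv_moment \<mu> k z) \<le> K * \<bar>w - z\<bar>"
    unfolding eventually_at using \<eta> b by (auto simp: dist_real_def intro!: exI[of _ \<eta>])
  then have "((\<lambda>w. inv_moment \<mu> k w - inv_moment \<mu> k z) \<longlongrightarrow> 0) (at z)"
    using lim by (rule Lim_null_comparison)
  then show ?thesis unfolding isCont_def by (rule LIM_zero_cancel)
qed

end

subsection \<open>Shape estimates in a fixed direction\<close>

lemma (in prob_space) prob_Collect_mono:
  assumes "\<And>\<omega>. \<omega> \<in> space M \<Longrightarrow> P \<omega> \<Longrightarrow> Q \<omega>" "{\<omega>\<in>space M. Q \<omega>} \<in> events"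
  shows "prob {\<omega>\<in>space M. P \<omega>} \<le> prob {\<omega>\<in>space M. Q \<omega>}"
  using assms by (intro finite_measure_mono) auto

locale lpp_arrays =
  A: vague_array a \<alpha> \<aa> + B: vague_array b \<beta> \<bb>
  for a b :: "nat \<Rightarrow> nat \<Rightarrow> real" and \<alpha> \<beta> :: "real measure" and \<aa> \<bb> :: ereal +
  fixes M :: "'s measure" and X :: "nat \<Rightarrow> nat \<Rightarrow> nat \<times> nat \<Rightarrow> 's \<Rightarrow> real"
  assumes gap: "\<aa> + \<bb> > 0"
    and indep: "\<And>m n. m \<ge> 1 \<Longrightarrow> n \<ge> 1 \<Longrightarrow>
      indep_exp M (X m n) ({1..m}\<times>{1..n}) (\<lambda>p. a m (fst p) + b n (snd p))"
begin

abbreviation "T m n \<omega> \<equiv> bulk (\<lambda>p. X m n p \<omega>) m n"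

lemma prob_M: "prob_space M"
  using indep_exp_prob_space[OF indep[of 1 1]] by simp

sublocale prob_space M by (rule prob_M)

lemma T_measurable [measurable]: "m \<ge> 1 \<Longrightarrow> n \<ge> 1 \<Longrightarrow> (\<lambda>\<omega>. T m n \<omega>) \<in> borel_measurable M"
  using indep_exp_bulk_measurable[OF indep] .

lemma lo_gap: "A.lo + B.lo > 0"
proof -
  have "\<aa> + \<bb> = ereal (A.lo + B.lo)" by (subst A.\<aa>_eq, subst B.\<aa>_eq) simp
  then show ?thesis using gap by (simp add: zero_ereal_def)
qed

text \<open>For fixed z strictly inside the interval all shifted parameters eventually exceed one
  \<eta>, so the exponential rate is uniform in (m, n). Half of \<delta> pays for the convergence of
  the empirical averages, half for the fluctuations.\<close>

lemma bulk_upper: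
  assumes z: "- A.lo < z" "z < B.lo" and \<delta>: "\<delta> > 0"
  shows "\<exists>c>0. \<exists>C L. \<forall>m\<ge>L. \<forall>n\<ge>L.
    prob {\<omega>\<in>space M. T m n \<omega> \<ge> real m * inv_moment \<alpha> 1 z + real n * inv_moment \<beta> 1 (- z) + \<delta> * real (m + n)} \<le> C * exp (- c * real (m + n))"
proof -
  define \<eta> where "\<eta> = min (A.lo + z) (B.lo - z) / 2"
  have \<eta>: "\<eta> > 0" "\<eta> - z < A.lo" "\<eta> + z < B.lo" using z by (auto simp: \<eta>_def min_def field_simps)
  have "eventually (\<lambda>m. \<forall>i\<in>{1..m}. a m i \<ge> \<eta> - z) sequentially"
    using \<eta> by (intro A.eventually_ge) (simp add: A.less_lo_iff)
  moreover have "eventually (\<lambda>n. \<forall>j\<in>{1..n}. b n j \<ge> \<eta> + z) sequentially"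
    using \<eta> by (intro B.eventually_ge) (simp add: B.less_lo_iff)
  moreover have "eventually (\<lambda>m. (\<Sum>i=1..m. 1 / (a m i + z) ^ 1) / real m < inv_moment \<alpha> 1 z + \<delta> / 2) sequentially"
    using z \<delta> by (intro order_tendstoD(2)[OF A.inv_moment_limit]) auto
  moreover have "eventually (\<lambda>n. (\<Sum>j=1..n. 1 / (b n j + (- z)) ^ 1) / real n < inv_moment \<beta> 1 (- z) + \<delta> / 2) sequentially"
    using z \<delta> by (intro order_tendstoD(2)[OF B.inv_moment_limit]) auto
  ultimately have "eventually (\<lambda>m. m \<ge> 1 \<and> (\<forall>i\<in>{1..m}. a m i \<ge> \<eta> - z) \<and> (\<forall>j\<in>{1..m}. b m j \<ge> \<eta> + z) \<and>
    (\<Sum>i=1..m. 1 / (a m i + z) ^ 1) / real m < inv_moment \<alpha> 1 z + \<delta> / 2 \<and>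
    (\<Sum>j=1..m. 1 / (b m j + (- z)) ^ 1) / real m < inv_moment \<beta> 1 (- z) + \<delta> / 2) sequentially"
    using eventually_ge_at_top[of "1::nat"] by eventually_elim blast
  then obtain L where L: "\<And>m. m \<ge> L \<Longrightarrow> m \<ge> 1 \<and> (\<forall>i\<in>{1..m}. a m i \<ge> \<eta> - z) \<and> (\<forall>j\<in>{1..m}. b m j \<ge> \<eta> + z) \<and>
    (\<Sum>i=1..m. 1 / (a m i + z) ^ 1) / real m < inv_moment \<alpha> 1 z + \<delta> / 2 \<and>
    (\<Sum>j=1..m. 1 / (b m j + (- z)) ^ 1) / real m < inv_moment \<beta> 1 (- z) + \<delta> / 2"
    unfolding eventually_sequentially by blast
  show ?thesis
  proof (rule exI[of _ "chernoff \<eta> (\<delta> / 2 / 2)"], rule conjI, rule chernoff_pos, rule \<eta>(1), use \<delta> in simp,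
      rule exI[of _ 4], rule exI[of _ L], intro allI impI)
    fix m n assume mn: "m \<ge> L" "n \<ge> L"
    then have m1: "m \<ge> 1" "n \<ge> 1" using L by auto
    have sa: "(\<Sum>i=1..m. 1 / (a m i + z)) \<le> real m * (inv_moment \<alpha> 1 z + \<delta> / 2)"
      using L[OF mn(1)] m1 by (simp add: field_simps)
    have sb: "(\<Sum>j=1..n. 1 / (b n j - z)) \<le> real n * (inv_moment \<beta> 1 (- z) + \<delta> / 2)"
      using L[OF mn(2)] m1 by (simp add: field_simps)
    have "prob {\<omega>\<in>space M. T m n \<omega> \<ge> real m * inv_moment \<alpha> 1 z + real n * inv_moment \<beta> 1 (- z) + \<delta> * real (m + n)}
      \<le> prob {\<omega>\<in>space M. T m n \<omega> \<ge> (\<Sum>i=1..m. 1 / (a m i + z)) + (\<Sum>j=1..n. 1 / (b n j - z)) + \<delta> / 2 * real (m + n)}"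
    proof (rule prob_Collect_mono)
      have "\<delta> * real (m + n) = \<delta> / 2 * real (m + n) + (real m * (\<delta> / 2) + real n * (\<delta> / 2))"
        by (simp add: field_simps)
      note dN = this sa[unfolded distrib_left] sb[unfolded distrib_left]
      fix \<omega> assume "T m n \<omega> \<ge> real m * inv_moment \<alpha> 1 z + real n * inv_moment \<beta> 1 (- z) + \<delta> * real (m + n)"
      then show "T m n \<omega> \<ge> (\<Sum>i=1..m. 1 / (a m i + z)) + (\<Sum>j=1..n. 1 / (b n j - z)) + \<delta> / 2 * real (m + n)"
        using dN by linarith
    qed (use m1 in measurable)
    also have "\<dots> \<le> 4 * exp (- chernoff \<eta> (\<delta> / 2 / 2) * real (m + n))"
      using L[OF mn(1)] L[OF mn(2)] \<eta> \<delta>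
      by (intro bulk_upper_tail[OF indep[OF m1]]) (auto simp: algebra_simps)
    finally show "prob {\<omega>\<in>space M. T m n \<omega> \<ge> real m * inv_moment \<alpha> 1 z + real n * inv_moment \<beta> 1 (- z) + \<delta> * real (m + n)}
      \<le> 4 * exp (- chernoff \<eta> (\<delta> / 2 / 2) * real (m + n))" .
  qed
qed

text \<open>Balance of the limiting second moments is handed down to the finite sums: half of the
  tolerance \<kappa> is left to the direction, half to the convergence of the empirical second
  moments.\<close>

lemma bulk_lower_balanced:
  assumes z: "- A.lo < z" "z < B.lo" and \<delta>: "\<delta> > 0"
  shows "\<exists>\<rho>>0. \<exists>c>0. \<exists>C L. \<forall>m\<ge>L. \<forall>n\<ge>L. \<bar>real m * inv_moment \<alpha> 2 z - real n * inv_moment \<beta> 2 (- z)\<bar> \<le> \<rho> * real (m + n) \<longrightarrow>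
    prob {\<omega>\<in>space M. T m n \<omega> < real m * inv_moment \<alpha> 1 z + real n * inv_moment \<beta> 1 (- z) - \<delta> * real (m + n)} \<le> C * exp (- c * real (m + n))"
proof -
  define \<eta> where "\<eta> = min (A.lo + z) (B.lo - z) / 2"
  have \<eta>: "\<eta> > 0" "\<eta> - z < A.lo" "\<eta> + z < B.lo" using z by (auto simp: \<eta>_def min_def field_simps)
  obtain \<kappa> c where kc: "\<kappa> > 0" "c > 0" and L0: "\<And>(M :: 's measure) X r u v m n N.
    indep_exp M X ({1..m}\<times>{1..n}) r \<Longrightarrow>
    (\<forall>i\<in>{1..m}. \<forall>j\<in>{1..n}. r (i, j) \<le> u i + v j) \<Longrightarrow>
    (\<forall>i\<in>{1..m}. u i \<ge> \<eta>) \<Longrightarrow> (\<forall>j\<in>{1..n}. v j \<ge> \<eta>) \<Longrightarrow> real (m + n) \<le> N \<Longrightarrow>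
    \<bar>(\<Sum>i=1..m. 1 / (u i)\<^sup>2) - (\<Sum>j=1..n. 1 / (v j)\<^sup>2)\<bar> \<le> \<kappa> * N \<Longrightarrow>
    measure M {\<omega>\<in>space M. bulk (\<lambda>p. X p \<omega>) m n < (\<Sum>i=1..m. 1 / u i) + (\<Sum>j=1..n. 1 / v j) - \<delta> / 2 * N}
      \<le> 16 * exp (- c * N)"
    using balanced_bulk_lower_tail[of \<eta> "\<delta> / 2", where 's='s] \<eta> \<delta> by auto
  define PA where "PA k m = (\<Sum>i=1..m. 1 / (a m i + z) ^ k) / real m" for k m
  define PB where "PB k n = (\<Sum>j=1..n. 1 / (b n j + (- z)) ^ k) / real n" for k n
  have limA: "PA k \<longlonglongrightarrow> inv_moment \<alpha> k z" if "k = 1 \<or> k = 2" for k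
    unfolding PA_def using z that by (intro A.inv_moment_limit) auto
  have limB: "PB k \<longlonglongrightarrow> inv_moment \<beta> k (- z)" if "k = 1 \<or> k = 2" for k
    unfolding PB_def using z that by (intro B.inv_moment_limit) auto
  have "eventually (\<lambda>m. \<forall>i\<in>{1..m}. a m i \<ge> \<eta> - z) sequentially"
    using \<eta> by (intro A.eventually_ge) (simp add: A.less_lo_iff)
  moreover have "eventually (\<lambda>n. \<forall>j\<in>{1..n}. b n j \<ge> \<eta> + z) sequentially"
    using \<eta> by (intro B.eventually_ge) (simp add: B.less_lo_iff)
  moreover have "eventually (\<lambda>m. PA 1 m > inv_moment \<alpha> 1 z - \<delta> / 2) sequentially"
    using \<delta> by (intro order_tendstoD(1)[OF limA]) auto
  moreover have "eventually (\<lambda>n. PB 1 n > inv_moment \<beta> 1 (- z) - \<delta> / 2) sequentially"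
    using \<delta> by (intro order_tendstoD(1)[OF limB]) auto
  moreover have "eventually (\<lambda>m. dist (PA 2 m) (inv_moment \<alpha> 2 z) < \<kappa> / 2) sequentially"
    using kc by (intro tendstoD[OF limA]) auto
  moreover have "eventually (\<lambda>n. dist (PB 2 n) (inv_moment \<beta> 2 (- z)) < \<kappa> / 2) sequentially"
    using kc by (intro tendstoD[OF limB]) auto
  ultimately have "eventually (\<lambda>m. m \<ge> 1 \<and> (\<forall>i\<in>{1..m}. a m i \<ge> \<eta> - z) \<and> (\<forall>j\<in>{1..m}. b m j \<ge> \<eta> + z) \<and>
    PA 1 m > inv_moment \<alpha> 1 z - \<delta> / 2 \<and> PB 1 m > inv_moment \<beta> 1 (- z) - \<delta> / 2 \<and>
    dist (PA 2 m) (inv_moment \<alpha> 2 z) < \<kappa> / 2 \<and> dist (PB 2 m) (inv_moment \<beta> 2 (- z)) < \<kappa> / 2) sequentially"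
    using eventually_ge_at_top[of "1::nat"] by eventually_elim blast
  then obtain L where L: "\<And>m. m \<ge> L \<Longrightarrow> m \<ge> 1 \<and> (\<forall>i\<in>{1..m}. a m i \<ge> \<eta> - z) \<and> (\<forall>j\<in>{1..m}. b m j \<ge> \<eta> + z) \<and>
    PA 1 m > inv_moment \<alpha> 1 z - \<delta> / 2 \<and> PB 1 m > inv_moment \<beta> 1 (- z) - \<delta> / 2 \<and>
    dist (PA 2 m) (inv_moment \<alpha> 2 z) < \<kappa> / 2 \<and> dist (PB 2 m) (inv_moment \<beta> 2 (- z)) < \<kappa> / 2"
    unfolding eventually_sequentially by blast
  show ?thesis
  proof (rule exI[of _ "\<kappa> / 2"], rule conjI, use kc in simp, rule exI[of _ c], rule conjI[OF kc(2)],
      rule exI[of _ 16], rule exI[of _ L], intro allI impI)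
    fix m n assume mn: "m \<ge> L" "n \<ge> L"
      and bal: "\<bar>real m * inv_moment \<alpha> 2 z - real n * inv_moment \<beta> 2 (- z)\<bar> \<le> \<kappa> / 2 * real (m + n)"
    then have m1: "m \<ge> 1" "n \<ge> 1" using L by auto
    have eqA: "(\<Sum>i=1..m. 1 / (a m i + z) ^ k) = real m * PA k m" for k using m1 by (simp add: PA_def)
    have eqB: "(\<Sum>j=1..n. 1 / (b n j - z) ^ k) = real n * PB k n" for k using m1 by (simp add: PB_def)
    have "real m * (inv_moment \<alpha> 1 z - \<delta> / 2) \<le> real m * PA 1 m" using L[OF mn(1)] by (intro mult_left_mono) auto
    then have sa: "(\<Sum>i=1..m. 1 / (a m i + z)) \<ge> real m * (inv_moment \<alpha> 1 z - \<delta> / 2)"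
      using eqA[of 1] by simp
    have "real n * (inv_moment \<beta> 1 (- z) - \<delta> / 2) \<le> real n * PB 1 n" using L[OF mn(2)] by (intro mult_left_mono) auto
    then have sb: "(\<Sum>j=1..n. 1 / (b n j - z)) \<ge> real n * (inv_moment \<beta> 1 (- z) - \<delta> / 2)"
      using eqB[of 1] by simp
    have "\<bar>real m * PA 2 m - real m * inv_moment \<alpha> 2 z\<bar> \<le> real m * (\<kappa> / 2)"
      using L[OF mn(1)] unfolding right_diff_distrib[symmetric] abs_mult by (intro mult_mono) (auto simp: dist_real_def)
    moreover have "\<bar>real n * PB 2 n - real n * inv_moment \<beta> 2 (- z)\<bar> \<le> real n * (\<kappa> / 2)"
      using L[OF mn(2)] unfolding right_diff_distrib[symmetric] abs_mult by (intro mult_mono) (auto simp: dist_real_def)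
    moreover have "\<kappa> / 2 * real (m + n) = real m * (\<kappa> / 2) + real n * (\<kappa> / 2)" "\<kappa> * real (m + n) = 2 * (real m * (\<kappa> / 2) + real n * (\<kappa> / 2))"
      by (auto simp: algebra_simps)
    ultimately have bal': "\<bar>(\<Sum>i=1..m. 1 / (a m i + z)\<^sup>2) - (\<Sum>j=1..n. 1 / (b n j - z)\<^sup>2)\<bar> \<le> \<kappa> * real (m + n)"
      unfolding eqA eqB using bal by linarith
    have "prob {\<omega>\<in>space M. T m n \<omega> < real m * inv_moment \<alpha> 1 z + real n * inv_moment \<beta> 1 (- z) - \<delta> * real (m + n)}
      \<le> prob {\<omega>\<in>space M. T m n \<omega> < (\<Sum>i=1..m. 1 / (a m i + z)) + (\<Sum>j=1..n. 1 / (b n j - z)) - \<delta> / 2 * real (m + n)}"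
    proof (rule prob_Collect_mono)
      have "\<delta> * real (m + n) = \<delta> / 2 * real (m + n) + (real m * (\<delta> / 2) + real n * (\<delta> / 2))"
        by (simp add: field_simps)
      note dN = this sa[unfolded right_diff_distrib] sb[unfolded right_diff_distrib]
      fix \<omega> assume "T m n \<omega> < real m * inv_moment \<alpha> 1 z + real n * inv_moment \<beta> 1 (- z) - \<delta> * real (m + n)"
      then show "T m n \<omega> < (\<Sum>i=1..m. 1 / (a m i + z)) + (\<Sum>j=1..n. 1 / (b n j - z)) - \<delta> / 2 * real (m + n)"
        using dN by linarith
    qed (use m1 in measurable)
    also have "\<dots> \<le> 16 * exp (- c * real (m + n))"
      using L[OF mn(1)] L[OF mn(2)]
      by (intro L0[OF indep[OF m1] _ _ _ _ bal']) (auto simp: algebra_simps)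
    finally show "prob {\<omega>\<in>space M. T m n \<omega> < real m * inv_moment \<alpha> 1 z + real n * inv_moment \<beta> 1 (- z) - \<delta> * real (m + n)}
      \<le> 16 * exp (- c * real (m + n))" .
  qed
qed

text \<open>Shifting the two sets of parameters by different amounts, \<open>\<eta> - lo\<close> and \<open>lo + \<eta>2\<close>, only
  increases the rates, and a column whose parameter is below \<open>lo + \<eta>2\<close> always exists.\<close>

lemma bulk_lower_slow_column:
  assumes \<eta>: "\<eta> > 0" "\<eta>2 > 0" and \<rho>: "\<rho> > 0" and \<delta>: "\<delta> > 0"
  shows "\<exists>c>0. \<exists>C L. \<forall>m\<ge>L. \<forall>n\<ge>L.
    real m * (inv_moment \<alpha> 2 (\<eta> - A.lo) + \<rho>) \<le> real n * (inv_moment \<beta> 2 (A.lo + \<eta>2) - \<rho>) \<longrightarrow>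
    prob {\<omega>\<in>space M. T m n \<omega> < real m * inv_moment \<alpha> 1 (\<eta> - A.lo) + real n * inv_moment \<beta> 1 (A.lo + \<eta>2) - \<delta> * real (m + n)}
      \<le> C * exp (- c * real (m + n))"
proof -
  define z where "z = \<eta> - A.lo"
  define w where "w = A.lo + \<eta>2"
  \<comment> \<open>A common lower bound for the shifted parameters: the smallest a + z tends to
    \<eta>, the smallest b + w to the positive gap plus \<eta>2.\<close>
  define \<theta> where "\<theta> = min (\<eta> / 2) (A.lo + B.lo)"
  have \<theta>: "\<theta> > 0" "\<theta> - z < A.lo" "\<theta> - w < B.lo" using \<eta> lo_gap by (auto simp: \<theta>_def z_def w_def)
  have zw: "z > - A.lo" "w > - B.lo" using \<eta> lo_gap by (auto simp: z_def w_def)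
  obtain C c where kc: "c > 0" and L0: "\<And>(M :: 's measure) X r u v m n N i0.
    indep_exp M X ({1..m}\<times>{1..n}) r \<Longrightarrow>
    (\<forall>i\<in>{1..m}. \<forall>j\<in>{1..n}. r (i, j) \<le> u i + v j) \<Longrightarrow>
    i0 \<in> {1..m} \<Longrightarrow> (\<forall>j\<in>{1..n}. r (i0, j) \<le> v j) \<Longrightarrow>
    (\<forall>i\<in>{1..m}. u i \<ge> \<theta>) \<Longrightarrow> (\<forall>j\<in>{1..n}. v j \<ge> \<theta>) \<Longrightarrow> real (m + n) \<le> N \<Longrightarrow>
    (\<Sum>i=1..m. 1 / (u i)\<^sup>2) \<le> (\<Sum>j=1..n. 1 / (v j)\<^sup>2) \<Longrightarrow>
    measure M {\<omega>\<in>space M. bulk (\<lambda>p. X p \<omega>) m n < (\<Sum>i=1..m. 1 / u i) + (\<Sum>j=1..n. 1 / v j) - \<delta> / 2 * N}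
      \<le> C * exp (- c * N)"
    using slow_column_bulk_lower_tail[OF \<theta>(1) half_gt_zero[OF \<delta>], where 's='s] by (elim exE conjE) (rule that, assumption, blast)
  define PA where "PA k m = (\<Sum>i=1..m. 1 / (a m i + z) ^ k) / real m" for k m
  define PB where "PB k n = (\<Sum>j=1..n. 1 / (b n j + w) ^ k) / real n" for k n
  have limA: "PA k \<longlonglongrightarrow> inv_moment \<alpha> k z" if "k = 1 \<or> k = 2" for k
    unfolding PA_def using zw that by (intro A.inv_moment_limit) auto
  have limB: "PB k \<longlonglongrightarrow> inv_moment \<beta> k w" if "k = 1 \<or> k = 2" for k
    unfolding PB_def using zw that by (intro B.inv_moment_limit) auto
  have "eventually (\<lambda>m. \<forall>i\<in>{1..m}. a m i \<ge> \<theta> - z) sequentially"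
    using \<theta> by (intro A.eventually_ge) (simp add: A.less_lo_iff)
  moreover have "eventually (\<lambda>n. \<forall>j\<in>{1..n}. b n j \<ge> \<theta> - w) sequentially"
    using \<theta> by (intro B.eventually_ge) (simp add: B.less_lo_iff)
  moreover have "eventually (\<lambda>m. PA 1 m > inv_moment \<alpha> 1 z - \<delta> / 2) sequentially"
    using \<delta> by (intro order_tendstoD(1)[OF limA]) auto
  moreover have "eventually (\<lambda>n. PB 1 n > inv_moment \<beta> 1 w - \<delta> / 2) sequentially"
    using \<delta> by (intro order_tendstoD(1)[OF limB]) auto
  moreover have "eventually (\<lambda>m. PA 2 m < inv_moment \<alpha> 2 z + \<rho>) sequentially"
    using \<rho> by (intro order_tendstoD(2)[OF limA]) auto
  moreover have "eventually (\<lambda>n. PB 2 n > inv_moment \<beta> 2 w - \<rho>) sequentially"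
    using \<rho> by (intro order_tendstoD(1)[OF limB]) auto
  \<comment> \<open>The minimum only converges to its limit, possibly from above; the margin \<eta>2
    > 0 ensures a column with a i0 \<le> w, whose rates are then at most b j + w.\<close>
  moreover have "eventually (\<lambda>m. ereal (min_param a m) < ereal w) sequentially"
  proof (rule order_tendstoD(2)[OF A.min_conv])
    show "\<aa> < ereal w" using \<eta> by (subst A.\<aa>_eq) (simp add: w_def)
  qed
  ultimately have "eventually (\<lambda>m. m \<ge> 1 \<and> (\<forall>i\<in>{1..m}. a m i \<ge> \<theta> - z) \<and> (\<forall>j\<in>{1..m}. b m j \<ge> \<theta> - w) \<and>
    PA 1 m > inv_moment \<alpha> 1 z - \<delta> / 2 \<and> PB 1 m > inv_moment \<beta> 1 w - \<delta> / 2 \<and>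
    PA 2 m < inv_moment \<alpha> 2 z + \<rho> \<and> PB 2 m > inv_moment \<beta> 2 w - \<rho> \<and> min_param a m < w) sequentially"
    using eventually_ge_at_top[of "1::nat"] by eventually_elim simp
  then obtain L where L: "\<And>m. m \<ge> L \<Longrightarrow> m \<ge> 1 \<and> (\<forall>i\<in>{1..m}. a m i \<ge> \<theta> - z) \<and> (\<forall>j\<in>{1..m}. b m j \<ge> \<theta> - w) \<and>
    PA 1 m > inv_moment \<alpha> 1 z - \<delta> / 2 \<and> PB 1 m > inv_moment \<beta> 1 w - \<delta> / 2 \<and>
    PA 2 m < inv_moment \<alpha> 2 z + \<rho> \<and> PB 2 m > inv_moment \<beta> 2 w - \<rho> \<and> min_param a m < w"
    unfolding eventually_sequentially by blast
  show ?thesis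
    unfolding z_def[symmetric] w_def[symmetric]
  proof (rule exI[of _ c], rule conjI[OF kc], rule exI[of _ C], rule exI[of _ L], intro allI impI)
    fix m n assume mn: "m \<ge> L" "n \<ge> L"
      and bal: "real m * (inv_moment \<alpha> 2 z + \<rho>) \<le> real n * (inv_moment \<beta> 2 w - \<rho>)"
    then have m1: "m \<ge> 1" "n \<ge> 1" using L by auto
    have eqA: "(\<Sum>i=1..m. 1 / (a m i + z) ^ k) = real m * PA k m" for k using m1 by (simp add: PA_def)
    have eqB: "(\<Sum>j=1..n. 1 / (b n j + w) ^ k) = real n * PB k n" for k using m1 by (simp add: PB_def)
    have "real m * (inv_moment \<alpha> 1 z - \<delta> / 2) \<le> real m * PA 1 m" using L[OF mn(1)] by (intro mult_left_mono) auto
    then have sa: "(\<Sum>i=1..m. 1 / (a m i + z)) \<ge> real m * (inv_moment \<alpha> 1 z - \<delta> / 2)"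
      using eqA[of 1] by simp
    have "real n * (inv_moment \<beta> 1 w - \<delta> / 2) \<le> real n * PB 1 n" using L[OF mn(2)] by (intro mult_left_mono) auto
    then have sb: "(\<Sum>j=1..n. 1 / (b n j + w)) \<ge> real n * (inv_moment \<beta> 1 w - \<delta> / 2)"
      using eqB[of 1] by simp
    have "real m * PA 2 m \<le> real m * (inv_moment \<alpha> 2 z + \<rho>)" using L[OF mn(1)] by (intro mult_left_mono) auto
    moreover have "real n * (inv_moment \<beta> 2 w - \<rho>) \<le> real n * PB 2 n" using L[OF mn(2)] by (intro mult_left_mono) auto
    ultimately have bal': "(\<Sum>i=1..m. 1 / (a m i + z)\<^sup>2) \<le> (\<Sum>j=1..n. 1 / (b n j + w)\<^sup>2)"
      unfolding eqA eqB using bal by linarith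
    obtain i0 where i0: "i0 \<in> {1..m}" "a m i0 \<le> w"
    proof -
      have "min_param a m \<in> a m ` {1..m}"
        unfolding min_param_def using m1 by (intro Min_in) auto
      then obtain i where "i \<in> {1..m}" "min_param a m = a m i" by auto
      then show thesis using that[of i] L[OF mn(1)] by auto
    qed
    have "prob {\<omega>\<in>space M. T m n \<omega> < real m * inv_moment \<alpha> 1 z + real n * inv_moment \<beta> 1 w - \<delta> * real (m + n)}
      \<le> prob {\<omega>\<in>space M. T m n \<omega> < (\<Sum>i=1..m. 1 / (a m i + z)) + (\<Sum>j=1..n. 1 / (b n j + w)) - \<delta> / 2 * real (m + n)}"
    proof (rule prob_Collect_mono)
      have "\<delta> * real (m + n) = \<delta> / 2 * real (m + n) + (real m * (\<delta> / 2) + real n * (\<delta> / 2))"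
        by (simp add: field_simps)
      note dN = this sa[unfolded right_diff_distrib] sb[unfolded right_diff_distrib]
      fix \<omega> assume "T m n \<omega> < real m * inv_moment \<alpha> 1 z + real n * inv_moment \<beta> 1 w - \<delta> * real (m + n)"
      then show "T m n \<omega> < (\<Sum>i=1..m. 1 / (a m i + z)) + (\<Sum>j=1..n. 1 / (b n j + w)) - \<delta> / 2 * real (m + n)"
        using dN by linarith
    qed (use m1 in measurable)
    also have "\<dots> \<le> C * exp (- c * real (m + n))"
    proof (rule L0[OF indep[OF m1] _ i0(1) _ _ _ _ bal'])
      show "\<forall>i\<in>{1..m}. \<forall>j\<in>{1..n}. a m (fst (i, j)) + b n (snd (i, j)) \<le> a m i + z + (b n j + w)"
        using \<eta> by (auto simp: z_def w_def)
      show "\<forall>j\<in>{1..n}. a m (fst (i0, j)) + b n (snd (i0, j)) \<le> b n j + w" using i0 by auto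
      show "\<forall>i\<in>{1..m}. \<theta> \<le> a m i + z" "\<forall>j\<in>{1..n}. \<theta> \<le> b n j + w"
        using L[OF mn(1)] L[OF mn(2)] by (auto simp: algebra_simps)
    qed simp
    finally show "prob {\<omega>\<in>space M. T m n \<omega> < real m * inv_moment \<alpha> 1 z + real n * inv_moment \<beta> 1 w - \<delta> * real (m + n)}
      \<le> C * exp (- c * real (m + n))" .
  qed
qed

end

section \<open>Lower bounds in every direction, with or without a balanced parameter\<close>

context lpp_arrays
begin

definition "I = {- A.lo<..<B.lo}"

text \<open>If the derivative of the limiting mean is positive on the whole interval, its infimum is
  approached at the left end, where a slow column takes over.\<close>

lemma flat_left_lower:
  assumes s0: "0 \<le> s0" "s0 \<le> 1" and flat: "\<And>z. z \<in> I \<Longrightarrow> s0 * inv_moment \<alpha> 2 z < (1 - s0) * inv_moment \<beta> 2 (- z)"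
    and \<delta>: "\<delta> > 0"
  shows "\<exists>z\<in>I. \<exists>r>0. \<exists>c>0. \<exists>C L. \<forall>m\<ge>L. \<forall>n\<ge>L. \<bar>real m - s0 * real (m + n)\<bar> \<le> r * real (m + n) \<longrightarrow>
    prob {\<omega>\<in>space M. T m n \<omega> < real m * inv_moment \<alpha> 1 z + real n * inv_moment \<beta> 1 (- z) - \<delta> * real (m + n)} \<le> C * exp (- c * real (m + n))"
proof -
  define g where "g = A.lo + B.lo"
  have g: "g > 0" using lo_gap by (simp add: g_def)
  define K where "K = max (1 / (g / 2)\<^sup>2) (2 / (g / 2) ^ 3)"
  have K: "K > 0" using g by (auto simp: K_def less_max_iff_disj)
  \<comment> \<open>The slow column yields the \<beta>-transform at \<open>A.lo + \<eta>2\<close>,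
    whereas z = \<eta> - A.lo calls for it at \<open>A.lo - \<eta>\<close>. These points are at most
    2 \<eta> apart and stay g / 2 away from the singularity, so the loss is at most 2 K \<eta> \<le>
    \<delta> / 2.\<close>
  define \<eta> where "\<eta> = min (g / 2) (\<delta> / (4 * K))"
  have \<eta>: "\<eta> > 0" "\<eta> \<le> g / 2" "K * \<eta> \<le> \<delta> / 4"
  proof -
    have "\<eta> \<le> \<delta> / (4 * K)" by (simp add: \<eta>_def)
    then show "K * \<eta> \<le> \<delta> / 4" using K by (simp add: field_simps)
  qed (use g K \<delta> in \<open>auto simp: \<eta>_def\<close>)
  have mem: "h - A.lo \<in> I" if "0 < h" "h \<le> \<eta>" for h
    using that \<eta> g by (auto simp: I_def g_def)
  have lim: "((\<lambda>h. (1 - s0) * inv_moment \<beta> 2 (A.lo + c * h)) \<longlongrightarrow> (1 - s0) * inv_moment \<beta> 2 A.lo) (at_right 0)" for c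
  proof -
    have "isCont (inv_moment \<beta> 2) (A.lo + c * 0)" using lo_gap by (intro B.inv_moment_isCont) auto
    moreover have "((\<lambda>h. A.lo + c * h) \<longlongrightarrow> A.lo + c * 0) (at_right 0)" by (intro tendsto_intros)
    ultimately have "((\<lambda>h. inv_moment \<beta> 2 (A.lo + c * h)) \<longlongrightarrow> inv_moment \<beta> 2 (A.lo + c * 0)) (at_right 0)"
      by (rule isCont_tendsto_compose)
    then show ?thesis by (intro tendsto_intros) simp
  qed
  \<comment> \<open>Letting z tend to the left end in the flatness inequality keeps only a weak
    inequality, with the \<alpha>-moment bounded below by its value for \<eta> / 2. The strict
    decrease from \<eta> / 2 to \<eta> restores strictness.\<close>
  have strict: "s0 * inv_moment \<alpha> 2 (\<eta> - A.lo) < (1 - s0) * inv_moment \<beta> 2 A.lo"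
  proof (cases "s0 = 0")
    case True
    then show ?thesis using B.inv_moment_pos[of A.lo 2] lo_gap by simp
  next
    case False
    have "s0 * inv_moment \<alpha> 2 (\<eta> / 2 - A.lo) \<le> (1 - s0) * inv_moment \<beta> 2 A.lo"
    proof (rule tendsto_lowerbound[OF lim[of "-1"]])
      show "\<forall>\<^sub>F h in at_right 0. s0 * inv_moment \<alpha> 2 (\<eta> / 2 - A.lo) \<le> (1 - s0) * inv_moment \<beta> 2 (A.lo + - 1 * h)"
        unfolding eventually_at_right_field
      proof (intro exI[of _ "\<eta> / 2"] conjI allI impI)
        fix h assume h: "0 < h" "h < \<eta> / 2"
        have "s0 * inv_moment \<alpha> 2 (\<eta> / 2 - A.lo) \<le> s0 * inv_moment \<alpha> 2 (h - A.lo)"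
          using h s0 by (intro mult_left_mono A.inv_moment_antimono) auto
        also have "\<dots> < (1 - s0) * inv_moment \<beta> 2 (- (h - A.lo))" using h \<eta> by (intro flat mem) auto
        finally show "s0 * inv_moment \<alpha> 2 (\<eta> / 2 - A.lo) \<le> (1 - s0) * inv_moment \<beta> 2 (A.lo + - 1 * h)" by simp
      qed (use \<eta> in auto)
    qed simp
    moreover have "s0 * inv_moment \<alpha> 2 (\<eta> - A.lo) < s0 * inv_moment \<alpha> 2 (\<eta> / 2 - A.lo)"
      using False s0 \<eta> by (intro mult_strict_left_mono A.inv_moment_strict_antimono) auto
    ultimately show ?thesis by linarith
  qed
  obtain \<eta>2 where \<eta>2: "\<eta>2 > 0" "\<eta>2 \<le> \<eta>" and gap2: "s0 * inv_moment \<alpha> 2 (\<eta> - A.lo) < (1 - s0) * inv_moment \<beta> 2 (A.lo + \<eta>2)"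
  proof -
    obtain h0 where h0: "h0 > 0" "\<And>h. 0 < h \<Longrightarrow> h < h0 \<Longrightarrow> s0 * inv_moment \<alpha> 2 (\<eta> - A.lo) < (1 - s0) * inv_moment \<beta> 2 (A.lo + 1 * h)"
      using order_tendstoD(1)[OF lim[of 1] strict] unfolding eventually_at_right_field by blast
    show thesis using that[of "min \<eta> (h0 / 2)"] h0(1) h0(2)[of "min \<eta> (h0 / 2)"] \<eta> by auto
  qed
  define A2 B2 where "A2 = inv_moment \<alpha> 2 (\<eta> - A.lo)" and "B2 = inv_moment \<beta> 2 (A.lo + \<eta>2)"
  have AB: "A2 > 0" "B2 > 0" using \<eta> \<eta>2 lo_gap by (auto simp: A2_def B2_def intro!: A.inv_moment_pos B.inv_moment_pos)
  define G where "G = (1 - s0) * B2 - s0 * A2"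
  have G: "G > 0" using gap2 by (simp add: G_def A2_def B2_def)
  \<comment> \<open>Half of the gap G absorbs the deviation of the direction from s0, half is the
    margin \<rho> that the slow-column estimate demands.\<close>
  define r where "r = G / 2 / (A2 + B2)"
  have "A2 + B2 > 0" using AB by simp
  then have r: "r > 0" "r * (A2 + B2) = G / 2" using G unfolding r_def by (simp_all del: divide_divide_eq_left)
  obtain c C L where c: "c > 0" and L: "\<And>m n. m \<ge> L \<Longrightarrow> n \<ge> L \<Longrightarrow>
    real m * (A2 + G / 2) \<le> real n * (B2 - G / 2) \<Longrightarrow>
    prob {\<omega>\<in>space M. T m n \<omega> < real m * inv_moment \<alpha> 1 (\<eta> - A.lo) + real n * inv_moment \<beta> 1 (A.lo + \<eta>2) - \<delta> / 2 * real (m + n)}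
      \<le> C * exp (- c * real (m + n))"
    using bulk_lower_slow_column[OF \<eta>(1) \<eta>2(1) half_gt_zero[OF G] half_gt_zero[OF \<delta>]]
    unfolding A2_def[symmetric] B2_def[symmetric] by blast
  have drop: "inv_moment \<beta> 1 (- (\<eta> - A.lo)) - inv_moment \<beta> 1 (A.lo + \<eta>2) \<le> \<delta> / 2"
  proof -
    have "inv_moment \<beta> 1 (- (\<eta> - A.lo)) - inv_moment \<beta> 1 (A.lo + \<eta>2) \<le> K * (A.lo + \<eta>2 - (- (\<eta> - A.lo)))"
      unfolding K_def using g \<eta> \<eta>2 by (intro B.inv_moment_lipschitz) (auto simp: g_def)
    also have "\<dots> \<le> K * (2 * \<eta>)" using K \<eta>2 by (intro mult_left_mono) auto
    finally show ?thesis using \<eta> by simp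
  qed
  show ?thesis
  proof (rule bexI[OF _ mem[OF \<eta>(1) order_refl]], rule exI[of _ r], rule conjI[OF r(1)], rule exI[of _ c], rule conjI[OF c],
      rule exI[of _ C], rule exI[of _ "max 1 L"], intro allI impI)
    fix m n assume mn: "max 1 L \<le> m" "max 1 L \<le> n" and dir: "\<bar>real m - s0 * real (m + n)\<bar> \<le> r * real (m + n)"
    define N where "N = real (m + n)"
    have N: "real m + real n = N" by (simp add: N_def)
    have "real m * A2 \<le> (s0 * N + r * N) * A2" using dir AB by (intro mult_right_mono) (auto simp: N_def)
    moreover have "((1 - s0) * N - r * N) * B2 \<le> real n * B2"
    proof (rule mult_right_mono)
      show "(1 - s0) * N - r * N \<le> real n" using dir N unfolding N_def[symmetric] by (simp add: algebra_simps)
    qed (use AB in auto)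
    moreover have "((1 - s0) * N - r * N) * B2 - (s0 * N + r * N) * A2 = N * (G - r * (A2 + B2))"
      by (simp add: G_def algebra_simps)
    moreover have "N * (G - r * (A2 + B2)) = real m * (G / 2) + real n * (G / 2)"
      unfolding r by (simp add: N[symmetric] algebra_simps)
    ultimately have bal: "real m * (A2 + G / 2) \<le> real n * (B2 - G / 2)"
      by (simp only: distrib_left right_diff_distrib)
    have dN: "\<delta> * real (m + n) = \<delta> / 2 * real (m + n) + (real m * (\<delta> / 2) + real n * (\<delta> / 2))"
      by (simp add: field_simps)
    have "real n * (inv_moment \<beta> 1 (- (\<eta> - A.lo)) - inv_moment \<beta> 1 (A.lo + \<eta>2)) \<le> real n * (\<delta> / 2)"
      using drop by (intro mult_left_mono) auto
    then have dn: "real n * inv_moment \<beta> 1 (- (\<eta> - A.lo)) - real n * inv_moment \<beta> 1 (A.lo + \<eta>2) \<le> real n * (\<delta> / 2)"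
      by (simp only: right_diff_distrib)
    have dm: "real m * (\<delta> / 2) \<ge> 0" using \<delta> by simp
    have "prob {\<omega>\<in>space M. T m n \<omega> < real m * inv_moment \<alpha> 1 (\<eta> - A.lo) + real n * inv_moment \<beta> 1 (- (\<eta> - A.lo)) - \<delta> * real (m + n)}
     \<le> prob {\<omega>\<in>space M. T m n \<omega> < real m * inv_moment \<alpha> 1 (\<eta> - A.lo) + real n * inv_moment \<beta> 1 (A.lo + \<eta>2) - \<delta> / 2 * real (m + n)}"
    proof (rule prob_Collect_mono)
      fix \<omega> assume "T m n \<omega> < real m * inv_moment \<alpha> 1 (\<eta> - A.lo) + real n * inv_moment \<beta> 1 (- (\<eta> - A.lo)) - \<delta> * real (m + n)"
      then show "T m n \<omega> < real m * inv_moment \<alpha> 1 (\<eta> - A.lo) + real n * inv_moment \<beta> 1 (A.lo + \<eta>2) - \<delta> / 2 * real (m + n)"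
        using dN dn dm by linarith
    next
      have "m \<ge> 1" "n \<ge> 1" using mn by auto
      then show "{\<omega>\<in>space M. T m n \<omega> < real m * inv_moment \<alpha> 1 (\<eta> - A.lo) + real n * inv_moment \<beta> 1 (A.lo + \<eta>2) - \<delta> / 2 * real (m + n)} \<in> events"
        by measurable
    qed
    also have "\<dots> \<le> C * exp (- c * real (m + n))" using mn bal by (intro L) auto
    finally show "prob {\<omega>\<in>space M. T m n \<omega> < real m * inv_moment \<alpha> 1 (\<eta> - A.lo) + real n * inv_moment \<beta> 1 (- (\<eta> - A.lo)) - \<delta> * real (m + n)}
      \<le> C * exp (- c * real (m + n))" .
  qed
qed

text \<open>Reflection in the diagonal exchanges the two parameter sets, z with - z and s0 with 1 -
  s0, so the flat case at the right end becomes the one at the left end.\<close>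

lemma transposed: "lpp_arrays b a \<beta> \<alpha> \<bb> \<aa> M (\<lambda>m n p. X n m (snd p, fst p))"
proof unfold_locales
  show "0 < \<bb> + \<aa>" using gap by (simp add: add.commute)
  show "indep_exp M (\<lambda>p. X n m (snd p, fst p)) ({1..m} \<times> {1..n}) (\<lambda>p. b m (fst p) + a n (snd p))"
    if "1 \<le> m" "1 \<le> n" for m n
  proof -
    have "inj_on (\<lambda>p. (snd p, fst p)) ({1..m}\<times>{1..n})" "(\<lambda>p. (snd p, fst p)) ` ({1..m}\<times>{1..n}) \<subseteq> {1..n}\<times>{1..m}"
      by (auto simp: inj_on_def)
    from indep_exp_reindex[OF indep[OF that(2,1)] this] show ?thesis by (simp add: add.commute)
  qed
qed

text \<open>D is the derivative in z of the limiting mean in direction s0. It is continuous on a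
  connected interval, so it has a zero, where the sums of squares balance, or keeps one sign, in
  which case one end of the interval is flat.\<close>

lemma direction_lower:
  assumes s0: "0 \<le> s0" "s0 \<le> 1" and \<delta>: "\<delta> > 0"
  shows "\<exists>z\<in>I. \<exists>r>0. \<exists>c>0. \<exists>C L. \<forall>m\<ge>L. \<forall>n\<ge>L. \<bar>real m - s0 * real (m + n)\<bar> \<le> r * real (m + n) \<longrightarrow>
    prob {\<omega>\<in>space M. T m n \<omega> < real m * inv_moment \<alpha> 1 z + real n * inv_moment \<beta> 1 (- z) - \<delta> * real (m + n)} \<le> C * exp (- c * real (m + n))"
proof -
  define D where "D z = (1 - s0) * inv_moment \<beta> 2 (- z) - s0 * inv_moment \<alpha> 2 z" for z
  have "continuous_on I D"
  proof (rule continuous_at_imp_continuous_on, rule ballI)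
    fix z assume z: "z \<in> I"
    have "isCont (inv_moment \<alpha> 2) z" using z by (intro A.inv_moment_isCont) (auto simp: I_def)
    moreover have "isCont (\<lambda>z. inv_moment \<beta> 2 (- z)) z"
      using z by (intro isCont_o2[of z uminus "inv_moment \<beta> 2"] B.inv_moment_isCont) (auto simp: I_def intro!: continuous_intros)
    ultimately show "isCont D z" unfolding D_def by (intro continuous_intros)
  qed
  then have conn: "connected (D ` I)" unfolding I_def by (intro connected_continuous_image) auto
  consider z where "z \<in> I" "D z = 0" | "\<And>z. z \<in> I \<Longrightarrow> D z > 0" | "\<And>z. z \<in> I \<Longrightarrow> D z < 0"
  proof -
    have "0 \<in> D ` I" if "z1 \<in> I" "z2 \<in> I" "D z1 \<le> 0" "D z2 \<ge> 0" for z1 z2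
      using connected_contains_Icc[OF conn, of "D z1" "D z2"] that by auto
    then show thesis using that by (metis (no_types) imageE not_less)
  qed
  then show ?thesis
  proof cases
    case (1 z)
    then have z: "- A.lo < z" "z < B.lo" by (auto simp: I_def)
    define A2 B2 where "A2 = inv_moment \<alpha> 2 z" and "B2 = inv_moment \<beta> 2 (- z)"
    have AB: "A2 > 0" "B2 > 0" using z by (auto simp: A2_def B2_def intro!: A.inv_moment_pos B.inv_moment_pos)
    obtain \<rho> c C L where \<rho>: "\<rho> > 0" "c > 0" and L: "\<And>m n. m \<ge> L \<Longrightarrow> n \<ge> L \<Longrightarrow> \<bar>real m * A2 - real n * B2\<bar> \<le> \<rho> * real (m + n) \<Longrightarrow>
      prob {\<omega>\<in>space M. T m n \<omega> < real m * inv_moment \<alpha> 1 z + real n * inv_moment \<beta> 1 (- z) - \<delta> * real (m + n)} \<le> C * exp (- c * real (m + n))"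
      using bulk_lower_balanced[OF z \<delta>] unfolding A2_def[symmetric] B2_def[symmetric] by blast
    define r where "r = \<rho> / (A2 + B2)"
    have r: "r > 0" "r * (A2 + B2) = \<rho>" using AB \<rho> by (auto simp: r_def)
    show ?thesis
    proof (rule bexI[OF _ 1(1)], rule exI[of _ r], rule conjI[OF r(1)], rule exI[of _ c], rule conjI[OF \<rho>(2)],
      rule exI[of _ C], rule exI[of _ L], intro allI impI)
      fix m n assume mn: "L \<le> m" "L \<le> n" and dir: "\<bar>real m - s0 * real (m + n)\<bar> \<le> r * real (m + n)"
      have "real m * A2 - real n * B2 = (real m - s0 * real (m + n)) * (A2 + B2) - real (m + n) * D z"
        by (simp add: D_def A2_def B2_def algebra_simps)
      then have "\<bar>real m * A2 - real n * B2\<bar> = \<bar>real m - s0 * real (m + n)\<bar> * (A2 + B2)"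
        using 1 AB by (simp add: abs_mult)
      also have "\<dots> \<le> r * real (m + n) * (A2 + B2)" using dir AB by (intro mult_right_mono) auto
      also have "\<dots> = \<rho> * real (m + n)" unfolding r(2)[symmetric] by (simp only: mult_ac)
      finally show "prob {\<omega>\<in>space M. T m n \<omega> < real m * inv_moment \<alpha> 1 z + real n * inv_moment \<beta> 1 (- z) - \<delta> * real (m + n)} \<le> C * exp (- c * real (m + n))"
        using mn by (intro L)
    qed
  next
    case 2
    then show ?thesis using \<delta> s0 by (intro flat_left_lower) (auto simp: D_def)
  next
    case 3
    interpret tr: lpp_arrays b a \<beta> \<alpha> \<bb> \<aa> M "\<lambda>m n p. X n m (snd p, fst p)" by (rule transposed)
    have trT: "tr.T m n \<omega> = T n m \<omega>" for m n \<omega>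
      using bulk_transpose[of "\<lambda>p. X n m p \<omega>" m n] by simp
    have neg: "- z \<in> I" if "z \<in> tr.I" for z using that by (auto simp: I_def tr.I_def)
    have "(1 - s0) * inv_moment \<beta> 2 z < (1 - (1 - s0)) * inv_moment \<alpha> 2 (- z)" if "z \<in> tr.I" for z
      using 3[OF neg[OF that]] by (simp add: D_def)
    from tr.flat_left_lower[OF _ _ this \<delta>] s0
    obtain z r c C L where z: "z \<in> tr.I" and r: "r > 0" "c > 0" and L: "\<And>m n. m \<ge> L \<Longrightarrow> n \<ge> L \<Longrightarrow>
      \<bar>real m - (1 - s0) * real (m + n)\<bar> \<le> r * real (m + n) \<Longrightarrow>
      prob {\<omega>\<in>space M. tr.T m n \<omega> < real m * inv_moment \<beta> 1 z + real n * inv_moment \<alpha> 1 (- z) - \<delta> * real (m + n)} \<le> C * exp (- c * real (m + n))"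
      by (simp only: diff_ge_0_iff_ge diff_le_eq le_add_same_cancel1) blast
    show ?thesis
    proof (rule bexI[OF _ neg[OF z]], rule exI[of _ r], rule conjI[OF r(1)], rule exI[of _ c], rule conjI[OF r(2)],
      rule exI[of _ C], rule exI[of _ L], intro allI impI)
      fix m n assume mn: "L \<le> m" "L \<le> n" and dir: "\<bar>real m - s0 * real (m + n)\<bar> \<le> r * real (m + n)"
      have e: "real n - (1 - s0) * real (n + m) = - (real m - s0 * real (m + n))" by (simp add: algebra_simps)
      have dir': "\<bar>real n - (1 - s0) * real (n + m)\<bar> \<le> r * real (n + m)"
        unfolding e abs_minus_cancel using dir by (simp add: add.commute)
      show "prob {\<omega>\<in>space M. T m n \<omega> < real m * inv_moment \<alpha> 1 (- z) + real n * inv_moment \<beta> 1 (- (- z)) - \<delta> * real (m + n)} \<le> C * exp (- c * real (m + n))"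
        using L[OF mn(2,1) dir'] unfolding trT by (simp add: add.commute)
    qed
  qed
qed

text \<open>Closeness to the infimum over z without naming it: one z, free to depend on \<omega>, m
  and n, witnesses the lower bound, while the upper bound holds for all z. This is the form in which
  the inversion consumes it.\<close>

definition good :: "real \<Rightarrow> nat \<Rightarrow> nat \<Rightarrow> 's \<Rightarrow> bool" where
  "good \<delta> m n \<omega> \<longleftrightarrow>
     (\<exists>z\<in>I. T m n \<omega> \<ge> real m * inv_moment \<alpha> 1 z + real n * inv_moment \<beta> 1 (- z) - \<delta> * real (m + n)) \<and>
     (\<forall>z\<in>I. T m n \<omega> \<le> real m * inv_moment \<alpha> 1 z + real n * inv_moment \<beta> 1 (- z) + \<delta> * real (m + n))"

text \<open>The tail estimate controls one z at a time, but \<open>good\<close> asks for all z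
  together. One near-minimizer z0 suffices: its upper bound lies within a small multiple of m + n
  above the infimum, hence below the mean for every other z. A measurable exceptional E is supplied,
  since \<open>good\<close> ranges over uncountably many z.\<close>

lemma direction_good:
  assumes s0: "0 \<le> s0" "s0 \<le> 1" and \<delta>: "\<delta> > 0"
  shows "\<exists>r>0. \<exists>c>0. \<exists>C L. \<forall>m\<ge>L. \<forall>n\<ge>L. \<bar>real m - s0 * real (m + n)\<bar> \<le> r * real (m + n) \<longrightarrow>
    (\<exists>E\<in>events. prob E \<le> C * exp (- c * real (m + n)) \<and> (\<forall>\<omega>\<in>space M - E. good \<delta> m n \<omega>))"
proof -
  define \<mu> where "\<mu> z = s0 * inv_moment \<alpha> 1 z + (1 - s0) * inv_moment \<beta> 1 (- z)" for z
  have pos: "inv_moment \<alpha> 1 z > 0" "inv_moment \<beta> 1 (- z) > 0" if "z \<in> I" for z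
    using that by (auto simp: I_def intro!: A.inv_moment_pos B.inv_moment_pos)
  define g where "g = (INF z\<in>I. \<mu> z)"
  have \<mu>0: "\<mu> z \<ge> 0" if "z \<in> I" for z using pos[OF that] s0 by (auto simp: \<mu>_def)
  have ne: "I \<noteq> {}" using lo_gap by (auto simp: I_def)
  have gle: "g \<le> \<mu> z" if "z \<in> I" for z
    unfolding g_def using \<mu>0 that by (intro cINF_lower bdd_belowI2[of _ 0]) auto
  have g0: "g \<ge> 0" unfolding g_def using \<mu>0 ne by (intro cINF_greatest) auto
  obtain z0 where z0: "z0 \<in> I" "\<mu> z0 < g + \<delta> / 4"
  proof -
    have "Inf (\<mu> ` I) < g + \<delta> / 4" using \<delta> by (simp add: g_def)
    then show thesis using cInf_lessD[of "\<mu> ` I" "g + \<delta> / 4"] ne that by auto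
  qed
  obtain c1 C1 L1 where c1: "c1 > 0" and L1: "\<And>m n. m \<ge> L1 \<Longrightarrow> n \<ge> L1 \<Longrightarrow>
    prob {\<omega>\<in>space M. T m n \<omega> \<ge> real m * inv_moment \<alpha> 1 z0 + real n * inv_moment \<beta> 1 (- z0) + \<delta> / 4 * real (m + n)} \<le> C1 * exp (- c1 * real (m + n))"
  proof -
    have "- A.lo < z0" "z0 < B.lo" "\<delta> / 4 > 0" using z0 \<delta> by (auto simp: I_def)
    then show thesis using bulk_upper[of z0 "\<delta> / 4"] that by blast
  qed
  obtain z1 r2 c2 C2 L2 where z1: "z1 \<in> I" and r2: "r2 > 0" "c2 > 0" and L2: "\<And>m n. m \<ge> L2 \<Longrightarrow> n \<ge> L2 \<Longrightarrow>
    \<bar>real m - s0 * real (m + n)\<bar> \<le> r2 * real (m + n) \<Longrightarrow>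
    prob {\<omega>\<in>space M. T m n \<omega> < real m * inv_moment \<alpha> 1 z1 + real n * inv_moment \<beta> 1 (- z1) - \<delta> * real (m + n)} \<le> C2 * exp (- c2 * real (m + n))"
    using direction_lower[OF s0 \<delta>] by blast
  \<comment> \<open>The transforms may be unbounded near the ends of the interval, so an additive
    error in m or n would not be uniform in z. A relative error \<rho> is: it costs only \<rho> g of
    the infimum. Choice of z0, fluctuation, direction and \<rho> take \<delta> / 4 each.\<close>
  define \<rho> where "\<rho> = min 1 (\<delta> / (4 * (g + 1)))"
  have \<rho>: "\<rho> > 0" "\<rho> \<le> 1" "\<rho> * g \<le> \<delta> / 4"
  proof -
    show "\<rho> > 0" using \<delta> g0 by (simp add: \<rho>_def)
    have "\<rho> * g \<le> \<delta> / (4 * (g + 1)) * (g + 1)"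
      using g0 \<delta> by (intro mult_mono) (auto simp: \<rho>_def)
    also have "\<delta> / (4 * (g + 1)) * (g + 1) = \<delta> / 4" using g0 by (simp add: divide_simps)
    finally show "\<rho> * g \<le> \<delta> / 4" .
  qed (simp add: \<rho>_def)
  define A0 B0 where "A0 = inv_moment \<alpha> 1 z0" and "B0 = inv_moment \<beta> 1 (- z0)"
  have AB: "A0 > 0" "B0 > 0" using pos[OF z0(1)] by (auto simp: A0_def B0_def)
  \<comment> \<open>The radius must be small relative to s0 and 1 - s0. Where one of these vanishes,
    the corresponding lower bound on m or n is just nonnegativity, and the default 1 stands
    in.\<close>
  define r where "r = min (min r2 (\<delta> / 4 / (A0 + B0))) (min (if s0 = 0 then 1 else \<rho> * s0) (if s0 = 1 then 1 else \<rho> * (1 - s0)))"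
  have r: "r > 0" "r \<le> r2" "r \<le> \<delta> / 4 / (A0 + B0)" "s0 \<noteq> 0 \<Longrightarrow> r \<le> \<rho> * s0" "s0 \<noteq> 1 \<Longrightarrow> r \<le> \<rho> * (1 - s0)"
    using r2 \<delta> AB \<rho> s0 by (auto simp: r_def)
  have rAB: "r * (A0 + B0) \<le> \<delta> / 4" using r(3) add_pos_pos[OF AB] by (simp only: pos_le_divide_eq)
  define c where "c = min c1 c2"
  show ?thesis
  proof (rule exI[of _ r], rule conjI[OF r(1)], rule exI[of _ c], rule conjI,
      use c1 r2 in \<open>simp add: c_def\<close>, rule exI[of _ "\<bar>C1\<bar> + \<bar>C2\<bar>"], rule exI[of _ "max 1 (max L1 L2)"], intro allI impI)
    fix m n assume mn: "max 1 (max L1 L2) \<le> m" "max 1 (max L1 L2) \<le> n" and dir: "\<bar>real m - s0 * real (m + n)\<bar> \<le> r * real (m + n)"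
    define N where "N = real (m + n)"
    have N: "real m + real n = N" "N \<ge> 0" by (auto simp: N_def)
    define E1 where "E1 = {\<omega>\<in>space M. T m n \<omega> \<ge> real m * A0 + real n * B0 + \<delta> / 4 * N}"
    define E2 where "E2 = {\<omega>\<in>space M. T m n \<omega> < real m * inv_moment \<alpha> 1 z1 + real n * inv_moment \<beta> 1 (- z1) - \<delta> * N}"
    have "m \<ge> 1" "n \<ge> 1" using mn by auto
    then have ev: "E1 \<in> events" "E2 \<in> events" unfolding E1_def E2_def by measurable
    have rr: "r * N \<le> r2 * N" using r N by (intro mult_right_mono) auto
    have "prob E1 \<le> C1 * exp (- c1 * N)" unfolding E1_def A0_def B0_def N_def using mn by (intro L1) auto
    also have "\<dots> \<le> \<bar>C1\<bar> * exp (- c * N)"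
      using N by (intro mult_mono) (auto simp: c_def intro!: mult_right_mono)
    finally have P1: "prob E1 \<le> \<bar>C1\<bar> * exp (- c * N)" .
    have "prob E2 \<le> C2 * exp (- c2 * N)" unfolding E2_def N_def using mn order_trans[OF dir rr[unfolded N_def]] by (intro L2) auto
    also have "\<dots> \<le> \<bar>C2\<bar> * exp (- c * N)"
      using N by (intro mult_mono) (auto simp: c_def intro!: mult_right_mono)
    finally have P2: "prob E2 \<le> \<bar>C2\<bar> * exp (- c * N)" .
    show "\<exists>E\<in>events. prob E \<le> (\<bar>C1\<bar> + \<bar>C2\<bar>) * exp (- c * real (m + n)) \<and> (\<forall>\<omega>\<in>space M - E. good \<delta> m n \<omega>)"
    proof (intro bexI[of _ "E1 \<union> E2"] conjI ballI)
      show "E1 \<union> E2 \<in> events" using ev by auto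
      have "prob (E1 \<union> E2) \<le> prob E1 + prob E2" using ev by (intro measure_Un_le)
      then show "prob (E1 \<union> E2) \<le> (\<bar>C1\<bar> + \<bar>C2\<bar>) * exp (- c * real (m + n))"
        using P1 P2 by (simp add: N_def distrib_right)
      fix \<omega> assume \<omega>: "\<omega> \<in> space M - (E1 \<union> E2)"
      have lower: "T m n \<omega> \<ge> real m * inv_moment \<alpha> 1 z1 + real n * inv_moment \<beta> 1 (- z1) - \<delta> * N"
        using \<omega> by (auto simp: E2_def)
      have m_le: "real m \<le> s0 * N + r * N" and n_le: "real n \<le> (1 - s0) * N + r * N"
        using dir N by (auto simp: N_def[symmetric] abs_le_iff algebra_simps)
      have "T m n \<omega> \<le> real m * A0 + real n * B0 + \<delta> / 4 * N" using \<omega> by (auto simp: E1_def)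
      also have "\<dots> \<le> (s0 * N + r * N) * A0 + ((1 - s0) * N + r * N) * B0 + \<delta> / 4 * N"
        using m_le n_le AB N by (intro add_mono mult_right_mono) auto
      also have "\<dots> = (\<mu> z0 + r * (A0 + B0) + \<delta> / 4) * N" by (simp add: \<mu>_def A0_def B0_def algebra_simps)
      also have "\<dots> \<le> (g + \<delta> / 4 + \<delta> / 4 + \<delta> / 4) * N"
        using z0 rAB N by (intro mult_right_mono) auto
      finally have up: "T m n \<omega> \<le> (g + 3 / 4 * \<delta>) * N" by (simp add: algebra_simps)
      have "(1 - \<rho>) * s0 * N \<le> real m"
      proof (cases "s0 = 0")
        case False
        have "s0 * N - r * N \<le> real m" using dir by (auto simp: N_def)
        moreover have "r * N \<le> \<rho> * s0 * N" using r(4)[OF False] N by (intro mult_right_mono) auto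
        ultimately show ?thesis by (simp add: algebra_simps)
      qed simp
      moreover have "(1 - \<rho>) * (1 - s0) * N \<le> real n"
      proof (cases "s0 = 1")
        case False
        have "(1 - s0) * N - r * N \<le> real n" using dir N by (auto simp: N_def[symmetric] abs_le_iff algebra_simps)
        moreover have "r * N \<le> \<rho> * (1 - s0) * N" using r(5)[OF False] N by (intro mult_right_mono) auto
        ultimately show ?thesis by (simp add: algebra_simps)
      qed simp
      ultimately have low: "(1 - \<rho>) * N * \<mu> z \<le> real m * inv_moment \<alpha> 1 z + real n * inv_moment \<beta> 1 (- z)" if "z \<in> I" for z
      proof -
        have "(1 - \<rho>) * N * \<mu> z = (1 - \<rho>) * s0 * N * inv_moment \<alpha> 1 z + (1 - \<rho>) * (1 - s0) * N * inv_moment \<beta> 1 (- z)"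
          by (simp add: \<mu>_def algebra_simps)
        also have "\<dots> \<le> real m * inv_moment \<alpha> 1 z + real n * inv_moment \<beta> 1 (- z)"
          using pos[OF that] \<open>(1 - \<rho>) * s0 * N \<le> real m\<close> \<open>(1 - \<rho>) * (1 - s0) * N \<le> real n\<close>
          by (intro add_mono mult_right_mono) auto
        finally show ?thesis .
      qed
      have "T m n \<omega> \<le> real m * inv_moment \<alpha> 1 z + real n * inv_moment \<beta> 1 (- z) + \<delta> * N" if "z \<in> I" for z
      proof -
        have "(1 - \<rho>) * N * g \<le> (1 - \<rho>) * N * \<mu> z" using gle[OF that] \<rho> N by (intro mult_left_mono) auto
        moreover have "\<rho> * g * N \<le> \<delta> / 4 * N" using \<rho> N by (intro mult_right_mono) auto
        moreover have "(1 - \<rho>) * N * g = g * N - \<rho> * g * N" "(g + 3 / 4 * \<delta>) * N = g * N + 3 / 4 * (\<delta> * N)" "\<delta> / 4 * N = 1 / 4 * (\<delta> * N)"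
          by (simp_all add: algebra_simps)
        ultimately show ?thesis using up low[OF that] by linarith
      qed
      then show "good \<delta> m n \<omega>" unfolding good_def N_def[symmetric] using lower z1 by blast
    qed
  qed
qed

end

subsection \<open>Almost sure shape theorem\<close>

text \<open>The linear factor counts the pairs on an antidiagonal; half of the exponential decay
  absorbs it.\<close>

lemma linear_times_geometric_summable:
  fixes c C :: real
  assumes "c > 0" "C \<ge> 0"
  shows "summable (\<lambda>N::nat. (real N + 1) * (C * exp (- c * real N)))"
proof (rule summable_comparison_test')
  show "summable (\<lambda>N::nat. (2 / c + 1) * C * exp (- (c / 2)) ^ N)"
    using assms by (intro summable_mult summable_geometric) auto
  fix N :: nat
  have "c / 2 * real N \<le> exp (c / 2 * real N)" using exp_ge_add_one_self[of "c / 2 * real N"] by linarith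
  then have "real N \<le> 2 / c * exp (c / 2 * real N)" using assms by (simp add: field_simps)
  moreover have "1 \<le> exp (c / 2 * real N)" using assms by simp
  ultimately have "real N + 1 \<le> (2 / c + 1) * exp (c / 2 * real N)" unfolding distrib_right by linarith
  then have "(real N + 1) * (C * exp (- c * real N)) \<le> (2 / c + 1) * exp (c / 2 * real N) * (C * exp (- c * real N))"
    using assms by (intro mult_right_mono) auto
  also have "\<dots> = (2 / c + 1) * C * (exp (c / 2 * real N) * exp (- c * real N))" by (simp add: mult_ac)
  also have "exp (c / 2 * real N) * exp (- c * real N) = exp (- (c / 2)) ^ N"
    by (simp add: exp_add[symmetric] exp_of_nat_mult[symmetric] algebra_simps)
  finally show "norm ((real N + 1) * (C * exp (- c * real N))) \<le> (2 / c + 1) * C * exp (- (c / 2)) ^ N"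
    using assms by simp
qed

context lpp_arrays
begin

text \<open>Radius, rate, constant and threshold vary with the direction. Finitely many balls cover
  the directions m / (m + n) in [0, 1], and the worst of finitely many choices serves all.\<close>

lemma uniform_good:
  assumes \<delta>: "\<delta> > 0"
  shows "\<exists>c>0. \<exists>C\<ge>0. \<exists>L. \<forall>m\<ge>L. \<forall>n\<ge>L.
    \<exists>E\<in>events. prob E \<le> C * exp (- c * real (m + n)) \<and> (\<forall>\<omega>\<in>space M - E. good \<delta> m n \<omega>)"
proof -
  define P where "P s r c C L \<longleftrightarrow> r > 0 \<and> c > 0 \<and> (\<forall>m\<ge>L. \<forall>n\<ge>L. \<bar>real m - s * real (m + n)\<bar> \<le> r * real (m + n) \<longrightarrow>
    (\<exists>E\<in>events. prob E \<le> C * exp (- c * real (m + n)) \<and> (\<forall>\<omega>\<in>space M - E. good \<delta> m n \<omega>)))"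
    for s r c C :: real and L
  have "\<forall>s\<in>{0..1::real}. \<exists>q. P s (fst q) (fst (snd q)) (fst (snd (snd q))) (snd (snd (snd q)))"
  proof
    fix s :: real assume "s \<in> {0..1}"
    then have "\<exists>r c C L. P s r c C L" using direction_good[OF _ _ \<delta>, of s] unfolding P_def by simp
    then obtain r c C L where "P s r c C L" by blast
    then show "\<exists>q. P s (fst q) (fst (snd q)) (fst (snd (snd q))) (snd (snd (snd q)))"
      by (intro exI[of _ "(r, c, C, L)"]) simp
  qed
  from bchoice[OF this] obtain q where
    "\<forall>s\<in>{0..1}. P s (fst (q s)) (fst (snd (q s))) (fst (snd (snd (q s)))) (snd (snd (snd (q s))))" ..
  then have "\<exists>r c C L. \<forall>s\<in>{0..1}. P s (r s) (c s) (C s) (L s)" by fast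
  then obtain r c C L where P: "\<And>s. s \<in> {0..1} \<Longrightarrow> P s (r s) (c s) (C s) (L s)" by blast
  have rc: "\<And>s. s \<in> {0..1::real} \<Longrightarrow> r s > (0::real)" "\<And>s. s \<in> {0..1::real} \<Longrightarrow> c s > (0::real)"
    using P unfolding P_def by blast+
  have G: "\<And>s m n. s \<in> {0..1::real} \<Longrightarrow> m \<ge> L s \<Longrightarrow> n \<ge> L s \<Longrightarrow> \<bar>real m - s * real (m + n)\<bar> \<le> r s * real (m + n) \<Longrightarrow>
    (\<exists>E\<in>events. prob E \<le> C s * exp (- c s * real (m + n)) \<and> (\<forall>\<omega>\<in>space M - E. good \<delta> m n \<omega>))"
    using P unfolding P_def by blast
  have "{0..1} \<subseteq> (\<Union>s\<in>{0..1}. ball s (r s))" using rc by auto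
  then obtain S where S: "S \<subseteq> {0..1}" "finite S" "{0..1} \<subseteq> (\<Union>s\<in>S. ball s (r s))"
    using compactE_image[of "{0..1::real}" "{0..1}" "\<lambda>s. ball s (r s)"] by auto
  have Sne: "S \<noteq> {}" using S by auto
  define c' where "c' = Min (c ` S)"
  define C' where "C' = (\<Sum>s\<in>S. \<bar>C s\<bar>)"
  define L' where "L' = Max (insert 1 (L ` S))"
  have c': "c' > 0" unfolding c'_def using S Sne rc by (subst Min_gr_iff) auto
  have C': "C' \<ge> 0" by (simp add: C'_def sum_nonneg)
  show ?thesis
  proof (rule exI[of _ c'], rule conjI[OF c'], rule exI[of _ C'], rule conjI[OF C'], rule exI[of _ L'], intro allI impI)
    fix m n assume mn: "m \<ge> L'" "n \<ge> L'"
    have "L' \<ge> 1" unfolding L'_def using S by (intro Max_ge) auto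
    then have N: "real (m + n) > 0" using mn by simp
    define s1 where "s1 = real m / real (m + n)"
    have "s1 \<in> {0..1}" using N by (auto simp: s1_def)
    then obtain s where s: "s \<in> S" "\<bar>s1 - s\<bar> < r s" using S(3) by (auto simp: dist_real_def abs_minus_commute)
    have "\<bar>real m - s * real (m + n)\<bar> = \<bar>s1 - s\<bar> * real (m + n)"
    proof -
      have "real m - s * real (m + n) = (s1 - s) * real (m + n)" using N by (simp add: s1_def left_diff_distrib)
      then show ?thesis using N by (simp add: abs_mult)
    qed
    also have "\<dots> \<le> r s * real (m + n)" using s N by (intro mult_right_mono) auto
    finally have d: "\<bar>real m - s * real (m + n)\<bar> \<le> r s * real (m + n)" .
    have "L s \<le> L'" unfolding L'_def using S s by (intro Max_ge) auto
    then have "m \<ge> L s" "n \<ge> L s" "s \<in> {0..1}" using s S mn by auto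
    then obtain E where E: "E \<in> events" "prob E \<le> C s * exp (- c s * real (m + n))" "\<forall>\<omega>\<in>space M - E. good \<delta> m n \<omega>"
      using G[OF _ _ _ d] by blast
    note E(2)
    also have "C s * exp (- c s * real (m + n)) \<le> C' * exp (- c' * real (m + n))"
    proof (rule mult_mono)
      have "C s \<le> \<bar>C s\<bar>" by simp
      also have "\<dots> \<le> C'" unfolding C'_def using s S by (intro member_le_sum) auto
      finally show "C s \<le> C'" .
      have "c' \<le> c s" unfolding c'_def using s S by (intro Min_le) auto
      then show "exp (- c s * real (m + n)) \<le> exp (- c' * real (m + n))" using N by (simp add: mult_right_mono)
    qed (use C' in auto)
    finally show "\<exists>E\<in>events. prob E \<le> C' * exp (- c' * real (m + n)) \<and> (\<forall>\<omega>\<in>space M - E. good \<delta> m n \<omega>)"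
      using E by blast
  qed
qed

lemma AE_good:
  assumes \<delta>: "\<delta> > 0"
  shows "AE \<omega> in M. \<exists>L. \<forall>m\<ge>L. \<forall>n\<ge>L. good \<delta> m n \<omega>"
proof -
  obtain c C L where c: "c > 0" "C \<ge> 0" and ex: "\<forall>m\<ge>L. \<forall>n\<ge>L.
    \<exists>E\<in>events. prob E \<le> C * exp (- c * real (m + n)) \<and> (\<forall>\<omega>\<in>space M - E. good \<delta> m n \<omega>)"
    using uniform_good[OF \<delta>] by blast
  have "\<forall>m n. \<exists>E. E \<in> events \<and> prob E \<le> C * exp (- c * real (m + n)) \<and> (m \<ge> L \<longrightarrow> n \<ge> L \<longrightarrow> (\<forall>\<omega>\<in>space M - E. good \<delta> m n \<omega>))"
  proof (intro allI)
    fix m n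
    show "\<exists>E. E \<in> events \<and> prob E \<le> C * exp (- c * real (m + n)) \<and> (m \<ge> L \<longrightarrow> n \<ge> L \<longrightarrow> (\<forall>\<omega>\<in>space M - E. good \<delta> m n \<omega>))"
    proof (cases "m \<ge> L \<and> n \<ge> L")
      case True
      then show ?thesis using ex by blast
    next
      case False
      then show ?thesis using c by (intro exI[of _ "{}"]) auto
    qed
  qed
  then obtain E where E: "\<And>m n. E m n \<in> events" "\<And>m n. prob (E m n) \<le> C * exp (- c * real (m + n))"
    "\<And>m n \<omega>. m \<ge> L \<Longrightarrow> n \<ge> L \<Longrightarrow> \<omega> \<in> space M \<Longrightarrow> \<omega> \<notin> E m n \<Longrightarrow> good \<delta> m n \<omega>"
    by (metis DiffI)
  \<comment> \<open>One event per antidiagonal m + n = N, so that a sequence with a single index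
    enters Borel-Cantelli.\<close>
  define F where "F N = (\<Union>k\<in>{..N}. E k (N - k))" for N
  have F: "F N \<in> events" for N unfolding F_def using E by (intro sets.finite_UN) auto
  have PF: "prob (F N) \<le> (real N + 1) * (C * exp (- c * real N))" for N
  proof -
    have "prob (F N) \<le> (\<Sum>k\<in>{..N}. prob (E k (N - k)))"
      unfolding F_def using E by (intro measure_UNION_le) auto
    also have "\<dots> \<le> (\<Sum>k\<in>{..N}. C * exp (- c * real N))"
      using E(2)[of _ "N - _"] by (intro sum_mono) (metis atMost_iff le_add_diff_inverse)
    finally show ?thesis by (simp add: add.commute)
  qed
  have "AE \<omega> in M. eventually (\<lambda>N. \<omega> \<in> space M - F N) sequentially"
  proof (rule borel_cantelli_AE1[OF F])
    show "emeasure M (F N) < \<infinity>" for N by (simp add: emeasure_eq_measure)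
    show "summable (\<lambda>N. prob (F N))"
      by (rule summable_comparison_test'[OF linear_times_geometric_summable[OF c]]) (use PF in simp)
  qed
  then show ?thesis
  proof eventually_elim
    case (elim \<omega>)
    then obtain N0 where N0: "\<And>N. N \<ge> N0 \<Longrightarrow> \<omega> \<in> space M - F N" unfolding eventually_sequentially by blast
    show ?case
    proof (intro exI[of _ "max L N0"] allI impI)
      fix m n assume mn: "max L N0 \<le> m" "max L N0 \<le> n"
      have "\<omega> \<in> space M - F (m + n)" using mn by (intro N0) auto
      moreover have "E m (m + n - m) \<subseteq> F (m + n)" unfolding F_def by (rule UN_upper) simp
      ultimately have "\<omega> \<in> space M" "\<omega> \<notin> E m n" by auto
      then show "good \<delta> m n \<omega>" using mn by (intro E(3)) auto
    qed
  qed
qed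

end

subsection \<open>Inversion\<close>

text \<open>The height function is the case \<open>(C, D) = (B, A)\<close> with \<open>\<Gamma> k n = G (n, k)\<close>, the flux the case
  \<open>(C, D) = (A, A + B)\<close> with \<open>\<Gamma> k n = G (k + n - 1, n)\<close>. The argument \<open>n - 1\<close> in the lower bound
  leaves room for the shift by one in the latter.\<close>

lemma inversion:
  fixes C D :: "real \<Rightarrow> real" and \<Gamma> :: "nat \<Rightarrow> nat \<Rightarrow> real"
  assumes I: "I \<noteq> {}" and D: "\<And>z. z \<in> I \<Longrightarrow> D z \<ge> D0" "D0 > 0" and C: "\<And>z. z \<in> I \<Longrightarrow> C z \<ge> 0"
    and \<epsilon>: "\<epsilon> > 0" and \<delta>: "\<delta> > 0" "\<delta> \<le> D0 / 8" "\<delta> * (1 + 1 / D0) \<le> \<epsilon> * D0 / 8"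
    and up: "\<And>k n z. k \<ge> L \<Longrightarrow> n \<ge> L \<Longrightarrow> z \<in> I \<Longrightarrow> \<Gamma> k n \<le> real k * C z + real n * D z + \<delta> * real (k + n)"
    and low: "\<And>k n c. k \<ge> L \<Longrightarrow> n \<ge> L \<Longrightarrow> (\<And>z. z \<in> I \<Longrightarrow> c \<le> real k * C z + (real n - 1) * D z) \<Longrightarrow> \<Gamma> k n \<ge> c - \<delta> * real (k + n)"
    and k: "real k * \<epsilon> \<ge> 4 * real L + 8" "k \<ge> L" "k \<ge> 1" and t: "t \<ge> 0"
  shows "\<bar>max (SUP n\<in>{n. n \<ge> 1 \<and> \<Gamma> k n \<le> t}. ereal (real n)) 0 -
      max (SUP z\<in>I. ereal ((t - real k * C z) / D z)) 0\<bar> \<le> ereal (\<epsilon> * (t + real k))"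
proof -
  define q where "q z = (t - real k * C z) / D z" for z
  \<comment> \<open>D \<ge> D0 and C \<ge> 0 bound every q z by t / D0, so the extended supremum
    equals a real one and the estimates can be carried out in the reals.\<close>
  define p where "p = max (SUP z\<in>I. q z) 0"
  have Dpos: "D z > 0" if "z \<in> I" for z using D that by (meson less_le_trans)
  have q_le: "q z \<le> t / D0" if z: "z \<in> I" for z
  proof -
    have "q z \<le> t / D z" unfolding q_def using Dpos[OF z] C[OF z] by (intro divide_right_mono) auto
    also have "\<dots> \<le> t / D0" using D z t Dpos[OF z] by (intro divide_left_mono) auto
    finally show ?thesis .
  qed
  have bdd: "bdd_above (q ` I)" using q_le by (intro bdd_aboveI2)
  have sup_eq: "(SUP z\<in>I. ereal (q z)) = ereal (SUP z\<in>I. q z)"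
  proof (rule ereal_SUP[symmetric])
    obtain z where z: "z \<in> I" using I by blast
    have "ereal (q z) \<le> (SUP z\<in>I. ereal (q z))" using z by (rule SUP_upper)
    moreover have "(SUP z\<in>I. ereal (q z)) \<le> ereal (t / D0)" using q_le by (intro SUP_least) simp
    ultimately show "\<bar>SUP z\<in>I. ereal (q z)\<bar> \<noteq> \<infinity>" by auto
  qed
  have p_eq: "max (SUP z\<in>I. ereal ((t - real k * C z) / D z)) 0 = ereal p"
    unfolding q_def[symmetric] sup_eq p_def by (simp add: max_def zero_ereal_def)
  have p0: "p \<ge> 0" by (simp add: p_def)
  have qp: "q z \<le> p" if "z \<in> I" for z
    unfolding p_def using cSUP_upper[OF that bdd] by simp
  have pt: "p \<le> t / D0" unfolding p_def using q_le I t D by (auto intro!: cSUP_least)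
  define e where "e = \<epsilon> * (t + real k)"
  have e_big: "e \<ge> 4 * real L + 8"   proof -
    have "\<epsilon> * t \<ge> 0" using \<epsilon> t by simp
    then show ?thesis using k(1) unfolding e_def distrib_left by (simp add: mult.commute)
  qed
  have upper: "real n \<le> p + e" if n: "n \<ge> 1" "\<Gamma> k n \<le> t" for n
  proof (rule ccontr)
    assume "\<not> real n \<le> p + e"
    then have big: "real n > p + e" by simp
    then have nL: "n \<ge> L" using e_big p0 by linarith
    \<comment> \<open>One less than n, to match the lower hypothesis; since e \<ge> 8, the lost unit
      is covered by half of the excess e.\<close>
    define x where "x = real n - 1"
    have x: "x \<ge> p + e / 2" using big e_big by (simp add: x_def)
    have x0: "x \<ge> 0" using x p0 e_big by linarith
    \<comment> \<open>Two lower bounds for the mean. As \<Gamma> need not be monotone in n,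
      arbitrarily large n must be excluded too, and there the error \<delta> (k + n) grows with n.
      The first bound wins while x is at most 2 t / D0 + e; beyond that the second wins, because
      \<delta> \<le> D0 / 8.\<close>
    define c where "c = max (t + e / 2 * D0) (D0 * x)"
    have "c \<le> real k * C z + (real n - 1) * D z" if z: "z \<in> I" for z
    proof -
      have "t - real k * C z = q z * D z" using Dpos[OF z] by (simp add: q_def)
      also have "\<dots> \<le> p * D z" using qp[OF z] Dpos[OF z] by (intro mult_right_mono) auto
      finally have "t \<le> real k * C z + p * D z" by simp
      moreover have "e / 2 * D0 \<le> e / 2 * D z" using D z e_big by (intro mult_left_mono) auto
      moreover have "(p + e / 2) * D z \<le> x * D z" using x Dpos[OF z] by (intro mult_right_mono) auto
      ultimately have "t + e / 2 * D0 \<le> real k * C z + x * D z" by (simp add: distrib_right)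
      moreover have "D0 * x \<le> x * D z" using mult_right_mono[OF D(1)[OF z] x0] by (simp add: mult.commute)
      moreover have "real k * C z \<ge> 0" using C[OF z] by simp
      ultimately show ?thesis by (simp add: c_def x_def)
    qed
    then have "\<Gamma> k n \<ge> c - \<delta> * real (k + n)" using k nL by (intro low)
    moreover have "c - \<delta> * real (k + n) > t"
    proof -
      have kn: "real (k + n) = real k + x + 1" by (simp add: x_def)
      have "1 \<le> real k" using k by simp
      have s: "\<delta> * real (k + n) \<le> \<delta> * (2 * real k + x)" unfolding kn using \<delta> \<open>1 \<le> real k\<close> by (intro mult_left_mono) auto
      show ?thesis
      proof (cases "x \<le> (2 * t + e / 2 * D0 * 2) / D0")
        case True
        have "\<delta> * (2 * real k + x) \<le> \<delta> * (2 * real k + (2 * t / D0 + e))"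
          using True D \<delta> by (intro mult_left_mono) (auto simp: add_divide_distrib)
        also have "\<dots> = \<delta> * (2 * real k + 2 * t / D0) + \<delta> * e" by (simp add: algebra_simps)
        also have "\<delta> * e \<le> D0 / 8 * e" using \<delta> e_big by (intro mult_right_mono) auto
        also have "\<delta> * (2 * real k + 2 * t / D0) \<le> \<delta> * (2 * (1 + 1 / D0) * (t + real k))"
        proof (intro mult_left_mono)
          have "0 \<le> 2 * t + 2 * real k / D0" using t D by simp
          then show "2 * real k + 2 * t / D0 \<le> 2 * (1 + 1 / D0) * (t + real k)" by (simp add: algebra_simps add_divide_distrib)
        qed (use \<delta> in auto)
        also have "\<dots> = 2 * (\<delta> * (1 + 1 / D0)) * (t + real k)" by simp
        also have "\<dots> \<le> 2 * (\<epsilon> * D0 / 8) * (t + real k)" using \<delta>(3) t by (intro mult_right_mono mult_left_mono) auto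
        also have "\<dots> = D0 / 4 * e" by (simp add: e_def)
        finally have "\<delta> * (2 * real k + x) \<le> 3 / 8 * (e * D0)" by (simp add: mult.commute)
        moreover have "e * D0 > 0" using e_big D by simp
        moreover have "c \<ge> t + e / 2 * D0" by (simp add: c_def)
        moreover have "e / 2 * D0 = 1 / 2 * (e * D0)" by simp
        ultimately show ?thesis using s by linarith
      next
        case False
        then have "2 * t + e * D0 < D0 * x" using D by (simp add: field_simps)
        moreover have "c \<ge> D0 * x" by (simp add: c_def)
        moreover have "\<delta> * x \<le> D0 / 8 * x" using \<delta> x0 by (intro mult_right_mono) auto
        moreover have "\<delta> * (2 * real k) \<le> D0 / 4 * e"
        proof -
          have "\<delta> * (2 * real k) \<le> 2 * (\<delta> * (1 + 1 / D0)) * (t + real k)"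
          proof -
            have "\<delta> * real k \<le> \<delta> * (1 + 1 / D0) * (t + real k)" using \<delta> D t by (intro mult_mono) auto
            then show ?thesis by linarith
          qed
          also have "\<dots> \<le> 2 * (\<epsilon> * D0 / 8) * (t + real k)" using \<delta>(3) t by (intro mult_right_mono mult_left_mono) auto
          also have "\<dots> = D0 / 4 * e" by (simp add: e_def)
          finally show ?thesis .
        qed
        moreover have "\<delta> * (2 * real k + x) = \<delta> * (2 * real k) + \<delta> * x" by (simp add: algebra_simps)
        moreover have "e * D0 > 0" using e_big D by simp
        moreover have "D0 / 8 * x = 1 / 8 * (D0 * x)" "D0 / 4 * e = 1 / 4 * (e * D0)" by simp_all
        ultimately show ?thesis using s t by linarith
      qed
    qed
    ultimately show False using n by linarith
  qed
  have lower: "\<exists>n\<ge>1. \<Gamma> k n \<le> t \<and> p - e \<le> real n" if pe: "p > e"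
  proof -
    \<comment> \<open>A witness e / 2 below p: the near-optimal z loses only e / 4 of this, and the
      remaining e / 4 * D0 pays the error. Since p > e, it also exceeds e / 2 - 1, hence both 1 and
      L.\<close>
    define n where "n = nat \<lfloor>p - e / 2\<rfloor>"
    have pe0: "p - e / 2 \<ge> 0" using pe e_big by linarith
    have n: "real n \<le> p - e / 2" "real n > p - e / 2 - 1"
      using pe0 unfolding n_def by linarith+
    have n': "n \<ge> 1" "n \<ge> L" "p - e \<le> real n" using n e_big pe by linarith+
    have "p - e / 4 < (SUP z\<in>I. q z)" using pe e_big by (auto simp: p_def max_def split: if_splits)
    then obtain z where z: "z \<in> I" "p - e / 4 < q z" using less_cSUP_iff[OF I bdd] by auto
    have "(p - e / 4) * D z \<le> t - real k * C z"
    proof -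
      have "(p - e / 4) * D z \<le> q z * D z" using z Dpos[OF z(1)] by (intro mult_right_mono) auto
      also have "\<dots> = t - real k * C z" using Dpos[OF z(1)] by (simp add: q_def)
      finally show ?thesis .
    qed
    moreover have "real n * D z \<le> (p - e / 2) * D z" using n Dpos[OF z(1)] by (intro mult_right_mono) auto
    moreover have "e / 4 * D0 \<le> e / 4 * D z" using D z e_big by (intro mult_left_mono) auto
    ultimately have "real k * C z + real n * D z \<le> t - e / 4 * D0" by (simp add: algebra_simps)
    moreover have "\<delta> * real (k + n) \<le> e / 4 * D0"
    proof -
      have "real n \<le> t / D0" using n pt e_big by linarith
      then have "\<delta> * real (k + n) \<le> \<delta> * (real k + t / D0)" using \<delta> by (intro mult_left_mono) auto
      also have "\<dots> \<le> \<delta> * ((1 + 1 / D0) * (t + real k))"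
      proof (intro mult_left_mono)
        have "0 \<le> t + real k / D0" using t D by simp
        then show "real k + t / D0 \<le> (1 + 1 / D0) * (t + real k)" by (simp add: algebra_simps add_divide_distrib)
      qed (use \<delta> in auto)
      also have "\<dots> = (\<delta> * (1 + 1 / D0)) * (t + real k)" by simp
      also have "\<dots> \<le> \<epsilon> * D0 / 8 * (t + real k)" using \<delta>(3) t by (intro mult_right_mono) auto
      also have "\<dots> \<le> e / 4 * D0" using \<epsilon> D t by (simp add: e_def field_simps)
      finally show ?thesis .
    qed
    ultimately have "\<Gamma> k n \<le> t" using up[OF k(2) n'(2) z(1)] by linarith
    then show ?thesis using n' by blast
  qed
  define H where "H = max (SUP n\<in>{n. n \<ge> 1 \<and> \<Gamma> k n \<le> t}. ereal (real n)) 0"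
  have H_le: "H \<le> ereal (p + e)"
    unfolding H_def using upper p0 e_big by (auto intro!: SUP_least simp: zero_ereal_def)
  have H_ge: "H \<ge> ereal (p - e)"
  proof (cases "p > e")
    case True
    then obtain n where n: "n \<ge> 1" "\<Gamma> k n \<le> t" "p - e \<le> real n" using lower by blast
    have "ereal (p - e) \<le> ereal (real n)" using n by simp
    also have "\<dots> \<le> H" unfolding H_def using n by (intro max.coboundedI1 SUP_upper) auto
    finally show ?thesis .
  next
    case False
    then have "ereal (p - e) \<le> 0" by (simp add: zero_ereal_def)
    also have "\<dots> \<le> H" by (simp add: H_def)
    finally show ?thesis .
  qed
  have "\<bar>H\<bar> \<noteq> \<infinity>" using H_le H_ge by auto
  then obtain h where h: "H = ereal h" by auto
  show ?thesis unfolding H_def[symmetric] p_eq e_def[symmetric] using H_le H_ge unfolding h by (simp add: abs_le_iff)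
qed

theorem theorem3p10:
  fixes a b :: "nat \<Rightarrow> nat \<Rightarrow> real"
    and \<alpha> \<beta> :: "real measure"
    and \<aa> \<bb> :: ereal
    and \<omega> :: "nat \<Rightarrow> nat \<Rightarrow> nat \<times> nat \<Rightarrow> (nat \<times> nat \<Rightarrow> real) \<Rightarrow> real"
    and \<epsilon> :: real
  defines "G \<equiv> \<lambda>x m n. last_passage (\<lambda>p. \<omega> m n p x) m n"
  assumes pos: "\<And>m n i j. m \<ge> 1 \<Longrightarrow> n \<ge> 1 \<Longrightarrow> i \<in> {1..m} \<Longrightarrow> j \<in> {1..n} \<Longrightarrow> a m i + b n j > 0"
    and indep: "\<And>m n. m \<ge> 1 \<Longrightarrow> n \<ge> 1 \<Longrightarrow>
          prob_space.indep_vars exp_product_space (\<lambda>_. borel) (\<omega> m n) ({1..m} \<times> {1..n})"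
    and exp_dist: "\<And>m n i j. m \<ge> 1 \<Longrightarrow> n \<ge> 1 \<Longrightarrow> i \<in> {1..m} \<Longrightarrow> j \<in> {1..n} \<Longrightarrow>
          distributed exp_product_space lborel (\<omega> m n (i, j)) (exponential_density (a m i + b n j))"
    and \<alpha>: "subprob_space \<alpha>" "sets \<alpha> = sets borel" "emeasure \<alpha> (space \<alpha>) \<noteq> 0"
    and \<beta>: "subprob_space \<beta>" "sets \<beta> = sets borel" "emeasure \<beta> (space \<beta>) \<noteq> 0"
    and conv_\<alpha>: "vague_conv (empirical_distribution a) \<alpha>"
    and conv_\<beta>: "vague_conv (empirical_distribution b) \<beta>"
    and \<aa>_\<bb>: "\<aa> \<noteq> -\<infinity>" "\<bb> \<noteq> -\<infinity>" "\<aa> + \<bb> > 0"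
    and min_a: "(\<lambda>m. ereal (min_param a m)) \<longlonglongrightarrow> \<aa>"
    and min_b: "(\<lambda>n. ereal (min_param b n)) \<longlonglongrightarrow> \<bb>"
    and \<epsilon>: "\<epsilon> > 0"
  shows "AE x in exp_product_space. \<exists>L\<ge>1. \<forall>m\<ge>L. \<forall>n\<ge>L. \<forall>t\<ge>0.
           \<bar>height_process (G x) n t - limit_height \<alpha> \<beta> \<aa> \<bb> (real n) t\<bar> \<le> ereal (\<epsilon> * (t + real n)) \<and>
           \<bar>particle_process (G x) n t - limit_height \<alpha> \<beta> \<aa> \<bb> (real n) t + ereal (real n)\<bar>
             \<le> ereal (\<epsilon> * (t + real n)) \<and>
           \<bar>flux_process (G x) m t - limit_flux \<alpha> \<beta> \<aa> \<bb> (real m) t\<bar> \<le> ereal (\<epsilon> * (t + real m))"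
proof -
  interpret P: prob_space exp_product_space by (rule prob_space_exp_product_space)
  have indep_exp: "indep_exp exp_product_space (\<omega> m n) ({1..m}\<times>{1..n}) (\<lambda>p. a m (fst p) + b n (snd p))"
    if "m \<ge> 1" "n \<ge> 1" for m n
    unfolding indep_exp_def using pos[OF that] exp_dist[OF that] indep[OF that] P.prob_space_axioms by auto
  interpret arr: lpp_arrays a b \<alpha> \<beta> \<aa> \<bb> exp_product_space \<omega>
    by (intro lpp_arrays.intro lpp_arrays_axioms.intro vague_array.intro)
      (use \<alpha> \<beta> conv_\<alpha> conv_\<beta> \<aa>_\<bb> min_a min_b indep_exp in blast)+
  have AE_nonneg: "AE x in exp_product_space. \<forall>m n. m \<ge> 1 \<longrightarrow> n \<ge> 1 \<longrightarrow> (\<forall>p\<in>{1..m}\<times>{1..n}. \<omega> m n p x \<ge> 0)"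
    unfolding AE_all_countable
  proof (intro allI)
    fix m n :: nat
    show "AE x in exp_product_space. m \<ge> 1 \<longrightarrow> n \<ge> 1 \<longrightarrow> (\<forall>p\<in>{1..m}\<times>{1..n}. \<omega> m n p x \<ge> 0)"
    proof (cases "m \<ge> 1 \<and> n \<ge> 1")
      case True
      then have "AE x in exp_product_space. \<forall>p\<in>{1..m}\<times>{1..n}. \<omega> m n p x \<ge> 0"
        by (intro indep_exp_AE_nonneg[OF indep_exp]) auto
      then show ?thesis by eventually_elim simp
    qed auto
  qed
  define A where "A = inv_moment \<alpha> 1"
  define B where "B z = inv_moment \<beta> 1 (- z)" for z
  \<comment> \<open>A is decreasing, so its value at the right end of the interval bounds it from
    below. That end lies strictly to the right of - A.lo, so the value is positive.\<close>
  define D0 where "D0 = inv_moment \<alpha> 1 arr.B.lo"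
  have D0: "D0 > 0" unfolding D0_def using arr.lo_gap by (intro arr.A.inv_moment_pos) auto
  have AD: "A z \<ge> D0" and B0: "B z \<ge> 0" if "z \<in> arr.I" for z
    using that arr.B.inv_moment_pos[of "- z" 1]
    by (auto simp: A_def B_def D0_def arr.I_def intro!: arr.A.inv_moment_antimono)
  have I_ne: "arr.I \<noteq> {}" using arr.lo_gap by (auto simp: arr.I_def)
  have I_eq: "{z. - \<aa> < ereal z \<and> ereal z < \<bb>} = arr.I"
  proof -
    have "- \<aa> < ereal z \<longleftrightarrow> - arr.A.lo < z" for z by (subst arr.A.\<aa>_eq) simp
    then show ?thesis
      by (simp only: arr.I_def set_eq_iff mem_Collect_eq greaterThanLessThan_iff arr.B.less_lo_iff simp_thms)
  qed
  have transforms: "A_transform \<alpha> = A" "B_transform \<beta> = B"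
    by (auto simp: A_def B_def A_transform_def B_transform_def inv_moment_def)
  have height_eq: "limit_height \<alpha> \<beta> \<aa> \<bb> y t = max (SUP z\<in>arr.I. ereal ((t - y * B z) / A z)) 0" for y t
    unfolding limit_height_def I_eq transforms ..
  have flux_eq: "limit_flux \<alpha> \<beta> \<aa> \<bb> y t = max (SUP z\<in>arr.I. ereal ((t - y * A z) / (A z + B z))) 0" for y t
    unfolding limit_flux_def I_eq transforms ..
  \<comment> \<open>The spare half of \<epsilon> absorbs the summand 1 in the particle process, as
    \<epsilon>' n is at least 8 for the n considered.\<close>
  define \<epsilon>' where "\<epsilon>' = \<epsilon> / 2"
  have \<epsilon>': "\<epsilon>' > 0" using \<epsilon> by (simp add: \<epsilon>'_def)
  define \<delta> where "\<delta> = min (D0 / 8) (\<epsilon>' * D0 / 8 / (1 + 1 / D0))"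
  have c0: "1 + 1 / D0 > 0" using D0 by (intro add_pos_pos) auto
  have \<delta>: "\<delta> > 0" "\<delta> \<le> D0 / 8" "\<delta> * (1 + 1 / D0) \<le> \<epsilon>' * D0 / 8"
  proof -
    show "\<delta> > 0" using D0 \<epsilon>' c0 by (simp add: \<delta>_def)
    have "\<delta> \<le> \<epsilon>' * D0 / 8 / (1 + 1 / D0)" by (simp add: \<delta>_def)
    then show "\<delta> * (1 + 1 / D0) \<le> \<epsilon>' * D0 / 8" using c0 by (simp only: pos_le_divide_eq)
  qed (unfold \<delta>_def, rule min.cobounded1)
  \<comment> \<open>Half of \<delta>, because the flux evaluates the passage time at (k + n - 1, n),
    whose coordinates sum to less than 2 (k + n).\<close>
  from AE_nonneg arr.AE_good[OF half_gt_zero[OF \<delta>(1)]] show ?thesis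
  proof eventually_elim
    case (elim x)
    then obtain L0 where L0: "\<And>m n. m \<ge> L0 \<Longrightarrow> n \<ge> L0 \<Longrightarrow> arr.good (\<delta> / 2) m n x" by blast
    define L1 where "L1 = max 1 L0"
    have G_eq: "G x m n = arr.T m n x" if "m \<ge> 1" "n \<ge> 1" for m n
      unfolding G_def using elim(1) that by (intro last_passage_eq_bulk) auto
    have G_low: "\<exists>z\<in>arr.I. G x m n \<ge> real m * A z + real n * B z - \<delta> / 2 * real (m + n)"
      and G_up: "z \<in> arr.I \<Longrightarrow> G x m n \<le> real m * A z + real n * B z + \<delta> / 2 * real (m + n)"
      if "m \<ge> L1" "n \<ge> L1" for m n z
    proof -
      have "m \<ge> L0" "n \<ge> L0" "m \<ge> 1" "n \<ge> 1" using that by (auto simp: L1_def)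
      then show "\<exists>z\<in>arr.I. G x m n \<ge> real m * A z + real n * B z - \<delta> / 2 * real (m + n)"
        "z \<in> arr.I \<Longrightarrow> G x m n \<le> real m * A z + real n * B z + \<delta> / 2 * real (m + n)"
        using L0[of m n] unfolding arr.good_def A_def B_def G_eq[OF \<open>m \<ge> 1\<close> \<open>n \<ge> 1\<close>] by blast+
    qed
    define L where "L = nat \<lceil>(4 * real L1 + 8) / \<epsilon>'\<rceil> + L1"
    have big: "real k * \<epsilon>' \<ge> 4 * real L1 + 8" "k \<ge> L1" "k \<ge> 1" if "k \<ge> L" for k
    proof -
      have "real k \<ge> (4 * real L1 + 8) / \<epsilon>'" using that unfolding L_def by linarith
      then show "real k * \<epsilon>' \<ge> 4 * real L1 + 8" using \<epsilon>' by (simp add: pos_divide_le_eq)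
    qed (use that in \<open>auto simp: L_def L1_def\<close>)
    have height: "\<bar>height_process (G x) n t - limit_height \<alpha> \<beta> \<aa> \<bb> (real n) t\<bar> \<le> ereal (\<epsilon>' * (t + real n))"
      if n: "n \<ge> L" and t: "t \<ge> 0" for n t
      unfolding height_process_def height_eq
    proof (rule inversion[where L=L1 and \<Gamma>="\<lambda>k n. G x n k", OF I_ne AD D0 B0 \<epsilon>' \<delta>])
      fix k n z assume kn: "L1 \<le> k" "L1 \<le> n" and z: "z \<in> arr.I"
      have "\<delta> / 2 * real (n + k) \<le> \<delta> * real (k + n)" using \<delta> by (simp add: add.commute)
      then show "G x n k \<le> real k * B z + real n * A z + \<delta> * real (k + n)"
        using G_up[OF kn(2,1) z] by linarith
    next
      fix k n c assume kn: "L1 \<le> k" "L1 \<le> n" and c: "\<And>z. z \<in> arr.I \<Longrightarrow> c \<le> real k * B z + (real n - 1) * A z"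
      obtain z where z: "z \<in> arr.I" "G x n k \<ge> real n * A z + real k * B z - \<delta> / 2 * real (n + k)"
        using G_low[OF kn(2,1)] by blast
      have "\<delta> / 2 * real (n + k) \<le> \<delta> * real (k + n)" using \<delta> by (simp add: add.commute)
      moreover have "(real n - 1) * A z = real n * A z - A z" by (simp add: left_diff_distrib)
      ultimately show "c - \<delta> * real (k + n) \<le> G x n k" using z c[OF z(1)] AD[OF z(1)] D0 by linarith
    qed (use big[OF n] t in auto)
    have flux: "\<bar>flux_process (G x) n t - limit_flux \<alpha> \<beta> \<aa> \<bb> (real n) t\<bar> \<le> ereal (\<epsilon>' * (t + real n))"
      if n: "n \<ge> L" and t: "t \<ge> 0" for n t
      unfolding flux_process_def flux_eq
    proof (rule inversion[where L=L1 and \<Gamma>="\<lambda>k n. G x (k + n - 1) n", OF I_ne _ D0 _ \<epsilon>' \<delta>])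
      show "D0 \<le> A z + B z" "0 \<le> A z" if "z \<in> arr.I" for z
        using AD[OF that] B0[OF that] D0 by auto
    next
      fix k n z assume kn: "L1 \<le> k" "L1 \<le> n" and z: "z \<in> arr.I"
      have k1: "k + n - 1 \<ge> L1" "k \<ge> 1" using kn by (auto simp: L1_def)
      have "\<delta> / 2 * real (k + n - 1 + n) \<le> \<delta> / 2 * (2 * real (k + n))" using \<delta> k1 by (intro mult_left_mono) auto
      moreover have "real (k + n - 1) * A z \<le> (real k + real n) * A z"
        using AD[OF z] D0 k1 by (intro mult_right_mono) auto
      ultimately show "G x (k + n - 1) n \<le> real k * A z + real n * (A z + B z) + \<delta> * real (k + n)"
        using G_up[OF k1(1) kn(2) z] by (simp add: algebra_simps)
    next
      fix k n c assume kn: "L1 \<le> k" "L1 \<le> n" and c: "\<And>z. z \<in> arr.I \<Longrightarrow> c \<le> real k * A z + (real n - 1) * (A z + B z)"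
      have k1: "k + n - 1 \<ge> L1" "k \<ge> 1" using kn by (auto simp: L1_def)
      obtain z where z: "z \<in> arr.I" "G x (k + n - 1) n \<ge> real (k + n - 1) * A z + real n * B z - \<delta> / 2 * real (k + n - 1 + n)"
        using G_low[OF k1(1) kn(2)] by blast
      have "\<delta> / 2 * real (k + n - 1 + n) \<le> \<delta> / 2 * (2 * real (k + n))" using \<delta> k1 by (intro mult_left_mono) auto
      \<comment> \<open>The shift by one falls exactly into place: k A + (n - 1) (A + B) is (k + n -
        1) A + (n - 1) B, short of the mean by B \<ge> 0 only.\<close>
      moreover have "real (k + n - 1) * A z = real k * A z + (real n - 1) * A z" using k1 by (simp add: of_nat_diff algebra_simps)
      moreover have "(real n - 1) * (A z + B z) = (real n - 1) * A z + real n * B z - B z" by (simp add: algebra_simps)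
      ultimately show "c - \<delta> * real (k + n) \<le> G x (k + n - 1) n" using z c[OF z(1)] B0[OF z(1)] by linarith
    qed (use big[OF n] t in auto)
    show ?case
    proof (rule exI[of _ L], intro conjI allI impI)
      show "L \<ge> 1" by (simp add: L_def L1_def)
      fix m n t assume mn: "L \<le> m" "L \<le> n" and t: "(0::real) \<le> t"
      have half: "\<epsilon>' * (t + real k) \<le> \<epsilon> * (t + real k)" for k
        using \<epsilon> t by (intro mult_right_mono) (auto simp: \<epsilon>'_def)
      show "\<bar>height_process (G x) n t - limit_height \<alpha> \<beta> \<aa> \<bb> (real n) t\<bar> \<le> ereal (\<epsilon> * (t + real n))"
        using height[OF mn(2) t] half[of n] by (meson ereal_less_eq(3) order_trans)
      show "\<bar>flux_process (G x) m t - limit_flux \<alpha> \<beta> \<aa> \<bb> (real m) t\<bar> \<le> ereal (\<epsilon> * (t + real m))"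
        using flux[OF mn(1) t] half[of m] by (meson ereal_less_eq(3) order_trans)
      \<comment> \<open>Both values are nonnegative and their difference has a real bound; with
        \<infinity> - \<infinity> = \<infinity> this forces them to be finite, and the particle
        estimate becomes one in the reals.\<close>
      have nn: "height_process (G x) n t \<ge> 0" "limit_height \<alpha> \<beta> \<aa> \<bb> (real n) t \<ge> 0"
        by (auto simp: height_process_def limit_height_def)
      then obtain h l where h: "height_process (G x) n t = ereal h" and l: "limit_height \<alpha> \<beta> \<aa> \<bb> (real n) t = ereal l"
        using height[OF mn(2) t]
        by (cases "height_process (G x) n t"; cases "limit_height \<alpha> \<beta> \<aa> \<bb> (real n) t") auto
      have "\<bar>h - l\<bar> \<le> \<epsilon>' * (t + real n)" using height[OF mn(2) t] unfolding h l by simp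
      moreover have "\<epsilon>' * (t + real n) + 1 \<le> \<epsilon> * (t + real n)"
      proof -
        have "\<epsilon> * (t + real n) = 2 * (\<epsilon>' * (t + real n))" by (simp add: \<epsilon>'_def)
        moreover have "\<epsilon>' * (t + real n) = \<epsilon>' * t + real n * \<epsilon>'" by (simp add: algebra_simps)
        moreover have "\<epsilon>' * t \<ge> 0" using \<epsilon>' t by simp
        ultimately show ?thesis using big(1)[OF mn(2)] by linarith
      qed
      ultimately show "\<bar>particle_process (G x) n t - limit_height \<alpha> \<beta> \<aa> \<bb> (real n) t + ereal (real n)\<bar> \<le> ereal (\<epsilon> * (t + real n))"
        unfolding particle_process_def h l by (simp add: one_ereal_def)
    qed
  qed
qed

end
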